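(* Let $\alpha\in(-1,1)$, $X_0\in\mathbb{R}$, and let $a,b>0$. Set $$F_{a,b}(x)=\begin{cases}-|x+a|^{\frac1{1-\alpha}},& x<-a,\\ 0,& -a\le x\le b,\\ |x-b|^{\frac1{1-\alpha}},& x>b,\end{cases}\qquad X^{a,b}_t=F_{a,b}\big((1-\alpha)B_t+(X_0)^{1-\alpha}\big),\quad t\ge0.$$ Then the process $X^{a,b}$ is a strong solution of the equation $X_t=X_0+\int_0^t|X_s|^\alpha\circ\mathrm{d}B_s$.
   Context: $B$ is a standard continuous Brownian motion on a filtered probability space satisfying the usual assumptions. Powers: $\operatorname{sign}0=0$; for $\alpha\in\mathbb{R}$, $|x|^\alpha$ is the usual power for $x\ne0$ and $|0|^\alpha:=0$ (so $|x|^0=\mathbf 1_{x\neq 0}$); the signed power is $(x)^\gamma:=|x|^\gamma\operatorname{sign}x$. Integrals: let $D_n=\{0=t_0^n<t_1^n<\dots\}$ be partitions of $[0,\infty)$ with finitely many points in each $[0,t]$ and mesh tending to $0$. Limits are in u.c.p. (uniformly on compact time intervals in probability). The It\^o integral is $\int_0^t X_s\,\mathrm{d}Y_s=\lim_n\sum_{t_k<t}X_{t_k}(Y_{t_{k+1}}-Y_{t_k})$; the covariation is $[X,Y]_t=\lim_n\sum_{t_k<t}(X_{t_{k+1}}-X_{t_k})(Y_{t_{k+1}}-Y_{t_k})$; the Stratonovich integral is $\int_0^tX_s\circ \mathrm{d}Y_s=\int_0^tX_s\,\mathrm{d}Y_s+\frac12[X,Y]_t$, provided both exist. A strong solution of $X_t=X_0+\int_0^t|X_s|^\alpha\circ\mathrm{d}B_s$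 is a continuous process $X$, adapted to the augmented natural filtration of $B$, such that for every $t\ge0$ the It\^o integral $\int_0^t|X_s|^\alpha\,\mathrm{d}B_s$ and the covariation $[|X|^\alpha,B]_t$ exist and the equation holds $\mathbf{P}$-a.s.
   Formalization: The equation's initial value is taken as F_{a,b}((X_0)^{1-α}), since the printed claim fails at t=0 unless X_0=0; if α<0 and (X_0)^{1-α} equals b or -a, the ratios t_{k+1}/t_k (k≥1) of the partitions are also assumed bounded. *)

theory Defs
  imports "HOL-Probability.Probability"
begin

text \<open>Time is \<open>real\<close>, restricted to \<open>t \<ge> 0\<close>; a process is a function \<open>real \<Rightarrow> 'w \<Rightarrow> real\<close> (time, then
  sample point) whose values at negative times play no role.  The library locale \<open>filtration\<close> speaks
  about all times of the index type; a filtration on the half line is extended to negative times by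
  its value at time \<open>0\<close>.\<close>

locale usual_filtered_prob_space =
  prob_space M + complete_measure M + filtration "space M" F
  for M :: "'w measure" and F :: "real \<Rightarrow> 'w measure" +
  assumes sets_F_subset: "0 \<le> t \<Longrightarrow> sets (F t) \<subseteq> sets M"
    and null_sets_F: "null_sets M \<subseteq> sets (F 0)"
    and right_continuous_F: "0 \<le> t \<Longrightarrow> sets (F t) = (\<Inter>s\<in>{t<..}. sets (F s))"

definition adapted :: "(real \<Rightarrow> 'w measure) \<Rightarrow> (real \<Rightarrow> 'w \<Rightarrow> real) \<Rightarrow> bool" where
  "adapted F X \<longleftrightarrow> (\<forall>t\<ge>0. X t \<in> borel_measurable (F t))"

definition continuous_process :: "'w measure \<Rightarrow> (real \<Rightarrow> 'w \<Rightarrow> real) \<Rightarrow> bool" where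
  "continuous_process M X \<longleftrightarrow> (\<forall>\<omega>\<in>space M. continuous_on {0..} (\<lambda>t. X t \<omega>))"

locale brownian_motion = usual_filtered_prob_space M F
  for M :: "'w measure" and F :: "real \<Rightarrow> 'w measure" +
  fixes B :: "real \<Rightarrow> 'w \<Rightarrow> real"
  assumes B_adapted: "adapted F B"
    and B_continuous: "continuous_process M B"
    and B_start: "AE \<omega> in M. B 0 \<omega> = 0"
    and B_indep_increments: "0 \<le> s \<Longrightarrow> s < t \<Longrightarrow>
      indep_set (sets (F s)) (sets (vimage_algebra (space M) (\<lambda>\<omega>. B t \<omega> - B s \<omega>) borel))"
    and B_normal_increments: "0 \<le> s \<Longrightarrow> s < t \<Longrightarrow>
      distributed M lborel (\<lambda>\<omega>. B t \<omega> - B s \<omega>) (normal_density 0 (sqrt (t - s)))"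

text \<open>The \<open>\<sigma>\<close>-algebra generated by \<open>B\<^sub>s\<close>, \<open>0 \<le> s \<le> t\<close>, and the null sets of \<open>M\<close>.\<close>

definition augmented_natural :: "'w measure \<Rightarrow> (real \<Rightarrow> 'w \<Rightarrow> real) \<Rightarrow> real \<Rightarrow> 'w measure" where
  "augmented_natural M B t =
    sigma (space M) ({B s -` A \<inter> space M | s A. 0 \<le> s \<and> s \<le> t \<and> A \<in> sets borel} \<union> null_sets M)"

text \<open>\<open>D n k\<close> is the \<open>k\<close>-th point of the \<open>n\<close>-th partition.  A partition of the half line with
  mesh tending to \<open>0\<close> has infinitely many points, and having finitely many in each \<open>[0,t]\<close>
  means that they tend to infinity.\<close>

definition partition_sequence :: "(nat \<Rightarrow> nat \<Rightarrow> real) \<Rightarrow> bool" where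
  "partition_sequence D \<longleftrightarrow>
    (\<forall>n. D n 0 = 0 \<and> strict_mono (D n) \<and> filterlim (D n) at_top sequentially) \<and>
    (\<forall>\<epsilon>>0. \<forall>\<^sub>F n in sequentially. \<forall>k. D n (Suc k) - D n k < \<epsilon>)"

text \<open>Uniform convergence on compact time intervals in probability.  The event that the supremum of
  \<open>\<bar>X\<^sup>n\<^sub>s - X\<^sub>s\<bar>\<close> over \<open>s \<in> [0,T]\<close> exceeds \<open>\<epsilon>\<close> is a union over uncountably many \<open>s\<close> and need not be
  measurable (\<open>measure\<close> would then return \<open>0\<close>), so its outer probability is required to vanish.\<close>

definition ucp_limit ::
  "'w measure \<Rightarrow> (nat \<Rightarrow> real \<Rightarrow> 'w \<Rightarrow> real) \<Rightarrow> (real \<Rightarrow> 'w \<Rightarrow> real) \<Rightarrow> bool" where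
  "ucp_limit M Xn X \<longleftrightarrow>
    (\<forall>t\<ge>0. X t \<in> borel_measurable M) \<and>
    (\<forall>T\<ge>0. \<forall>\<epsilon>>0. \<exists>A. (\<forall>n. A n \<in> sets M \<and>
        {\<omega> \<in> space M. \<exists>s\<in>{0..T}. \<epsilon> < \<bar>Xn n s \<omega> - X s \<omega>\<bar>} \<subseteq> A n) \<and>
      (\<lambda>n. measure M (A n)) \<longlonglongrightarrow> 0)"

definition has_ito_integral ::
  "'w measure \<Rightarrow> (nat \<Rightarrow> nat \<Rightarrow> real) \<Rightarrow> (real \<Rightarrow> 'w \<Rightarrow> real) \<Rightarrow> (real \<Rightarrow> 'w \<Rightarrow> real) \<Rightarrow>
    (real \<Rightarrow> 'w \<Rightarrow> real) \<Rightarrow> bool" where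
  "has_ito_integral M D X Y I \<longleftrightarrow>
    ucp_limit M (\<lambda>n t \<omega>. \<Sum>k | D n k < t. X (D n k) \<omega> * (Y (D n (Suc k)) \<omega> - Y (D n k) \<omega>)) I"

definition has_covariation ::
  "'w measure \<Rightarrow> (nat \<Rightarrow> nat \<Rightarrow> real) \<Rightarrow> (real \<Rightarrow> 'w \<Rightarrow> real) \<Rightarrow> (real \<Rightarrow> 'w \<Rightarrow> real) \<Rightarrow>
    (real \<Rightarrow> 'w \<Rightarrow> real) \<Rightarrow> bool" where
  "has_covariation M D X Y C \<longleftrightarrow>
    ucp_limit M (\<lambda>n t \<omega>. \<Sum>k | D n k < t.
      (X (D n (Suc k)) \<omega> - X (D n k) \<omega>) * (Y (D n (Suc k)) \<omega> - Y (D n k) \<omega>)) C"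

definition has_stratonovich_integral ::
  "'w measure \<Rightarrow> (nat \<Rightarrow> nat \<Rightarrow> real) \<Rightarrow> (real \<Rightarrow> 'w \<Rightarrow> real) \<Rightarrow> (real \<Rightarrow> 'w \<Rightarrow> real) \<Rightarrow>
    (real \<Rightarrow> 'w \<Rightarrow> real) \<Rightarrow> bool" where
  "has_stratonovich_integral M D X Y S \<longleftrightarrow>
    (\<exists>I C. has_ito_integral M D X Y I \<and> has_covariation M D X Y C \<and>
      S = (\<lambda>t \<omega>. I t \<omega> + C t \<omega> / 2))"

text \<open>\<open>X\<close> solves \<open>X\<^sub>t = \<xi> + \<integral>\<^sub>0\<^sup>t \<bar>X\<^sub>s\<bar>\<^sup>\<alpha> \<circ> dB\<^sub>s\<close> with deterministic initial value \<open>\<xi>\<close>.  Since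
  \<open>0 powr \<alpha> = 0\<close> for every real \<open>\<alpha>\<close>, including \<open>\<alpha> \<le> 0\<close>, the term \<open>\<bar>x\<bar> powr \<alpha>\<close> follows the
  convention that the power vanishes at \<open>x = 0\<close>.\<close>

definition strong_solution ::
  "'w measure \<Rightarrow> (nat \<Rightarrow> nat \<Rightarrow> real) \<Rightarrow> (real \<Rightarrow> 'w \<Rightarrow> real) \<Rightarrow> real \<Rightarrow> real \<Rightarrow>
    (real \<Rightarrow> 'w \<Rightarrow> real) \<Rightarrow> bool" where
  "strong_solution M D B \<alpha> \<xi> X \<longleftrightarrow>
    continuous_process M X \<and>
    adapted (augmented_natural M B) X \<and>
    (\<exists>S. has_stratonovich_integral M D (\<lambda>t \<omega>. \<bar>X t \<omega>\<bar> powr \<alpha>) B S \<and>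
      (\<forall>t\<ge>0. AE \<omega> in M. X t \<omega> = \<xi> + S t \<omega>))"

definition signed_power :: "real \<Rightarrow> real \<Rightarrow> real" where
  "signed_power x \<gamma> = \<bar>x\<bar> powr \<gamma> * sgn x"

definition F_ab :: "real \<Rightarrow> real \<Rightarrow> real \<Rightarrow> real \<Rightarrow> real" where
  "F_ab \<alpha> a b x =
    (if x < - a then - (\<bar>x + a\<bar> powr (1 / (1 - \<alpha>)))
     else if x \<le> b then 0
     else \<bar>x - b\<bar> powr (1 / (1 - \<alpha>)))"

definition X_ab ::
  "real \<Rightarrow> real \<Rightarrow> real \<Rightarrow> real \<Rightarrow> (real \<Rightarrow> 'w \<Rightarrow> real) \<Rightarrow> real \<Rightarrow> 'w \<Rightarrow> real" where
  "X_ab \<alpha> a b x0 B t \<omega> = F_ab \<alpha> a b ((1 - \<alpha>) * B t \<omega> + signed_power x0 (1 - \<alpha>))"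

text \<open>\<open>F_ab \<alpha> a b (signed_power x0 (1 - \<alpha>))\<close> is the almost sure value of \<open>X_ab\<close> at time \<open>0\<close>.  It differs
  from \<open>x0\<close> unless \<open>x0 = 0\<close>, so it, and not \<open>x0\<close>, is the initial value of the equation which \<open>X_ab\<close>
  can solve.\<close>

lemma F_ab_start_eq_iff:
  assumes "\<alpha> < 1" "0 < a" "0 < b"
  shows "F_ab \<alpha> a b (signed_power x0 (1 - \<alpha>)) = x0 \<longleftrightarrow> x0 = 0"
proof
  assume "x0 = 0" then show "F_ab \<alpha> a b (signed_power x0 (1 - \<alpha>)) = x0"
    using assms by (simp add: F_ab_def signed_power_def)
next
  assume eq: "F_ab \<alpha> a b (signed_power x0 (1 - \<alpha>)) = x0"
  define y where "y = signed_power x0 (1 - \<alpha>)"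
  have inv: "\<bar>y\<bar> powr (1 / (1 - \<alpha>)) = \<bar>x0\<bar>"
    using assms by (cases "x0 = 0") (auto simp: y_def signed_power_def powr_powr abs_mult)
  have less: "\<bar>F_ab \<alpha> a b y\<bar> < \<bar>x0\<bar>" if "x0 \<noteq> 0"
  proof (cases "y < - a \<or> y > b")
    case True
    then have "\<bar>F_ab \<alpha> a b y\<bar> < \<bar>y\<bar> powr (1 / (1 - \<alpha>))"
      using assms by (auto simp: F_ab_def intro!: powr_less_mono2)
    then show ?thesis using inv by simp
  next
    case False then show ?thesis using that assms by (auto simp: F_ab_def)
  qed
  then show "x0 = 0" using eq by (auto simp: y_def)
qed

text \<open>Bounded ratio of consecutive points, the first point \<open>0\<close> excepted: no partition has points
  that are much closer to \<open>0\<close> than to their successor.  It is needed only when \<open>\<alpha> < 0\<close> and \<open>B\<close> starts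
  at a singularity of \<open>\<bar>X_ab\<bar>\<^sup>\<alpha>\<close> as a function of \<open>B\<close>: the Riemann sums then contain
  \<open>\<bar>X\<^sub>t\<bar>\<^sup>\<alpha> (B\<^sub>u - B\<^sub>t)\<close> with \<open>t\<close>, \<open>u\<close> the second and third points, and this is unbounded in
  probability if \<open>t\<close> tends to \<open>0\<close> too fast compared to \<open>u\<close>.\<close>

definition bounded_ratio :: "(nat \<Rightarrow> nat \<Rightarrow> real) \<Rightarrow> bool" where
  "bounded_ratio D \<longleftrightarrow> (\<exists>K. \<forall>n. \<forall>k\<ge>1. D n (Suc k) \<le> K * D n k)"

end

theory Submission
  imports Defs "HOL-Real_Asymp.Real_Asymp"
begin

text \<open>As a function of \<open>B\<close>, the process \<open>\<bar>X\<bar>\<^sup>\<alpha>\<close> is a combination of \<open>h (B)\<close> and \<open>h' (- B)\<close> with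
  \<open>h y = (y - p)\<^sub>+\<^sup>\<beta>\<close>, \<open>\<beta> = \<alpha> / (1 - \<alpha>) > - 1/2\<close>, so \<open>h\<close> is locally square integrable and its primitive
  is continuous.  For smooth \<open>f\<close> the Riemann sums of \<open>f (B)\<close> are treated by Taylor's formula, and
  \<open>h\<close> is approximated by polynomials in \<open>L\<^sup>2\<close>.  The error of the forward sums is a martingale.  The
  backward sums \<open>\<Sum> g (B\<^bsub>t (k+1)\<^esub>) (B\<^bsub>t (k+1)\<^esub> - B\<^bsub>t k\<^esub>)\<close> are a drift plus a martingale in reversed time,
  because \<open>B\<^sub>s - s/u B\<^sub>u\<close> is independent of the future from \<open>u\<close> on (Foellmer, Protter, Shiryaev).
  Both errors are controlled by the \<open>L\<^sup>2\<close> norm, since \<open>B\<^sub>t\<close> has a density bounded by \<open>1 / sqrt t\<close>;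
  only the left end points of the forward sums, where \<open>t\<close> can be small compared to the length of the
  interval, need an assumption on the partitions.  The average of forward and backward sums converges
  to the increment of the primitive, which is the Stratonovich equation; the covariation is obtained
  from their difference.\<close>

section \<open>Convergence uniformly on compacts in probability\<close>

text \<open>The obstacle is \<alpha> < 0: the integrand is then unbounded near its singularity, so
  smooth calculus gives neither its Ito integral nor its covariation. For \<alpha> < 1, the
  condition \<alpha> > -1 is the same as \<beta> > -1/2. The limit of the forward sums is never
  computed, only shown to exist. This is enough: the covariation is taken to be twice the limit of
  the trapezoidal sums minus twice the Ito integral, so the latter cancels in the Stratonovich
  integral. What remains is the chain rule: away from the two kinks, the derivative in
  \<open>y\<close> of \<open>F_ab\<close> at \<open>(1 - \<alpha>) * y + c\<close> is the power
  \<alpha> of its absolute value. At right end points the density bound can be summed against the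
  steps of any partition, by comparison with the integral of \<open>1 / sqrt u\<close>; the drift of
  the backward sums costs \<open>u powr (- 3/4)\<close>, again integrable at 0. At time 0 there is
  no density at all, but only the first forward term sits there, and its coefficient is
  deterministic. Passing to \<open>- B\<close> for the lower branch leaves only powers with a
  singularity approached from the right.\<close>

text \<open>\<open>P\<close> itself need not be measurable, as for suprema over uncountably many times.\<close>

definition off_event :: "'w measure \<Rightarrow> real \<Rightarrow> ('w \<Rightarrow> bool) \<Rightarrow> bool" where
  "off_event M \<eta> P \<longleftrightarrow> (\<exists>A\<in>sets M. measure M A \<le> \<eta> \<and> (\<forall>\<omega>\<in>space M - A. P \<omega>))"

lemma off_eventI:
  "A \<in> sets M \<Longrightarrow> measure M A \<le> \<eta> \<Longrightarrow> (\<And>\<omega>. \<omega> \<in> space M \<Longrightarrow> \<omega> \<notin> A \<Longrightarrow> P \<omega>) \<Longrightarrow> off_event M \<eta> P"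
  by (auto simp: off_event_def)

lemma off_event_mono:
  "off_event M \<eta> P \<Longrightarrow> \<eta> \<le> \<eta>' \<Longrightarrow> (\<And>\<omega>. \<omega> \<in> space M \<Longrightarrow> P \<omega> \<Longrightarrow> Q \<omega>) \<Longrightarrow> off_event M \<eta>' Q"
  unfolding off_event_def by (meson DiffD1 order.trans)

lemma off_event_weaken: "off_event M \<eta> P \<Longrightarrow> \<eta> \<le> \<eta>' \<Longrightarrow> off_event M \<eta>' P"
  by (erule off_event_mono) auto

lemma (in prob_space) off_event_conj:
  assumes "off_event M \<eta> P" "off_event M \<eta>' Q"
  shows "off_event M (\<eta> + \<eta>') (\<lambda>\<omega>. P \<omega> \<and> Q \<omega>)"
proof -
  obtain A A' where "A \<in> sets M" "measure M A \<le> \<eta>" "\<forall>\<omega>\<in>space M - A. P \<omega>"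
    "A' \<in> sets M" "measure M A' \<le> \<eta>'" "\<forall>\<omega>\<in>space M - A'. Q \<omega>"
    using assms by (auto simp: off_event_def)
  then show ?thesis
    using measure_subadditive[of A M A'] by (intro off_eventI[of "A \<union> A'"]) auto
qed

lemma (in prob_space) off_event_AE:
  assumes "AE \<omega> in M. P \<omega>" shows "off_event M 0 P"
proof -
  obtain N where "N \<in> null_sets M" "{\<omega> \<in> space M. \<not> P \<omega>} \<subseteq> N"
    using assms by (auto simp: eventually_ae_filter)
  then show ?thesis by (intro off_eventI[of N]) (auto simp: measure_eq_0_null_sets)
qed

lemma (in prob_space) off_event_Markov:
  fixes f :: "'a \<Rightarrow> real"
  assumes "integrable M f" "\<And>\<omega>. \<omega> \<in> space M \<Longrightarrow> 0 \<le> f \<omega>" "0 < c"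
  shows "off_event M ((\<integral>\<omega>. f \<omega> \<partial>M) / c) (\<lambda>\<omega>. f \<omega> < c)"
proof -
  have "measure M {\<omega>\<in>space M. c \<le> f \<omega>} \<le> (\<integral>\<omega>. f \<omega> \<partial>M) / c"
    using assms by (intro integral_Markov_inequality_measure[where A="{}"]) auto
  then show ?thesis using assms(1)
    by (intro off_eventI[of "{\<omega>\<in>space M. c \<le> f \<omega>}"]) (auto simp: not_le)
qed

text \<open>The covers in \<open>ucp_limit\<close> form one sequence, while estimates are made for
  one \<open>n\<close> and one error budget at a time. To return from budgets to a sequence, cover
  almost optimally: within \<open>1 / Suc n\<close> of the infimum over all measurable
  covers.\<close>

lemma (in prob_space) vanishing_cover_iff:
  "(\<exists>A. (\<forall>n. A n \<in> sets M \<and> {\<omega> \<in> space M. \<not> P n \<omega>} \<subseteq> A n) \<and> (\<lambda>n. measure M (A n)) \<longlonglongrightarrow> 0) \<longleftrightarrow>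
    (\<forall>\<eta>>0. \<forall>\<^sub>F n in sequentially. off_event M \<eta> (P n))" (is "?L \<longleftrightarrow> ?R")
proof
  assume ?L
  then obtain A where A: "\<And>n. A n \<in> sets M" "\<And>n. {\<omega> \<in> space M. \<not> P n \<omega>} \<subseteq> A n"
    "(\<lambda>n. measure M (A n)) \<longlonglongrightarrow> 0" by auto
  show ?R
  proof (intro allI impI)
    fix \<eta> :: real assume "0 < \<eta>"
    with A(3) have "\<forall>\<^sub>F n in sequentially. measure M (A n) < \<eta>" by (rule order_tendstoD)
    then show "\<forall>\<^sub>F n in sequentially. off_event M \<eta> (P n)"
    proof eventually_elim
      case (elim n)
      show ?case by (rule off_eventI[OF A(1)]) (use elim A(2)[of n] in auto)
    qed
  qed
next
  assume R: ?R
  define C where "C n = {A \<in> sets M. {\<omega> \<in> space M. \<not> P n \<omega>} \<subseteq> A}" for n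
  \<comment> \<open>The outer probability that \<open>P n\<close> fails.\<close>
  define m where "m n = (INF A\<in>C n. measure M A)" for n
  have ne: "space M \<in> C n" for n by (auto simp: C_def)
  have bdd: "bdd_below (measure M ` C n)" for n by (intro bdd_belowI[of _ 0]) auto
  have "\<exists>A\<in>C n. measure M A < m n + 1 / Suc n" for n
  proof -
    have "(INF A\<in>C n. measure M A) < m n + 1 / Suc n" by (simp add: m_def)
    then show ?thesis using cInf_lessD[of "measure M ` C n"] ne by blast
  qed
  then obtain A where A: "\<And>n. A n \<in> C n" "\<And>n. measure M (A n) < m n + 1 / Suc n" by metis
  have "m \<longlonglongrightarrow> 0"
  proof (rule tendstoI)
    fix \<eta> :: real assume "0 < \<eta>"
    then have "\<forall>\<^sub>F n in sequentially. off_event M (\<eta>/2) (P n)" using R by simp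
    then show "\<forall>\<^sub>F n in sequentially. dist (m n) 0 < \<eta>"
    proof eventually_elim
      case (elim n)
      then obtain A where A: "A \<in> C n" "measure M A \<le> \<eta>/2" by (auto simp: off_event_def C_def)
      have "m n \<le> measure M A" unfolding m_def using A(1) by (intro cINF_lower bdd)
      moreover have "0 \<le> m n" unfolding m_def using ne by (intro cINF_greatest) auto
      ultimately show ?case using A \<open>0 < \<eta>\<close> by simp
    qed
  qed
  then have lim: "(\<lambda>n. m n + 1 / Suc n) \<longlonglongrightarrow> 0"
    using tendsto_add[OF _ LIMSEQ_Suc[OF lim_1_over_n], of m 0] by simp
  have "(\<lambda>n. measure M (A n)) \<longlonglongrightarrow> 0"
    by (rule tendsto_sandwich[OF _ _ tendsto_const lim]) (use A(2) in \<open>auto intro!: always_eventually less_imp_le simp del: of_nat_Suc\<close>)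
  then show ?L using A(1) by (intro exI[of _ A]) (auto simp: C_def)
qed

lemma (in prob_space) ucp_limit_iff:
  "ucp_limit M Y X \<longleftrightarrow> (\<forall>t\<ge>0. X t \<in> borel_measurable M) \<and>
    (\<forall>T\<ge>0. \<forall>\<epsilon>>0. \<forall>\<eta>>0. \<forall>\<^sub>F n in sequentially.
      off_event M \<eta> (\<lambda>\<omega>. \<forall>s\<in>{0..T}. \<bar>Y n s \<omega> - X s \<omega>\<bar> \<le> \<epsilon>))"
proof -
  have "{\<omega> \<in> space M. \<exists>s\<in>{0..T}. \<epsilon> < \<bar>Y n s \<omega> - X s \<omega>\<bar>} =
      {\<omega> \<in> space M. \<not> (\<forall>s\<in>{0..T}. \<bar>Y n s \<omega> - X s \<omega>\<bar> \<le> \<epsilon>)}" for T \<epsilon> n by (auto simp: not_le)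
  then show ?thesis unfolding ucp_limit_def by (simp only: vanishing_cover_iff)
qed

lemma (in prob_space) ucp_limitI:
  assumes "\<And>t. 0 \<le> t \<Longrightarrow> X t \<in> borel_measurable M"
    and "\<And>T \<epsilon> \<eta>. 0 \<le> T \<Longrightarrow> 0 < \<epsilon> \<Longrightarrow> 0 < \<eta> \<Longrightarrow> \<forall>\<^sub>F n in sequentially.
      off_event M \<eta> (\<lambda>\<omega>. \<forall>s\<in>{0..T}. \<bar>Y n s \<omega> - X s \<omega>\<bar> \<le> \<epsilon>)"
  shows "ucp_limit M Y X"
  using assms by (simp add: ucp_limit_iff)

lemma (in prob_space) ucp_limitD:
  assumes "ucp_limit M Y X" "0 \<le> T" "0 < \<epsilon>" "0 < \<eta>"
  shows "\<forall>\<^sub>F n in sequentially. off_event M \<eta> (\<lambda>\<omega>. \<forall>s\<in>{0..T}. \<bar>Y n s \<omega> - X s \<omega>\<bar> \<le> \<epsilon>)"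
  using assms by (simp add: ucp_limit_iff)

lemma (in prob_space) ucp_limit_measurable:
  "ucp_limit M Y X \<Longrightarrow> 0 \<le> t \<Longrightarrow> X t \<in> borel_measurable M"
  by (simp add: ucp_limit_iff)

lemma (in prob_space) ucp_limit_add:
  assumes "ucp_limit M Y X" "ucp_limit M Y' X'"
  shows "ucp_limit M (\<lambda>n t \<omega>. Y n t \<omega> + Y' n t \<omega>) (\<lambda>t \<omega>. X t \<omega> + X' t \<omega>)"
proof (rule ucp_limitI)
  fix T \<epsilon> \<eta> :: real assume *: "0 \<le> T" "0 < \<epsilon>" "0 < \<eta>"
  have "\<forall>\<^sub>F n in sequentially. off_event M (\<eta>/2) (\<lambda>\<omega>. \<forall>s\<in>{0..T}. \<bar>Y n s \<omega> - X s \<omega>\<bar> \<le> \<epsilon>/2)"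
    using * by (intro ucp_limitD[OF assms(1)]) auto
  moreover have "\<forall>\<^sub>F n in sequentially. off_event M (\<eta>/2) (\<lambda>\<omega>. \<forall>s\<in>{0..T}. \<bar>Y' n s \<omega> - X' s \<omega>\<bar> \<le> \<epsilon>/2)"
    using * by (intro ucp_limitD[OF assms(2)]) auto
  ultimately show "\<forall>\<^sub>F n in sequentially.
      off_event M \<eta> (\<lambda>\<omega>. \<forall>s\<in>{0..T}. \<bar>Y n s \<omega> + Y' n s \<omega> - (X s \<omega> + X' s \<omega>)\<bar> \<le> \<epsilon>)"
  proof eventually_elim
    case (elim n)
    have le: "\<bar>y + y' - (x + x')\<bar> \<le> \<epsilon>" if "\<bar>y - x\<bar> \<le> \<epsilon>/2" "\<bar>y' - x'\<bar> \<le> \<epsilon>/2" for x x' y y'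
      using that by linarith
    from off_event_conj[OF elim] show ?case
      by (rule off_event_mono) (auto intro: le)
  qed
qed (intro borel_measurable_add ucp_limit_measurable[OF assms(1)] ucp_limit_measurable[OF assms(2)])

lemma (in prob_space) ucp_limit_cmult:
  assumes "ucp_limit M Y X"
  shows "ucp_limit M (\<lambda>n t \<omega>. c * Y n t \<omega>) (\<lambda>t \<omega>. c * X t \<omega>)"
proof (rule ucp_limitI)
  fix T \<epsilon> \<eta> :: real assume *: "0 \<le> T" "0 < \<epsilon>" "0 < \<eta>"
  have b: "\<bar>c * y - c * x\<bar> \<le> \<epsilon>" if "\<bar>y - x\<bar> \<le> \<epsilon> / (\<bar>c\<bar> + 1)" for x y
  proof -
    have "\<bar>c * y - c * x\<bar> = \<bar>c\<bar> * \<bar>y - x\<bar>" by (simp add: abs_mult[symmetric] right_diff_distrib)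
    also have "\<dots> \<le> (\<bar>c\<bar> + 1) * (\<epsilon> / (\<bar>c\<bar> + 1))" using that by (intro mult_mono) auto
    also have "\<dots> = \<epsilon>" by (simp add: field_simps)
    finally show ?thesis .
  qed
  have "\<forall>\<^sub>F n in sequentially. off_event M \<eta> (\<lambda>\<omega>. \<forall>s\<in>{0..T}. \<bar>Y n s \<omega> - X s \<omega>\<bar> \<le> \<epsilon> / (\<bar>c\<bar> + 1))"
    using * by (intro ucp_limitD[OF assms]) (auto intro!: divide_pos_pos)
  then show "\<forall>\<^sub>F n in sequentially. off_event M \<eta> (\<lambda>\<omega>. \<forall>s\<in>{0..T}. \<bar>c * Y n s \<omega> - c * X s \<omega>\<bar> \<le> \<epsilon>)"
    by eventually_elim (erule off_event_mono, simp, blast intro: b)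
qed (intro borel_measurable_times borel_measurable_const ucp_limit_measurable[OF assms])

text \<open>One null set has to serve all \<open>n\<close> and all times. This lets
  \<open>B 0 = 0\<close>, known almost surely only, be used inside the Riemann sums.\<close>

lemma (in prob_space) ucp_limit_cong_AE:
  assumes "ucp_limit M Y X" "AE \<omega> in M. \<forall>n. \<forall>t\<ge>0. Y n t \<omega> = Y' n t \<omega>"
  shows "ucp_limit M Y' X"
proof (rule ucp_limitI)
  fix T \<epsilon> \<eta> :: real assume *: "0 \<le> T" "0 < \<epsilon>" "0 < \<eta>"
  show "\<forall>\<^sub>F n in sequentially. off_event M \<eta> (\<lambda>\<omega>. \<forall>s\<in>{0..T}. \<bar>Y' n s \<omega> - X s \<omega>\<bar> \<le> \<epsilon>)"
    using ucp_limitD[OF assms(1) *]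
  proof eventually_elim
    case (elim n)
    from off_event_conj[OF this off_event_AE[OF assms(2)]] show ?case
      by (rule off_event_mono) auto
  qed
qed (rule ucp_limit_measurable[OF assms(1)])

text \<open>A subsequence whose consecutive differences have summable exceptional probabilities
  converges off a small tail event, and the Cauchy condition carries the whole sequence along. This
  yields an Ito integral without a formula for it.\<close>

lemma (in prob_space) ucp_complete:
  assumes meas: "\<And>n t. 0 \<le> t \<Longrightarrow> Y n t \<in> borel_measurable M"
    and cauchy: "\<And>T \<epsilon> \<eta>. 0 \<le> T \<Longrightarrow> 0 < \<epsilon> \<Longrightarrow> 0 < \<eta> \<Longrightarrow> \<exists>N. \<forall>m\<ge>N. \<forall>n\<ge>N.
      off_event M \<eta> (\<lambda>\<omega>. \<forall>s\<in>{0..T}. \<bar>Y m s \<omega> - Y n s \<omega>\<bar> \<le> \<epsilon>)"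
  obtains X where "ucp_limit M Y X"
proof -
  have "\<forall>j. \<exists>N. \<forall>m\<ge>N. \<forall>n\<ge>N. off_event M ((1/2)^j)
      (\<lambda>\<omega>. \<forall>s\<in>{0..real j}. \<bar>Y m s \<omega> - Y n s \<omega>\<bar> \<le> (1/2)^j)"
    by (intro allI cauchy) auto
  from choice[OF this] obtain N where N: "\<And>j m n. N j \<le> m \<Longrightarrow> N j \<le> n \<Longrightarrow> off_event M ((1/2)^j)
      (\<lambda>\<omega>. \<forall>s\<in>{0..real j}. \<bar>Y m s \<omega> - Y n s \<omega>\<bar> \<le> (1/2)^j)" by blast
  \<comment> \<open>Partial sums make the indices monotone, so that \<open>r j\<close> and
    \<open>r (Suc j)\<close> both lie beyond \<open>N j\<close>.\<close>
  define r where "r j = (\<Sum>i\<le>j. N i)" for j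
  have r: "N j \<le> r j" "N j \<le> r (Suc j)" for j
    using member_le_sum[of j "{..j}" N] by (simp_all add: r_def)
  have "\<forall>j. \<exists>A. A \<in> sets M \<and> measure M A \<le> (1/2)^j \<and> (\<forall>\<omega>\<in>space M - A.
      \<forall>s\<in>{0..real j}. \<bar>Y (r (Suc j)) s \<omega> - Y (r j) s \<omega>\<bar> \<le> (1/2)^j)"
    using N[OF r(2,1)] unfolding off_event_def Bex_def by blast
  from choice[OF this] obtain A where A0: "\<forall>j. A j \<in> sets M \<and> measure M (A j) \<le> (1/2)^j \<and>
      (\<forall>\<omega>\<in>space M - A j. \<forall>s\<in>{0..real j}. \<bar>Y (r (Suc j)) s \<omega> - Y (r j) s \<omega>\<bar> \<le> (1/2)^j)"
    by (elim exE)
  have A: "A j \<in> sets M" "measure M (A j) \<le> (1/2)^j"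
    "\<omega> \<in> space M \<Longrightarrow> \<omega> \<notin> A j \<Longrightarrow> 0 \<le> s \<Longrightarrow> s \<le> real j \<Longrightarrow>
      \<bar>Y (r (Suc j)) s \<omega> - Y (r j) s \<omega>\<bar> \<le> (1/2)^j" for j \<omega> s
    using A0[rule_format, of j] by simp_all
  \<comment> \<open>\<open>lim\<close> has an arbitrary value where the subsequence diverges. The
    estimate \<open>close\<close> is claimed only off \<open>L m\<close> and up to time
    \<open>m\<close>, where it converges.\<close>
  define X where "X t \<omega> = lim (\<lambda>j. Y (r j) t \<omega>)" for t \<omega>
  have X_meas: "X t \<in> borel_measurable M" if "0 \<le> t" for t
    unfolding X_def using meas[OF that] by (intro borel_measurable_lim_metric)
  define L where "L m = (\<Union>i. A (m + i))" for m
  have L: "L m \<in> sets M" "measure M (L m) \<le> 2 * (1/2)^m" for m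
  proof -
    show "L m \<in> sets M" using A(1) by (auto simp: L_def)
    have gs: "(\<lambda>i. (1/2)^(m+i)) sums ((1/2::real)^m * 2)"
      unfolding power_add using geometric_sums[of "1/2::real"] by (intro sums_mult) simp
    have sm: "summable (\<lambda>i. measure M (A (m+i)))"
      by (rule summable_comparison_test'[OF sums_summable[OF gs], of 0]) (use A(2) in auto)
    have "measure M (L m) \<le> (\<Sum>i. measure M (A (m+i)))"
      unfolding L_def using A(1) sm by (intro finite_measure_subadditive_countably) auto
    also have "\<dots> \<le> (\<Sum>i. (1/2)^(m+i))" using A(2) sm sums_summable[OF gs] by (intro suminf_le) auto
    finally show "measure M (L m) \<le> 2 * (1/2)^m" using sums_unique[OF gs] by simp
  qed
  have close: "\<bar>Y (r m) s \<omega> - X s \<omega>\<bar> \<le> 2 * (1/2)^m"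
    if "\<omega> \<in> space M" "\<omega> \<notin> L m" "0 \<le> s" "s \<le> real m" for m s \<omega>
  proof -
    let ?y = "\<lambda>i. Y (r (m + i)) s \<omega>"
    have d: "\<bar>?y (Suc i) - ?y i\<bar> \<le> (1/2)^(m+i)" for i
      using A(3)[of \<omega> "m+i" s] that by (auto simp: L_def)
    have gs: "(\<lambda>i. (1/2)^(m+i)) sums ((1/2::real)^m * 2)"
      unfolding power_add using geometric_sums[of "1/2::real"] by (intro sums_mult) simp
    have sa: "summable (\<lambda>i. \<bar>?y (Suc i) - ?y i\<bar>)"
      by (rule summable_comparison_test'[OF sums_summable[OF gs], of 0]) (use d in auto)
    have s1: "summable (\<lambda>i. ?y (Suc i) - ?y i)" using sa by (rule summable_rabs_cancel)
    have "(\<lambda>n. ?y n - ?y 0) \<longlonglongrightarrow> (\<Sum>i. ?y (Suc i) - ?y i)"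
      using summable_LIMSEQ[OF s1] unfolding sum_lessThan_telescope[of ?y] .
    from tendsto_add[OF this tendsto_const[of "?y 0"]]
    have lim: "?y \<longlonglongrightarrow> (\<Sum>i. ?y (Suc i) - ?y i) + ?y 0" by simp
    then have "(\<lambda>j. Y (r j) s \<omega>) \<longlonglongrightarrow> (\<Sum>i. ?y (Suc i) - ?y i) + ?y 0"
      by (subst (asm) add.commute[of m]) (rule LIMSEQ_offset)
    then have "X s \<omega> = (\<Sum>i. ?y (Suc i) - ?y i) + ?y 0" unfolding X_def by (rule limI)
    then have "\<bar>Y (r m) s \<omega> - X s \<omega>\<bar> = \<bar>\<Sum>i. ?y (Suc i) - ?y i\<bar>" by simp
    also have "\<dots> \<le> (\<Sum>i. \<bar>?y (Suc i) - ?y i\<bar>)" by (rule summable_rabs[OF sa])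
    also have "\<dots> \<le> (\<Sum>i. (1/2)^(m+i))" by (intro suminf_le d sa sums_summable[OF gs])
    finally show ?thesis using sums_unique[OF gs] by simp
  qed
  have "ucp_limit M Y X"
  proof (rule ucp_limitI)
    fix T \<epsilon> \<eta> :: real assume *: "0 \<le> T" "0 < \<epsilon>" "0 < \<eta>"
    \<comment> \<open>Three is two plus one: from \<open>X\<close> to \<open>Y (r m)\<close> costs
      twice \<open>(1/2)^m\<close>, from there to \<open>Y n\<close> once, in distance as well as in
      probability.\<close>
    have "(\<lambda>m. 3 * (1/2::real)^m) \<longlonglongrightarrow> 3 * 0" by (intro tendsto_mult tendsto_const LIMSEQ_realpow_zero) auto
    then have "\<forall>\<^sub>F m in sequentially. 3 * (1/2::real)^m < min \<epsilon> \<eta>" using * by (intro order_tendstoD) auto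
    moreover have "\<forall>\<^sub>F m in sequentially. T \<le> real m" by real_asymp
    ultimately have "\<forall>\<^sub>F m in sequentially. 3 * (1/2::real)^m < min \<epsilon> \<eta> \<and> T \<le> real m" by eventually_elim auto
    then obtain m where m: "3 * (1/2::real)^m < min \<epsilon> \<eta>" "T \<le> real m" by (auto dest: eventually_happens)
    have "off_event M \<eta> (\<lambda>\<omega>. \<forall>s\<in>{0..T}. \<bar>Y n s \<omega> - X s \<omega>\<bar> \<le> \<epsilon>)" if "N m \<le> n" for n
    proof -
      have "off_event M (2 * (1/2)^m) (\<lambda>\<omega>. \<forall>s\<in>{0..real m}. \<bar>Y (r m) s \<omega> - X s \<omega>\<bar> \<le> 2 * (1/2)^m)"
        using L close by (intro off_eventI[of "L m"]) auto
      from off_event_conj[OF this N[OF that r(1)]] show ?thesis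
      proof (rule off_event_mono)
        fix \<omega> assume **: "(\<forall>s\<in>{0..real m}. \<bar>Y (r m) s \<omega> - X s \<omega>\<bar> \<le> 2 * (1/2)^m) \<and>
          (\<forall>s\<in>{0..real m}. \<bar>Y n s \<omega> - Y (r m) s \<omega>\<bar> \<le> (1/2)^m)"
        show "\<forall>s\<in>{0..T}. \<bar>Y n s \<omega> - X s \<omega>\<bar> \<le> \<epsilon>"
        proof
          fix s assume "s \<in> {0..T}"
          with m(2) have "s \<in> {0..real m}" by simp
          with ** have "\<bar>Y (r m) s \<omega> - X s \<omega>\<bar> \<le> 2 * (1/2)^m" "\<bar>Y n s \<omega> - Y (r m) s \<omega>\<bar> \<le> (1/2)^m"
            by blast+
          then show "\<bar>Y n s \<omega> - X s \<omega>\<bar> \<le> \<epsilon>" using m(1) by linarith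
        qed
      qed (use m in auto)
    qed
    then show "\<forall>\<^sub>F n in sequentially. off_event M \<eta> (\<lambda>\<omega>. \<forall>s\<in>{0..T}. \<bar>Y n s \<omega> - X s \<omega>\<bar> \<le> \<epsilon>)"
      by (auto simp: eventually_sequentially)
  qed (rule X_meas)
  then show ?thesis by (rule that)
qed

section \<open>A maximal inequality\<close>

text \<open>Orthogonality to the functions of the previous differences suffices: they determine whether the
  partial sums have already left \<open>(- c, c)\<close>.\<close>

lemma (in prob_space) maximal_inequality:
  fixes d :: "nat \<Rightarrow> 'a \<Rightarrow> real"
  assumes meas: "\<And>k. k < N \<Longrightarrow> d k \<in> borel_measurable M"
    and sq: "\<And>k. k < N \<Longrightarrow> integrable M (\<lambda>\<omega>. (d k \<omega>)\<^sup>2)"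
    and orth: "\<And>k \<Phi>. k < N \<Longrightarrow> \<Phi> \<in> borel_measurable (PiM {..<k} (\<lambda>_. borel)) \<Longrightarrow>
      integrable M (\<lambda>\<omega>. (\<Phi> (\<lambda>i\<in>{..<k}. d i \<omega>))\<^sup>2) \<Longrightarrow> (\<integral>\<omega>. \<Phi> (\<lambda>i\<in>{..<k}. d i \<omega>) * d k \<omega> \<partial>M) = 0"
    and "0 < c"
  shows "off_event M ((\<Sum>k<N. \<integral>\<omega>. (d k \<omega>)\<^sup>2 \<partial>M) / c\<^sup>2) (\<lambda>\<omega>. \<forall>j\<le>N. \<bar>\<Sum>k<j. d k \<omega>\<bar> < c)"
proof -
  define S where "S j \<omega> = (\<Sum>k<j. d k \<omega>)" for j \<omega>
  have S_meas[measurable]: "S j \<in> borel_measurable M" if "j \<le> N" for j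
    unfolding S_def using that by (intro borel_measurable_sum meas) auto
  have S_sq: "integrable M (\<lambda>\<omega>. (S j \<omega>)\<^sup>2)" if "j \<le> N" for j
    using that
  proof (induction j)
    case (Suc j)
    have [measurable]: "S j \<in> borel_measurable M" "d j \<in> borel_measurable M" using Suc.prems meas by auto
    have "integrable M (\<lambda>\<omega>. 2 * (S j \<omega>)\<^sup>2 + 2 * (d j \<omega>)\<^sup>2)" using Suc sq by auto
    then have "integrable M (\<lambda>\<omega>. (S j \<omega> + d j \<omega>)\<^sup>2)"
    proof (rule Bochner_Integration.integrable_bound)
      have "(x + y)\<^sup>2 \<le> 2 * x\<^sup>2 + 2 * y\<^sup>2" for x y :: real
        using sum_squares_bound[of x y] by (simp add: power2_sum)
      then show "AE \<omega> in M. norm ((S j \<omega> + d j \<omega>)\<^sup>2) \<le> norm (2 * (S j \<omega>)\<^sup>2 + 2 * (d j \<omega>)\<^sup>2)"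
        by (intro AE_I2) simp
    qed simp
    then show ?case by (simp add: S_def)
  qed (simp add: S_def)
  define V where "V k \<omega> = (\<lambda>i\<in>{..<k}. d i \<omega>)" for k \<omega>
  have V_meas[measurable]: "V k \<in> measurable M (PiM {..<k} (\<lambda>_. borel))" if "k \<le> N" for k
    unfolding V_def using that meas by (intro measurable_restrict) auto
  \<comment> \<open>Pythagoras on an event determined by the first \<open>k\<close> differences: the
    cross term is \<open>d k\<close> against a function of these differences, hence zero by
    \<open>orth\<close>.\<close>
  have incr: "(\<integral>\<omega>. (S (Suc k) \<omega>)\<^sup>2 * indicator A (V k \<omega>) \<partial>M) =
      (\<integral>\<omega>. (S k \<omega>)\<^sup>2 * indicator A (V k \<omega>) \<partial>M) + (\<integral>\<omega>. (d k \<omega>)\<^sup>2 * indicator A (V k \<omega>) \<partial>M)"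
    if k: "k < N" and [measurable]: "A \<in> sets (PiM {..<k} (\<lambda>_. borel))" for k A
  proof -
    define \<Phi> where "\<Phi> x = (\<Sum>i<k. x i) * indicator A x" for x :: "nat \<Rightarrow> real"
    have [measurable]: "\<Phi> \<in> borel_measurable (PiM {..<k} (\<lambda>_. borel))"
      unfolding \<Phi>_def by measurable
    have [measurable]: "S k \<in> borel_measurable M" "d k \<in> borel_measurable M" "V k \<in> measurable M (PiM {..<k} (\<lambda>_. borel))"
      using k meas by auto
    have \<Phi>_V: "\<Phi> (V k \<omega>) = S k \<omega> * indicator A (V k \<omega>)" for \<omega>
      by (simp add: \<Phi>_def V_def S_def)
    have i1: "integrable M (\<lambda>\<omega>. (S k \<omega>)\<^sup>2 * indicator A (V k \<omega>))"
      by (rule Bochner_Integration.integrable_bound[OF S_sq[of k]]) (use k in \<open>auto simp: indicator_def\<close>)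
    have i2: "integrable M (\<lambda>\<omega>. (d k \<omega>)\<^sup>2 * indicator A (V k \<omega>))"
      by (rule Bochner_Integration.integrable_bound[OF sq[OF k]]) (auto simp: indicator_def)
    have "(\<Phi> (V k \<omega>))\<^sup>2 = (S k \<omega>)\<^sup>2 * indicator A (V k \<omega>)" for \<omega>
      by (simp add: \<Phi>_V power_mult_distrib indicator_def)
    then have i3: "integrable M (\<lambda>\<omega>. (\<Phi> (V k \<omega>))\<^sup>2)" using i1 by simp
    have i4: "integrable M (\<lambda>\<omega>. \<Phi> (V k \<omega>) * d k \<omega>)"
    proof (rule Bochner_Integration.integrable_bound)
      show "integrable M (\<lambda>\<omega>. (\<Phi> (V k \<omega>))\<^sup>2 + (d k \<omega>)\<^sup>2)" using i3 sq[OF k] by simp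
      have "\<bar>x * y\<bar> \<le> x\<^sup>2 + y\<^sup>2" for x y :: real
        using sum_squares_bound[of "\<bar>x\<bar>" "\<bar>y\<bar>"] mult_nonneg_nonneg[of "\<bar>x\<bar>" "\<bar>y\<bar>"] by (simp only: abs_mult power2_abs) linarith
      then show "AE \<omega> in M. norm (\<Phi> (V k \<omega>) * d k \<omega>) \<le> norm ((\<Phi> (V k \<omega>))\<^sup>2 + (d k \<omega>)\<^sup>2)"
        by (intro AE_I2) simp
    qed simp
    have "(S (Suc k) \<omega>)\<^sup>2 * indicator A (V k \<omega>) = (S k \<omega>)\<^sup>2 * indicator A (V k \<omega>) +
        (d k \<omega>)\<^sup>2 * indicator A (V k \<omega>) + 2 * (\<Phi> (V k \<omega>) * d k \<omega>)" for \<omega>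
      by (simp add: S_def \<Phi>_V power2_eq_square algebra_simps)
    moreover have "(\<integral>\<omega>. \<Phi> (V k \<omega>) * d k \<omega> \<partial>M) = 0"
      using orth[OF k, of \<Phi>] i3 by (simp add: V_def)
    ultimately show ?thesis using i1 i2 i4 by simp
  qed
  have S_N: "(\<integral>\<omega>. (S j \<omega>)\<^sup>2 \<partial>M) = (\<Sum>k<j. \<integral>\<omega>. (d k \<omega>)\<^sup>2 \<partial>M)" if "j \<le> N" for j
    using that
  proof (induction j)
    case (Suc j)
    have "V j \<omega> \<in> space (PiM {..<j} (\<lambda>_. borel))" for \<omega> by (simp add: V_def space_PiM)
    then have "indicator (space (PiM {..<j} (\<lambda>_. borel))) (V j \<omega>) = (1::real)" for \<omega> by simp
    with incr[of j "space (PiM {..<j} (\<lambda>_. borel))"] Suc show ?case by simp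
  qed (simp add: S_def)
  \<comment> \<open>On \<open>A j\<close> the partial sums leave \<open>(- c, c)\<close> for the
    first time at step \<open>j\<close>. These events are disjoint, which turns the sum over
    \<open>j\<close> below into a single second moment of \<open>S N\<close>.\<close>
  define A where "A j = {\<omega> \<in> space M. c \<le> \<bar>S j \<omega>\<bar> \<and> (\<forall>i<j. \<bar>S i \<omega>\<bar> < c)}" for j
  have A_meas[measurable]: "A j \<in> sets M" if "j \<le> N" for j
  proof -
    have [measurable]: "S i \<in> borel_measurable M" if "i \<le> j" for i using that \<open>j \<le> N\<close> by auto
    have "A j = {\<omega> \<in> space M. c \<le> \<bar>S j \<omega>\<bar>} \<inter> (\<Inter>i\<in>{..<j}. {\<omega> \<in> space M. \<bar>S i \<omega>\<bar> < c}) \<inter> space M"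
      by (auto simp: A_def)
    also have "\<dots> \<in> sets M" by (cases "j = 0") (auto intro!: sets.Int sets.finite_INT)
    finally show ?thesis .
  qed
  \<comment> \<open>\<open>A j\<close> once more, now as a set of vectors of the first
    \<open>k\<close> differences, the form in which \<open>incr\<close> applies to it.\<close>
  define As where "As j k = {x \<in> space (PiM {..<k} (\<lambda>_. borel)). c \<le> \<bar>\<Sum>i<j. x i\<bar> \<and>
      (\<forall>i\<in>{..<j}. \<bar>\<Sum>l<i. x l\<bar> < c)}" for j k :: nat
  have As_meas: "As j k \<in> sets (PiM {..<k} (\<lambda>_. borel))" if "j \<le> k" for j k
  proof -
    have [measurable]: "(\<lambda>x. \<Sum>l<i. x l :: real) \<in> borel_measurable (PiM {..<k} (\<lambda>_. borel))" if "i \<le> j" for i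
      using that \<open>j \<le> k\<close> by (intro borel_measurable_sum measurable_component_singleton) auto
    show ?thesis unfolding As_def by (intro sets.sets_Collect_conj sets.sets_Collect_finite_All) auto
  qed
  have As_V: "indicator (As j k) (V k \<omega>) = (indicator (A j) \<omega> :: real)"
    if "j \<le> k" "\<omega> \<in> space M" for j k \<omega>
  proof -
    have "(\<Sum>i<l. V k \<omega> i) = S l \<omega>" if "l \<le> j" for l
      using that \<open>j \<le> k\<close> by (simp add: V_def S_def)
    then show ?thesis using that by (auto simp: indicator_def As_def A_def V_def space_PiM)
  qed
  \<comment> \<open>Whether \<open>A j\<close> occurs is decided by step \<open>j\<close>, so on
    \<open>A j\<close> each later difference adds a nonnegative amount to the second moment.\<close>
  have mono: "(\<integral>\<omega>. (S j \<omega>)\<^sup>2 * indicator (A j) \<omega> \<partial>M) \<le> (\<integral>\<omega>. (S k \<omega>)\<^sup>2 * indicator (A j) \<omega> \<partial>M)"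
    if "j \<le> k" "k \<le> N" for j k
    using that
  proof (induction k rule: dec_induct)
    case (step k)
    have "(\<integral>\<omega>. (S k \<omega>)\<^sup>2 * indicator (A j) \<omega> \<partial>M) = (\<integral>\<omega>. (S k \<omega>)\<^sup>2 * indicator (As j k) (V k \<omega>) \<partial>M)"
      using step by (intro Bochner_Integration.integral_cong) (auto simp: As_V)
    also have "\<dots> \<le> (\<integral>\<omega>. (S (Suc k) \<omega>)\<^sup>2 * indicator (As j k) (V k \<omega>) \<partial>M)"
      using step incr[of k "As j k"] As_meas[of j k] by (auto intro!: integral_nonneg_AE)
    also have "\<dots> = (\<integral>\<omega>. (S (Suc k) \<omega>)\<^sup>2 * indicator (A j) \<omega> \<partial>M)"
      using step by (intro Bochner_Integration.integral_cong) (auto simp: As_V)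
    finally show ?case using step by simp
  qed simp
  have iA: "integrable M (\<lambda>\<omega>. (S k \<omega>)\<^sup>2 * indicator (A j) \<omega>)" if "j \<le> N" "k \<le> N" for j k
    by (rule integrable_real_mult_indicator[OF A_meas[OF that(1)] S_sq[OF that(2)]])
  have "c\<^sup>2 * measure M (A j) \<le> (\<integral>\<omega>. (S N \<omega>)\<^sup>2 * indicator (A j) \<omega> \<partial>M)" if "j \<le> N" for j
  proof -
    have "c\<^sup>2 * measure M (A j) = (\<integral>\<omega>. c\<^sup>2 * indicator (A j) \<omega> \<partial>M)" using A_meas[OF that] by simp
    also have "\<dots> \<le> (\<integral>\<omega>. (S j \<omega>)\<^sup>2 * indicator (A j) \<omega> \<partial>M)"
    proof (rule integral_mono)
      show "integrable M (\<lambda>\<omega>. c\<^sup>2 * indicator (A j) \<omega>)"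
        by (rule integrable_real_mult_indicator[OF A_meas[OF that]]) simp
      show "c\<^sup>2 * indicator (A j) \<omega> \<le> (S j \<omega>)\<^sup>2 * indicator (A j) \<omega>" for \<omega>
        using \<open>0 < c\<close> abs_le_square_iff[of c "S j \<omega>"] by (auto simp: indicator_def A_def)
    qed (use iA that in auto)
    also have "\<dots> \<le> (\<integral>\<omega>. (S N \<omega>)\<^sup>2 * indicator (A j) \<omega> \<partial>M)" using mono that by auto
    finally show ?thesis .
  qed
  then have "(\<Sum>j\<le>N. c\<^sup>2 * measure M (A j)) \<le> (\<Sum>j\<le>N. \<integral>\<omega>. (S N \<omega>)\<^sup>2 * indicator (A j) \<omega> \<partial>M)"
    by (intro sum_mono) auto
  also have "\<dots> = (\<integral>\<omega>. (\<Sum>j\<le>N. (S N \<omega>)\<^sup>2 * indicator (A j) \<omega>) \<partial>M)"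
    using iA by (subst Bochner_Integration.integral_sum) auto
  also have "\<dots> \<le> (\<integral>\<omega>. (S N \<omega>)\<^sup>2 \<partial>M)"
  proof (rule integral_mono)
    have disj: "disjoint_family_on A {..N}"
      unfolding disjoint_family_on_def A_def by (auto simp: not_le[symmetric]) (metis linorder_neqE_nat not_le)+
    show "(\<Sum>j\<le>N. (S N \<omega>)\<^sup>2 * indicator (A j) \<omega>) \<le> (S N \<omega>)\<^sup>2" for \<omega>
      unfolding sum_distrib_left[symmetric] indicator_UN_disjoint[OF finite_atMost disj, symmetric]
      by (auto simp: indicator_def)
  qed (intro Bochner_Integration.integrable_sum iA S_sq; simp)+
  finally have *: "c\<^sup>2 * (\<Sum>j\<le>N. measure M (A j)) \<le> (\<Sum>k<N. \<integral>\<omega>. (d k \<omega>)\<^sup>2 \<partial>M)"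
    by (simp add: S_N sum_distrib_left)
  show ?thesis
  proof (rule off_eventI)
    show "(\<Union>j\<le>N. A j) \<in> sets M" using A_meas by auto
    have "measure M (\<Union>j\<le>N. A j) \<le> (\<Sum>j\<le>N. measure M (A j))"
      using A_meas by (intro finite_measure_subadditive_finite) auto
    with * show "measure M (\<Union>j\<le>N. A j) \<le> (\<Sum>k<N. \<integral>\<omega>. (d k \<omega>)\<^sup>2 \<partial>M) / c\<^sup>2"
      using \<open>0 < c\<close> by (simp add: field_simps) (smt (verit) mult_left_mono zero_le_power2)
    fix \<omega> assume \<omega>: "\<omega> \<in> space M" "\<omega> \<notin> (\<Union>j\<le>N. A j)"
    have "\<bar>S j \<omega>\<bar> < c" if "j \<le> N" for j
      using that
    proof (induction j rule: less_induct)
      case (less j)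
      then have "\<forall>i<j. \<bar>S i \<omega>\<bar> < c" by simp
      with \<omega> less.prems show ?case unfolding A_def using not_le by blast
    qed
    then show "\<forall>j\<le>N. \<bar>\<Sum>k<j. d k \<omega>\<bar> < c" by (simp add: S_def)
  qed
qed

section \<open>Independence and Gaussian bridges\<close>

text \<open>Unlike \<open>indep_var\<close>, this allows variables with values in different types.\<close>

definition (in prob_space) indep_rv ::
  "'b measure \<Rightarrow> ('a \<Rightarrow> 'b) \<Rightarrow> 'c measure \<Rightarrow> ('a \<Rightarrow> 'c) \<Rightarrow> bool" where
  "indep_rv N X K Y \<longleftrightarrow> X \<in> measurable M N \<and> Y \<in> measurable M K \<and>
    distr M N X \<Otimes>\<^sub>M distr M K Y = distr M (N \<Otimes>\<^sub>M K) (\<lambda>\<omega>. (X \<omega>, Y \<omega>))"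

lemma (in prob_space) indep_rv_iff_indep_var: "indep_rv N X K Y \<longleftrightarrow> indep_var N X K Y"
  by (simp add: indep_rv_def indep_var_distribution_eq)

lemma (in prob_space) indep_rvI:
  assumes [measurable]: "X \<in> measurable M N" "Y \<in> measurable M K"
    and prob: "\<And>A C. A \<in> sets N \<Longrightarrow> C \<in> sets K \<Longrightarrow>
      prob ((X -` A \<inter> space M) \<inter> (Y -` C \<inter> space M)) = prob (X -` A \<inter> space M) * prob (Y -` C \<inter> space M)"
  shows "indep_rv N X K Y"
proof -
  interpret X: prob_space "distr M N X" by (rule prob_space_distr) simp
  interpret Y: prob_space "distr M K Y" by (rule prob_space_distr) simp
  have "distr M N X \<Otimes>\<^sub>M distr M K Y = distr M (N \<Otimes>\<^sub>M K) (\<lambda>\<omega>. (X \<omega>, Y \<omega>))"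
  proof (rule pair_measure_eqI)
    show "sigma_finite_measure (distr M N X)" "sigma_finite_measure (distr M K Y)" by unfold_locales
    show "sets (distr M N X \<Otimes>\<^sub>M distr M K Y) = sets (distr M (N \<Otimes>\<^sub>M K) (\<lambda>\<omega>. (X \<omega>, Y \<omega>)))"
      unfolding sets_distr by (rule sets_pair_measure_cong) simp_all
    fix A C assume "A \<in> sets (distr M N X)" "C \<in> sets (distr M K Y)"
    then have [measurable]: "A \<in> sets N" "C \<in> sets K" by auto
    have "(\<lambda>\<omega>. (X \<omega>, Y \<omega>)) -` (A \<times> C) \<inter> space M = (X -` A \<inter> space M) \<inter> (Y -` C \<inter> space M)" by auto
    then show "emeasure (distr M N X) A * emeasure (distr M K Y) C =
        emeasure (distr M (N \<Otimes>\<^sub>M K) (\<lambda>\<omega>. (X \<omega>, Y \<omega>))) (A \<times> C)"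
      using prob[of A C] by (simp add: emeasure_distr emeasure_eq_measure ennreal_mult[symmetric])
  qed
  then show ?thesis by (simp add: indep_rv_def)
qed

lemma (in prob_space) indep_rv_compose:
  assumes XY: "indep_rv N X K Y" and f[measurable]: "f \<in> measurable N N'" and g[measurable]: "g \<in> measurable K K'"
  shows "indep_rv N' (\<lambda>\<omega>. f (X \<omega>)) K' (\<lambda>\<omega>. g (Y \<omega>))"
proof -
  have [measurable]: "X \<in> measurable M N" "Y \<in> measurable M K" using XY by (auto simp: indep_rv_def)
  interpret gY: prob_space "distr (distr M K Y) K' g"
    by (rule prob_space.prob_space_distr[OF prob_space_distr]) simp_all
  have "distr M N' (\<lambda>\<omega>. f (X \<omega>)) \<Otimes>\<^sub>M distr M K' (\<lambda>\<omega>. g (Y \<omega>)) =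
      distr (distr M N X) N' f \<Otimes>\<^sub>M distr (distr M K Y) K' g"
    by (simp add: distr_distr o_def)
  also have "\<dots> = distr (distr M N X \<Otimes>\<^sub>M distr M K Y) (N' \<Otimes>\<^sub>M K') (\<lambda>(x, y). (f x, g y))"
    by (rule pair_measure_distr) (simp_all add: gY.sigma_finite_measure_axioms)
  also have "\<dots> = distr (distr M (N \<Otimes>\<^sub>M K) (\<lambda>\<omega>. (X \<omega>, Y \<omega>))) (N' \<Otimes>\<^sub>M K') (\<lambda>(x, y). (f x, g y))"
    using XY by (simp add: indep_rv_def)
  also have "\<dots> = distr M (N' \<Otimes>\<^sub>M K') (\<lambda>\<omega>. (f (X \<omega>), g (Y \<omega>)))"
    by (subst distr_distr) (auto simp: o_def)
  finally show ?thesis by (simp add: indep_rv_def)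
qed

text \<open>The joint law is the product of the three marginals, and Tonelli's theorem allows it to
  be bracketed either way. In this manner a variable is moved from the left block to the right one,
  although the blocks have different types.\<close>

lemma (in prob_space) indep_rv_assoc:
  assumes XY: "indep_rv N X K Y" and XYZ: "indep_rv (N \<Otimes>\<^sub>M K) (\<lambda>\<omega>. (X \<omega>, Y \<omega>)) L Z"
  shows "indep_rv N X (K \<Otimes>\<^sub>M L) (\<lambda>\<omega>. (Y \<omega>, Z \<omega>))"
proof -
  have [measurable]: "X \<in> measurable M N" "Y \<in> measurable M K" "Z \<in> measurable M L"
    using XY XYZ by (auto simp: indep_rv_def)
  have YZ: "indep_rv K Y L Z"
    using indep_rv_compose[OF XYZ, of snd K "\<lambda>z. z" L] by simp
  interpret P: prob_space "distr M N X" by (rule prob_space_distr) simp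
  interpret Q: prob_space "distr M K Y" by (rule prob_space_distr) simp
  interpret R: prob_space "distr M L Z" by (rule prob_space_distr) simp
  interpret QR: prob_space "distr M (K \<Otimes>\<^sub>M L) (\<lambda>\<omega>. (Y \<omega>, Z \<omega>))" by (rule prob_space_distr) simp
  have eqs: "distr M (N \<Otimes>\<^sub>M K) (\<lambda>\<omega>. (X \<omega>, Y \<omega>)) = distr M N X \<Otimes>\<^sub>M distr M K Y"
    "distr M (K \<Otimes>\<^sub>M L) (\<lambda>\<omega>. (Y \<omega>, Z \<omega>)) = distr M K Y \<Otimes>\<^sub>M distr M L Z"
    "distr M ((N \<Otimes>\<^sub>M K) \<Otimes>\<^sub>M L) (\<lambda>\<omega>. ((X \<omega>, Y \<omega>), Z \<omega>)) = distr M (N \<Otimes>\<^sub>M K) (\<lambda>\<omega>. (X \<omega>, Y \<omega>)) \<Otimes>\<^sub>M distr M L Z"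
    using XY XYZ YZ by (simp_all add: indep_rv_def)
  have "distr M N X \<Otimes>\<^sub>M distr M (K \<Otimes>\<^sub>M L) (\<lambda>\<omega>. (Y \<omega>, Z \<omega>)) =
      distr M (N \<Otimes>\<^sub>M (K \<Otimes>\<^sub>M L)) (\<lambda>\<omega>. (X \<omega>, (Y \<omega>, Z \<omega>)))" (is "?l = ?r")
  proof (rule measure_eqI)
    have "sets (distr M N X \<Otimes>\<^sub>M distr M (K \<Otimes>\<^sub>M L) (\<lambda>\<omega>. (Y \<omega>, Z \<omega>))) = sets (N \<Otimes>\<^sub>M (K \<Otimes>\<^sub>M L))"
      by (rule sets_pair_measure_cong) simp_all
    then show "sets ?l = sets ?r" by simp
    fix A assume "A \<in> sets ?l"
    then have A[measurable]: "A \<in> sets (N \<Otimes>\<^sub>M (K \<Otimes>\<^sub>M L))"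
      using \<open>sets ?l = sets (N \<Otimes>\<^sub>M (K \<Otimes>\<^sub>M L))\<close> by simp
    have m1[measurable]: "(\<lambda>w. indicator A (x, w) :: ennreal) \<in> borel_measurable (K \<Otimes>\<^sub>M L)" if "x \<in> space N" for x
      using that by measurable
    have m2[measurable]: "(\<lambda>u. indicator A (fst (fst u), snd (fst u), snd u) :: ennreal) \<in> borel_measurable ((N \<Otimes>\<^sub>M K) \<Otimes>\<^sub>M L)"
      by measurable
    have S: "sets (distr M K Y \<Otimes>\<^sub>M distr M L Z) = sets (K \<Otimes>\<^sub>M L)"
      "sets (distr M N X \<Otimes>\<^sub>M distr M K Y) = sets (N \<Otimes>\<^sub>M K)"
      "sets ((distr M N X \<Otimes>\<^sub>M distr M K Y) \<Otimes>\<^sub>M distr M L Z) = sets ((N \<Otimes>\<^sub>M K) \<Otimes>\<^sub>M L)"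
      by (simp_all cong: sets_pair_measure_cong)
    have m3: "(\<lambda>u. indicator A (fst (fst u), snd (fst u), snd u) :: ennreal) \<in>
        borel_measurable ((distr M N X \<Otimes>\<^sub>M distr M K Y) \<Otimes>\<^sub>M distr M L Z)"
      using m2 by (simp only: measurable_cong_sets[OF S(3) refl])
    have m4: "(\<lambda>v. \<integral>\<^sup>+z. indicator A (fst v, snd v, z) \<partial>distr M L Z) \<in>
        borel_measurable (distr M N X \<Otimes>\<^sub>M distr M K Y)"
      using R.borel_measurable_nn_integral_fst[OF m3] by simp
    have "emeasure ?l A = (\<integral>\<^sup>+x. \<integral>\<^sup>+w. indicator A (x, w) \<partial>distr M (K \<Otimes>\<^sub>M L) (\<lambda>\<omega>. (Y \<omega>, Z \<omega>)) \<partial>distr M N X)"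
      using \<open>A \<in> sets ?l\<close> by (rule QR.emeasure_pair_measure)
    also have "\<dots> = (\<integral>\<^sup>+x. \<integral>\<^sup>+y. \<integral>\<^sup>+z. indicator A (x, y, z) \<partial>distr M L Z \<partial>distr M K Y \<partial>distr M N X)"
    proof (rule nn_integral_cong)
      fix x assume "x \<in> space (distr M N X)"
      then have "(\<lambda>w. indicator A (x, w) :: ennreal) \<in> borel_measurable (distr M K Y \<Otimes>\<^sub>M distr M L Z)"
        using m1 by (simp add: measurable_cong_sets[OF S(1) refl])
      from R.nn_integral_fst[OF this]
      show "(\<integral>\<^sup>+w. indicator A (x, w) \<partial>distr M (K \<Otimes>\<^sub>M L) (\<lambda>\<omega>. (Y \<omega>, Z \<omega>))) =
          (\<integral>\<^sup>+y. \<integral>\<^sup>+z. indicator A (x, y, z) \<partial>distr M L Z \<partial>distr M K Y)"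
        by (simp add: eqs)
    qed
    also have "\<dots> = (\<integral>\<^sup>+v. \<integral>\<^sup>+z. indicator A (fst v, snd v, z) \<partial>distr M L Z \<partial>(distr M N X \<Otimes>\<^sub>M distr M K Y))"
      using Q.nn_integral_fst[OF m4] by simp
    also have "\<dots> = (\<integral>\<^sup>+u. indicator A (fst (fst u), snd (fst u), snd u) \<partial>((distr M N X \<Otimes>\<^sub>M distr M K Y) \<Otimes>\<^sub>M distr M L Z))"
      using R.nn_integral_fst[OF m3] by simp
    also have "\<dots> = (\<integral>\<^sup>+u. indicator A (fst (fst u), snd (fst u), snd u) \<partial>distr M ((N \<Otimes>\<^sub>M K) \<Otimes>\<^sub>M L) (\<lambda>\<omega>. ((X \<omega>, Y \<omega>), Z \<omega>)))"
      by (simp add: eqs)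
    also have "\<dots> = (\<integral>\<^sup>+\<omega>. indicator A (X \<omega>, Y \<omega>, Z \<omega>) \<partial>M)"
      by (subst nn_integral_distr) auto
    also have "\<dots> = (\<integral>\<^sup>+\<omega>. indicator ((\<lambda>\<omega>. (X \<omega>, Y \<omega>, Z \<omega>)) -` A \<inter> space M) \<omega> \<partial>M)"
      by (intro nn_integral_cong) (auto simp: indicator_def)
    also have "\<dots> = emeasure ?r A" by (subst nn_integral_indicator) (auto simp: emeasure_distr)
    finally show "emeasure ?l A = emeasure ?r A" .
  qed
  then show ?thesis by (simp add: indep_rv_def)
qed

lemma (in prob_space) indep_rv_integral_mult:
  fixes X Y :: "'a \<Rightarrow> real"
  assumes "indep_rv borel X borel Y" "integrable M X" "integrable M Y"
  shows "integrable M (\<lambda>\<omega>. X \<omega> * Y \<omega>)" "(\<integral>\<omega>. X \<omega> * Y \<omega> \<partial>M) = (\<integral>\<omega>. X \<omega> \<partial>M) * (\<integral>\<omega>. Y \<omega> \<partial>M)"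
  using indep_var_integrable[of X Y] indep_var_lebesgue_integral[of X Y] assms
  by (auto simp: indep_rv_iff_indep_var)

text \<open>Completing the square in \<open>x\<close>; \<open>s * d / (s + d)\<close> is the
  variance of the bridge. On the left stands the joint density of Brownian motion at times
  \<open>s\<close> and \<open>s + d\<close>, on the right the product of the densities of the end
  point and of the bridge.\<close>

lemma normal_density_bridge:
  fixes x y s d :: real assumes "0 < s" "0 < d"
  shows "normal_density 0 (sqrt s) x * normal_density 0 (sqrt d) (y - x) =
    normal_density 0 (sqrt (s + d)) y * normal_density 0 (sqrt (s * d / (s + d))) (x - s / (s + d) * y)"
proof -
  have e: "x\<^sup>2 / (2 * s) + (y - x)\<^sup>2 / (2 * d) = y\<^sup>2 / (2 * (s + d)) + (x - s / (s + d) * y)\<^sup>2 / (2 * (s * d / (s + d)))"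
  proof -
    define t where "t = s + d"
    have t: "0 < t" "d = t - s" using assms by (auto simp: t_def)
    have "t - s \<noteq> 0" "s \<noteq> 0" "t \<noteq> 0" using assms t by auto
    then have "x\<^sup>2 / (2 * s) + (y - x)\<^sup>2 / (2 * (t - s)) = y\<^sup>2 / (2 * t) + (x - s / t * y)\<^sup>2 / (2 * (s * (t - s) / t))"
      by (simp add: divide_simps power2_eq_square) (simp add: algebra_simps)
    then show ?thesis by (simp add: t_def)
  qed
  have c: "sqrt (2 * pi * s) * sqrt (2 * pi * d) = sqrt (2 * pi * (s + d)) * sqrt (2 * pi * (s * d / (s + d)))"
  proof -
    have "(2 * pi * s) * (2 * pi * d) = (2 * pi * (s + d)) * (2 * pi * (s * d / (s + d)))"
      using assms by (simp add: field_simps)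
    then show ?thesis by (simp only: real_sqrt_mult[symmetric])
  qed
  have nd: "normal_density 0 (sqrt v) z = exp (- (z\<^sup>2 / (2 * v))) / sqrt (2 * pi * v)" if "0 < v" for v z
    using that by (simp add: normal_density_def)
  have "normal_density 0 (sqrt s) x * normal_density 0 (sqrt d) (y - x) =
      exp (- (x\<^sup>2 / (2 * s) + (y - x)\<^sup>2 / (2 * d))) / (sqrt (2 * pi * s) * sqrt (2 * pi * d))"
    using assms by (simp add: nd exp_add[symmetric])
  also have "\<dots> = normal_density 0 (sqrt (s + d)) y * normal_density 0 (sqrt (s * d / (s + d))) (x - s / (s + d) * y)"
    using assms unfolding e c by (subst (1 2) nd) (simp_all add: exp_add[symmetric])
  finally show ?thesis .
qed

text \<open>With \<open>X = B\<^sub>s\<close> and \<open>Z = B\<^sub>t - B\<^sub>s\<close> this is the independence of the bridge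
  \<open>B\<^sub>s - s/t B\<^sub>t\<close> from \<open>B\<^sub>t\<close>.\<close>

lemma (in prob_space) gaussian_bridge_indep:
  fixes X Z :: "'a \<Rightarrow> real" and s d :: real
  assumes X: "distributed M lborel X (normal_density 0 (sqrt s))" and "0 < s"
    and Z: "distributed M lborel Z (normal_density 0 (sqrt d))" and "0 < d"
    and XZ: "indep_rv borel X borel Z"
  shows "indep_rv borel (\<lambda>\<omega>. X \<omega> - s / (s + d) * (X \<omega> + Z \<omega>)) borel (\<lambda>\<omega>. X \<omega> + Z \<omega>)"
proof -
  define r where "r = s / (s + d)"
  define p where "p = (\<lambda>v x. ennreal (normal_density 0 (sqrt v) x))"
  have p_meas[measurable]: "p v \<in> borel_measurable borel" for v unfolding p_def by measurable
  have rv[measurable]: "X \<in> borel_measurable M" "Z \<in> borel_measurable M"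
    using XZ by (auto simp: indep_rv_def)
  have XZ': "indep_var lborel X lborel Z" using XZ by (simp add: indep_rv_iff_indep_var indep_var_eq)
  have joint: "distributed M (lborel \<Otimes>\<^sub>M lborel) (\<lambda>\<omega>. (X \<omega>, Z \<omega>)) (\<lambda>(x, z). p s x * p d z)"
    unfolding p_def using X Z XZ' by (intro distributed_joint_indep lborel.sigma_finite_measure_axioms)
  define v where "v = s * d / (s + d)"
  have v: "0 < v" using assms by (simp add: v_def)
  have key: "p s x * p d (y - x) = p (s + d) y * p v (x - r * y)" for x y
    unfolding p_def v_def r_def using normal_density_bridge[of s d x y] assms
    by (simp add: ennreal_mult[symmetric])
  \<comment> \<open>The substitution \<open>y = x + z\<close>, Fubini's theorem and a shift of
    \<open>x\<close> separate the two variables. Taking \<open>A\<close> or \<open>C\<close> to be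
    \<open>UNIV\<close> gives the marginal laws, so the identity contains the product rule.\<close>
  have split: "emeasure M {\<omega> \<in> space M. X \<omega> - r * (X \<omega> + Z \<omega>) \<in> A \<and> X \<omega> + Z \<omega> \<in> C} =
      (\<integral>\<^sup>+w. p v w * indicator A w \<partial>lborel) * (\<integral>\<^sup>+y. p (s + d) y * indicator C y \<partial>lborel)"
    if [measurable]: "A \<in> sets borel" "C \<in> sets borel" for A C
  proof -
    define f :: "real \<Rightarrow> real \<Rightarrow> ennreal" where "f x z = indicator A (x - r * (x + z)) * indicator C (x + z)" for x z
    have [measurable]: "(\<lambda>(x, z). f x z) \<in> borel_measurable (borel \<Otimes>\<^sub>M borel)"
      unfolding f_def by measurable
    have "emeasure M {\<omega> \<in> space M. X \<omega> - r * (X \<omega> + Z \<omega>) \<in> A \<and> X \<omega> + Z \<omega> \<in> C} =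
        (\<integral>\<^sup>+\<omega>. indicator {\<omega> \<in> space M. X \<omega> - r * (X \<omega> + Z \<omega>) \<in> A \<and> X \<omega> + Z \<omega> \<in> C} \<omega> \<partial>M)"
      by simp
    also have "\<dots> = (\<integral>\<^sup>+\<omega>. (\<lambda>(x, z). f x z) (X \<omega>, Z \<omega>) \<partial>M)"
      by (intro nn_integral_cong) (auto simp: f_def indicator_def)
    also have "\<dots> = (\<integral>\<^sup>+u. (\<lambda>(x, z). p s x * p d z) u * (\<lambda>(x, z). f x z) u \<partial>(lborel \<Otimes>\<^sub>M lborel))"
      by (rule distributed_nn_integral[OF joint, symmetric]) measurable
    also have "\<dots> = (\<integral>\<^sup>+x. \<integral>\<^sup>+z. p s x * p d z * f x z \<partial>lborel \<partial>lborel)"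
      by (subst lborel.nn_integral_fst[symmetric]) (auto simp: split_beta')
    also have "\<dots> = (\<integral>\<^sup>+x. \<integral>\<^sup>+y. p s x * p d (y - x) * f x (y - x) \<partial>lborel \<partial>lborel)"
    proof (rule nn_integral_cong)
      fix x :: real
      show "(\<integral>\<^sup>+z. p s x * p d z * f x z \<partial>lborel) = (\<integral>\<^sup>+y. p s x * p d (y - x) * f x (y - x) \<partial>lborel)"
        by (subst nn_integral_real_affine[where c=1 and t="-x"]) (auto simp: add.commute)
    qed
    also have "\<dots> = (\<integral>\<^sup>+x. \<integral>\<^sup>+y. p (s + d) y * indicator C y * (p v (x - r * y) * indicator A (x - r * y)) \<partial>lborel \<partial>lborel)"
      unfolding key f_def by (intro nn_integral_cong) (simp add: ac_simps)
    also have "\<dots> = (\<integral>\<^sup>+y. \<integral>\<^sup>+x. p (s + d) y * indicator C y * (p v (x - r * y) * indicator A (x - r * y)) \<partial>lborel \<partial>lborel)"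
      by (rule lborel_pair.Fubini'[symmetric]) measurable
    also have "\<dots> = (\<integral>\<^sup>+y. p (s + d) y * indicator C y * (\<integral>\<^sup>+w. p v w * indicator A w \<partial>lborel) \<partial>lborel)"
    proof (rule nn_integral_cong)
      fix y :: real
      have "(\<integral>\<^sup>+x. p v (x - r * y) * indicator A (x - r * y) \<partial>lborel) = (\<integral>\<^sup>+w. p v w * indicator A w \<partial>lborel)"
        by (subst nn_integral_real_affine[where c=1 and t="r * y"]) auto
      then show "(\<integral>\<^sup>+x. p (s + d) y * indicator C y * (p v (x - r * y) * indicator A (x - r * y)) \<partial>lborel) =
          p (s + d) y * indicator C y * (\<integral>\<^sup>+w. p v w * indicator A w \<partial>lborel)"
        by (subst nn_integral_cmult) auto
    qed
    also have "\<dots> = (\<integral>\<^sup>+w. p v w * indicator A w \<partial>lborel) * (\<integral>\<^sup>+y. p (s + d) y * indicator C y \<partial>lborel)"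
      by (subst nn_integral_multc) (auto simp: mult.commute)
    finally show ?thesis .
  qed
  have one: "(\<integral>\<^sup>+w. p u w * indicator UNIV w \<partial>lborel) = 1" if "0 < u" for u
    using prob_space.emeasure_space_1[OF prob_space_normal_density[of "sqrt u" 0]] that
    by (simp add: emeasure_density p_def)
  let ?W = "\<lambda>\<omega>. X \<omega> - r * (X \<omega> + Z \<omega>)" and ?Y = "\<lambda>\<omega>. X \<omega> + Z \<omega>"
  have "indep_rv borel ?W borel ?Y"
  proof (rule indep_rvI)
    fix A C :: "real set" assume [measurable]: "A \<in> sets borel" "C \<in> sets borel"
    have pre: "?W -` A \<inter> space M = {\<omega> \<in> space M. ?W \<omega> \<in> A \<and> ?Y \<omega> \<in> UNIV}"
      "?Y -` C \<inter> space M = {\<omega> \<in> space M. ?W \<omega> \<in> UNIV \<and> ?Y \<omega> \<in> C}"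
      "(?W -` A \<inter> space M) \<inter> (?Y -` C \<inter> space M) = {\<omega> \<in> space M. ?W \<omega> \<in> A \<and> ?Y \<omega> \<in> C}" by auto
    have e1: "emeasure M (?W -` A \<inter> space M) = (\<integral>\<^sup>+w. p v w * indicator A w \<partial>lborel)"
      unfolding pre(1) using split[of A UNIV] one[of "s + d"] assms by simp
    have e2: "emeasure M (?Y -` C \<inter> space M) = (\<integral>\<^sup>+y. p (s + d) y * indicator C y \<partial>lborel)"
      unfolding pre(2) using split[of UNIV C] one[OF v] by simp
    have "emeasure M ((?W -` A \<inter> space M) \<inter> (?Y -` C \<inter> space M)) =
        emeasure M (?W -` A \<inter> space M) * emeasure M (?Y -` C \<inter> space M)"
      unfolding e1 e2 unfolding pre(3) by (rule split) measurable
    then show "prob ((?W -` A \<inter> space M) \<inter> (?Y -` C \<inter> space M)) =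
        prob (?W -` A \<inter> space M) * prob (?Y -` C \<inter> space M)"
      by (simp add: measure_def enn2real_mult[symmetric])
  qed simp_all
  then show ?thesis by (simp add: r_def)
qed

section \<open>Increments of Brownian motion\<close>

lemma integrable_mult_of_squares:
  fixes f g :: "'a \<Rightarrow> real"
  assumes [measurable]: "f \<in> borel_measurable M" "g \<in> borel_measurable M"
    and "integrable M (\<lambda>x. (f x)\<^sup>2)" "integrable M (\<lambda>x. (g x)\<^sup>2)"
  shows "integrable M (\<lambda>x. f x * g x)"
proof (rule Bochner_Integration.integrable_bound)
  show "integrable M (\<lambda>x. (f x)\<^sup>2 + (g x)\<^sup>2)" using assms by simp
  have "\<bar>x * y\<bar> \<le> x\<^sup>2 + y\<^sup>2" for x y :: real
    using sum_squares_bound[of "\<bar>x\<bar>" "\<bar>y\<bar>"] mult_nonneg_nonneg[of "\<bar>x\<bar>" "\<bar>y\<bar>"]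
    by (simp only: abs_mult power2_abs) linarith
  then show "AE x in M. norm (f x * g x) \<le> norm ((f x)\<^sup>2 + (g x)\<^sup>2)" by (intro AE_I2) simp
qed simp

lemma (in prob_space) integrable_of_square:
  fixes f :: "'a \<Rightarrow> real"
  assumes [measurable]: "f \<in> borel_measurable M" and "integrable M (\<lambda>x. (f x)\<^sup>2)"
  shows "integrable M f"
  using integrable_mult_of_squares[of f M "\<lambda>_. 1"] assms by simp

lemma (in prob_space) indep_rv_integral_square_mult:
  fixes f g :: "'a \<Rightarrow> real"
  assumes ind: "indep_rv borel f borel g" and "integrable M (\<lambda>x. (f x)\<^sup>2)" "integrable M (\<lambda>x. (g x)\<^sup>2)"
  shows "integrable M (\<lambda>x. (f x * g x)\<^sup>2)"
    "(\<integral>x. (f x * g x)\<^sup>2 \<partial>M) = (\<integral>x. (f x)\<^sup>2 \<partial>M) * (\<integral>x. (g x)\<^sup>2 \<partial>M)"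
    "(\<integral>x. f x * g x \<partial>M) = (\<integral>x. f x \<partial>M) * (\<integral>x. g x \<partial>M)"
proof -
  have [measurable]: "f \<in> borel_measurable M" "g \<in> borel_measurable M" using ind by (auto simp: indep_rv_def)
  have sq: "indep_rv borel (\<lambda>x. (f x)\<^sup>2) borel (\<lambda>x. (g x)\<^sup>2)"
    by (rule indep_rv_compose[OF ind]) measurable
  show "integrable M (\<lambda>x. (f x * g x)\<^sup>2)"
    "(\<integral>x. (f x * g x)\<^sup>2 \<partial>M) = (\<integral>x. (f x)\<^sup>2 \<partial>M) * (\<integral>x. (g x)\<^sup>2 \<partial>M)"
    using indep_rv_integral_mult[OF sq assms(2,3)] by (simp_all add: power_mult_distrib)
  show "(\<integral>x. f x * g x \<partial>M) = (\<integral>x. f x \<partial>M) * (\<integral>x. g x \<partial>M)"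
    by (rule indep_rv_integral_mult(2)[OF ind integrable_of_square integrable_of_square]) (simp_all add: assms)
qed

context brownian_motion
begin

lemma subalgebra_F: "0 \<le> t \<Longrightarrow> subalgebra M (F t)"
  by (simp add: subalgebra_def space_F sets_F_subset)

lemma measurable_F: "0 \<le> t \<Longrightarrow> f \<in> measurable (F t) N \<Longrightarrow> f \<in> measurable M N"
  using measurable_from_subalg[OF subalgebra_F] .

lemma measurable_F_mono: "s \<le> t \<Longrightarrow> f \<in> measurable (F s) N \<Longrightarrow> f \<in> measurable (F t) N"
  by (rule measurable_from_subalg[of "F t" "F s"]) (simp_all add: subalgebra_def space_F sets_F_mono)

lemma B_measurable_F: "0 \<le> s \<Longrightarrow> s \<le> t \<Longrightarrow> B s \<in> borel_measurable (F t)"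
  using B_adapted measurable_F_mono[of s t] by (auto simp: adapted_def)

lemma B_measurable: "0 \<le> t \<Longrightarrow> B t \<in> borel_measurable M"
  using B_measurable_F[of t t] measurable_F by blast

text \<open>The value space of \<open>V\<close> is left open so that a past variable together with a
  vector of earlier increments can be taken for \<open>V\<close>.\<close>

lemma indep_increment:
  assumes st: "0 \<le> s" "s < t" and V: "V \<in> measurable (F s) N"
  shows "indep_rv N V borel (\<lambda>\<omega>. B t \<omega> - B s \<omega>)"
proof (rule indep_rvI)
  show "V \<in> measurable M N" using measurable_F[OF st(1) V] .
  have [measurable]: "B s \<in> borel_measurable M" "B t \<in> borel_measurable M" using st B_measurable by auto
  show "(\<lambda>\<omega>. B t \<omega> - B s \<omega>) \<in> borel_measurable M" by measurable
  fix A C assume A: "A \<in> sets N" and C: "C \<in> sets (borel :: real measure)"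
  have "V -` A \<inter> space M \<in> sets (F s)" using measurable_sets[OF V A] by (simp add: space_F)
  moreover have "(\<lambda>\<omega>. B t \<omega> - B s \<omega>) -` C \<inter> space M \<in>
      sets (vimage_algebra (space M) (\<lambda>\<omega>. B t \<omega> - B s \<omega>) borel)"
    using C by (rule in_vimage_algebra)
  ultimately show "prob ((V -` A \<inter> space M) \<inter> ((\<lambda>\<omega>. B t \<omega> - B s \<omega>) -` C \<inter> space M)) =
      prob (V -` A \<inter> space M) * prob ((\<lambda>\<omega>. B t \<omega> - B s \<omega>) -` C \<inter> space M)"
    by (rule indep_setD[OF B_indep_increments[OF st]])
qed

text \<open>The second moment serves the forward sums, the variance
  \<open>2 * (t - s)\<^sup>2\<close> of the squared increment the quadratic variation, and the third
  absolute moment the Taylor remainders; the exact value of the last carries the factor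
  \<open>sqrt (2 / pi)\<close>, estimated by 1.\<close>

lemma increment_moments:
  assumes st: "0 \<le> s" "s < t"
  defines "Z \<equiv> \<lambda>\<omega>. B t \<omega> - B s \<omega>"
  shows "(\<integral>\<omega>. Z \<omega> \<partial>M) = 0"
    "integrable M (\<lambda>\<omega>. (Z \<omega>)\<^sup>2)" "(\<integral>\<omega>. (Z \<omega>)\<^sup>2 \<partial>M) = t - s"
    "integrable M (\<lambda>\<omega>. ((Z \<omega>)\<^sup>2 - (t - s))\<^sup>2)" "(\<integral>\<omega>. ((Z \<omega>)\<^sup>2 - (t - s))\<^sup>2 \<partial>M) = 2 * (t - s)\<^sup>2"
    "(\<integral>\<omega>. (Z \<omega>)\<^sup>2 - (t - s) \<partial>M) = 0"
    "integrable M (\<lambda>\<omega>. \<bar>Z \<omega>\<bar> ^ 3)" "(\<integral>\<omega>. \<bar>Z \<omega>\<bar> ^ 3 \<partial>M) \<le> 2 * (t - s) * sqrt (t - s)"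
proof -
  define d where "d = t - s"
  have d: "0 < d" using st by (simp add: d_def)
  have sd: "(sqrt d)\<^sup>2 = d" using d by simp
  have D: "distributed M lborel Z (normal_density 0 (sqrt d))"
    unfolding Z_def d_def using B_normal_increments[OF st] .
  have mom: "integrable M (\<lambda>\<omega>. f (Z \<omega>))" "(\<integral>\<omega>. f (Z \<omega>) \<partial>M) = c"
    if "has_bochner_integral lborel (\<lambda>x. normal_density 0 (sqrt d) x * f x) c" "f \<in> borel_measurable borel" for f c
    using that distributed_integrable[OF D, of f] distributed_integral[OF D, of f]
    by (auto simp: has_bochner_integral_iff)
  have h1: "has_bochner_integral lborel (\<lambda>x. normal_density 0 (sqrt d) x * x) 0"
    using normal_moment_odd[of "sqrt d" 0 0] d by simp
  show "(\<integral>\<omega>. Z \<omega> \<partial>M) = 0" using mom[OF h1] by simp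
  have h2: "has_bochner_integral lborel (\<lambda>x. normal_density 0 (sqrt d) x * x\<^sup>2) d"
    using normal_moment_even[of "sqrt d" 0 1] d by (simp add: sd)
  have m2: "integrable M (\<lambda>\<omega>. (Z \<omega>)\<^sup>2)" "(\<integral>\<omega>. (Z \<omega>)\<^sup>2 \<partial>M) = d"
    using mom[OF h2] by simp_all
  have "fact 4 / ((2 / d)\<^sup>2 * fact 2) = 3 * d\<^sup>2" using d by (simp add: fact_numeral power2_eq_square)
  then have h4: "has_bochner_integral lborel (\<lambda>x. normal_density 0 (sqrt d) x * x^4) (3 * d\<^sup>2)"
    using normal_moment_even[of "sqrt d" 0 2] d by (simp add: sd)
  have m4: "integrable M (\<lambda>\<omega>. (Z \<omega>)^4)" "(\<integral>\<omega>. (Z \<omega>)^4 \<partial>M) = 3 * d\<^sup>2"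
    using mom[OF h4] by simp_all
  show "integrable M (\<lambda>\<omega>. (Z \<omega>)\<^sup>2)" "(\<integral>\<omega>. (Z \<omega>)\<^sup>2 \<partial>M) = t - s" using m2 by (auto simp: d_def)
  have eq: "((Z \<omega>)\<^sup>2 - (t - s))\<^sup>2 = (Z \<omega>)^4 - 2 * d * (Z \<omega>)\<^sup>2 + d\<^sup>2" for \<omega>
    by (simp add: power2_eq_square power4_eq_xxxx algebra_simps d_def)
  show "integrable M (\<lambda>\<omega>. ((Z \<omega>)\<^sup>2 - (t - s))\<^sup>2)" unfolding eq using m2 m4 by simp
  show "(\<integral>\<omega>. ((Z \<omega>)\<^sup>2 - (t - s))\<^sup>2 \<partial>M) = 2 * (t - s)\<^sup>2"
    unfolding eq using m2 m4 by (simp add: prob_space power2_eq_square d_def)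
  show "(\<integral>\<omega>. (Z \<omega>)\<^sup>2 - (t - s) \<partial>M) = 0" using m2 by (simp add: prob_space d_def)
  have m3: "has_bochner_integral lborel (\<lambda>x. normal_density 0 (sqrt d) x * \<bar>x\<bar>^3) (2 * sqrt d ^ 3 * sqrt (2 / pi))"
    using normal_moment_abs_odd[of "sqrt d" 0 1] d by (simp add: numeral_3_eq_3)
  show "integrable M (\<lambda>\<omega>. \<bar>Z \<omega>\<bar> ^ 3)" using mom[OF m3] by simp
  have "(\<integral>\<omega>. \<bar>Z \<omega>\<bar> ^ 3 \<partial>M) = 2 * sqrt d ^ 3 * sqrt (2 / pi)" using mom[OF m3] by simp
  also have "\<dots> \<le> 2 * sqrt d ^ 3 * 1"
    using d pi_gt3 by (intro mult_left_mono) auto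
  also have "\<dots> = 2 * d * sqrt d" using sd by (simp add: power3_eq_cube power2_eq_square)
  finally show "(\<integral>\<omega>. \<bar>Z \<omega>\<bar> ^ 3 \<partial>M) \<le> 2 * (t - s) * sqrt (t - s)" by (simp add: d_def)
qed

text \<open>Multiplied by any function of earlier terms, \<open>c k\<close> stays
  \<open>F (t k)\<close>-measurable, and the centred \<open>\<phi> k\<close> of the next increment
  is independent of it; so the products are orthogonal. The instances are the identity and the
  square minus the step length.\<close>

lemma increments_maximal:
  fixes c :: "nat \<Rightarrow> 'w \<Rightarrow> real" and \<phi> :: "nat \<Rightarrow> real \<Rightarrow> real"
  assumes t: "strict_mono t" "0 \<le> t 0"
    and c: "\<And>k. k < N \<Longrightarrow> c k \<in> borel_measurable (F (t k))" "\<And>k. k < N \<Longrightarrow> integrable M (\<lambda>\<omega>. (c k \<omega>)\<^sup>2)"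
    and \<phi>[measurable]: "\<And>k. \<phi> k \<in> borel_measurable borel"
    and \<phi>_sq: "\<And>k. k < N \<Longrightarrow> integrable M (\<lambda>\<omega>. (\<phi> k (B (t (Suc k)) \<omega> - B (t k) \<omega>))\<^sup>2)"
    and \<phi>_0: "\<And>k. k < N \<Longrightarrow> (\<integral>\<omega>. \<phi> k (B (t (Suc k)) \<omega> - B (t k) \<omega>) \<partial>M) = 0"
    and "0 < l"
  shows "off_event M ((\<Sum>k<N. (\<integral>\<omega>. (c k \<omega>)\<^sup>2 \<partial>M) * (\<integral>\<omega>. (\<phi> k (B (t (Suc k)) \<omega> - B (t k) \<omega>))\<^sup>2 \<partial>M)) / l\<^sup>2)
    (\<lambda>\<omega>. \<forall>j\<le>N. \<bar>\<Sum>k<j. c k \<omega> * \<phi> k (B (t (Suc k)) \<omega> - B (t k) \<omega>)\<bar> < l)"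
proof -
  have tk: "0 \<le> t k" "t k < t (Suc k)" "i \<le> k \<Longrightarrow> t i \<le> t k" for i k
    using t strict_mono_less_eq[OF t(1)] strict_monoD[OF t(1)] by (auto intro: order_trans[of 0 "t 0"])
  let ?Z = "\<lambda>k \<omega>. \<phi> k (B (t (Suc k)) \<omega> - B (t k) \<omega>)"
  define d where "d k \<omega> = c k \<omega> * ?Z k \<omega>" for k \<omega>
  have ind: "indep_rv borel V borel (?Z k)" if "V \<in> borel_measurable (F (t k))" for V :: "'w \<Rightarrow> real" and k
    using indep_rv_compose[OF indep_increment[OF tk(1,2) that], of "\<lambda>x. x" borel "\<phi> k" borel] by simp
  have d_meas: "d i \<in> borel_measurable (F (t k))" if "i < k" "i < N" for i k
  proof -
    have [measurable]: "c i \<in> borel_measurable (F (t k))" "B (t i) \<in> borel_measurable (F (t k))"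
      "B (t (Suc i)) \<in> borel_measurable (F (t k))"
      using that c tk by (auto intro: measurable_F_mono[of "t i" "t k"] B_measurable_F)
    show ?thesis unfolding d_def by measurable
  qed
  have sq: "integrable M (\<lambda>\<omega>. (c k \<omega> * ?Z k \<omega>)\<^sup>2)"
    "(\<integral>\<omega>. (c k \<omega> * ?Z k \<omega>)\<^sup>2 \<partial>M) = (\<integral>\<omega>. (c k \<omega>)\<^sup>2 \<partial>M) * (\<integral>\<omega>. (?Z k \<omega>)\<^sup>2 \<partial>M)" if "k < N" for k
    using indep_rv_integral_square_mult(1,2)[of "c k" "?Z k"] ind[of "c k" k] c \<phi>_sq that by simp_all
  have "off_event M ((\<Sum>k<N. \<integral>\<omega>. (d k \<omega>)\<^sup>2 \<partial>M) / l\<^sup>2) (\<lambda>\<omega>. \<forall>j\<le>N. \<bar>\<Sum>k<j. d k \<omega>\<bar> < l)"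
  proof (rule maximal_inequality)
    show "d k \<in> borel_measurable M" if "k < N" for k
      using measurable_F[OF tk(1) d_meas[of k "Suc k"]] that by simp
    show "integrable M (\<lambda>\<omega>. (d k \<omega>)\<^sup>2)" if "k < N" for k
      unfolding d_def using sq(1) that by simp
    fix k and \<Phi> :: "(nat \<Rightarrow> real) \<Rightarrow> real"
    assume k: "k < N" and [measurable]: "\<Phi> \<in> borel_measurable (PiM {..<k} (\<lambda>_. borel :: real measure))"
      and \<Phi>_sq: "integrable M (\<lambda>\<omega>. (\<Phi> (\<lambda>i\<in>{..<k}. d i \<omega>))\<^sup>2)"
    have [measurable]: "(\<lambda>\<omega>. \<lambda>i\<in>{..<k}. d i \<omega>) \<in> measurable (F (t k)) (PiM {..<k} (\<lambda>_. borel))"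
      using k d_meas by (intro measurable_restrict) auto
    have \<Phi>[measurable]: "(\<lambda>\<omega>. \<Phi> (\<lambda>i\<in>{..<k}. d i \<omega>)) \<in> borel_measurable (F (t k))" by measurable
    have ck[measurable]: "c k \<in> borel_measurable (F (t k))" using c k by simp
    have "(\<integral>\<omega>. \<Phi> (\<lambda>i\<in>{..<k}. d i \<omega>) * d k \<omega> \<partial>M) = (\<integral>\<omega>. (\<Phi> (\<lambda>i\<in>{..<k}. d i \<omega>) * c k \<omega>) * ?Z k \<omega> \<partial>M)"
      by (simp add: d_def ac_simps)
    also have "\<dots> = (\<integral>\<omega>. \<Phi> (\<lambda>i\<in>{..<k}. d i \<omega>) * c k \<omega> \<partial>M) * (\<integral>\<omega>. ?Z k \<omega> \<partial>M)"
    proof (rule indep_rv_integral_mult(2))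
      show i: "indep_rv borel (\<lambda>\<omega>. \<Phi> (\<lambda>i\<in>{..<k}. d i \<omega>) * c k \<omega>) borel (?Z k)"
        by (rule ind) measurable
      show "integrable M (\<lambda>\<omega>. \<Phi> (\<lambda>i\<in>{..<k}. d i \<omega>) * c k \<omega>)"
        using measurable_F[OF tk(1) \<Phi>] measurable_F[OF tk(1) ck] \<Phi>_sq c(2)[OF k] by (rule integrable_mult_of_squares)
      show "integrable M (?Z k)"
        using i \<phi>_sq[OF k] by (auto simp: indep_rv_def intro: integrable_of_square[of "?Z k"])
    qed
    finally show "(\<integral>\<omega>. \<Phi> (\<lambda>i\<in>{..<k}. d i \<omega>) * d k \<omega> \<partial>M) = 0" using \<phi>_0[OF k] by simp
  qed (rule \<open>0 < l\<close>)
  then show ?thesis unfolding d_def using sq(2) by simp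
qed

end

section \<open>Independence of the past from a whole block of future increments\<close>

context brownian_motion
begin

text \<open>Induction on \<open>N\<close>: the pair of \<open>V\<close> and the increments so far is
  measurable at time \<open>t N\<close>, hence independent of the next increment, which
  \<open>indep_rv_assoc\<close> then attaches to the block.\<close>

lemma indep_future_increments:
  assumes t: "strict_mono t" "0 \<le> t 0" and V: "V \<in> measurable (F (t l)) K" and "l \<le> N"
  shows "indep_rv K V (PiM {l..<N} (\<lambda>_. borel)) (\<lambda>\<omega>. \<lambda>i\<in>{l..<N}. B (t (Suc i)) \<omega> - B (t i) \<omega>)"
  using \<open>l \<le> N\<close>
proof (induction N rule: dec_induct)
  have tk: "0 \<le> t k" "t k < t (Suc k)" "i \<le> k \<Longrightarrow> t i \<le> t k" for i k
    using t strict_mono_less_eq[OF t(1)] strict_monoD[OF t(1)] by (auto intro: order_trans[of 0 "t 0"])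
  {
    case base
    \<comment> \<open>The empty vector of increments is constant; its independence from
      \<open>V\<close> comes from composing the next increment with a constant map.\<close>
    have "(\<lambda>_. \<lambda>_. undefined) \<in> measurable borel (PiM {l..<l} (\<lambda>_. borel))"
      by (rule measurable_const) (simp add: space_PiM)
    from indep_rv_compose[OF indep_increment[OF tk(1,2) V] _ this, of "\<lambda>x. x" K] show ?case
      by (simp add: restrict_def)
  next
    case (step N)
    let ?U = "\<lambda>N \<omega>. \<lambda>i\<in>{l..<N}. B (t (Suc i)) \<omega> - B (t i) \<omega>"
    have [measurable]: "V \<in> measurable (F (t N)) K" using measurable_F_mono[OF tk(3) V] step by simp
    have [measurable]: "?U N \<in> measurable (F (t N)) (PiM {l..<N} (\<lambda>_. borel))"
    proof (rule measurable_restrict)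
      fix i assume "i \<in> {l..<N}"
      then have [measurable]: "B (t i) \<in> borel_measurable (F (t N))" "B (t (Suc i)) \<in> borel_measurable (F (t N))"
        using tk by (auto intro!: B_measurable_F)
      show "(\<lambda>\<omega>. B (t (Suc i)) \<omega> - B (t i) \<omega>) \<in> borel_measurable (F (t N))" by measurable
    qed
    have "(\<lambda>\<omega>. (V \<omega>, ?U N \<omega>)) \<in> measurable (F (t N)) (K \<Otimes>\<^sub>M PiM {l..<N} (\<lambda>_. borel))" by measurable
    from indep_rv_assoc[OF step.IH indep_increment[OF tk(1,2) this]]
    have ind: "indep_rv K V (PiM {l..<N} (\<lambda>_. borel) \<Otimes>\<^sub>M borel) (\<lambda>\<omega>. (?U N \<omega>, B (t (Suc N)) \<omega> - B (t N) \<omega>))" .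
    have ext: "(\<lambda>(u, z). u(N := z)) \<in> measurable (PiM {l..<N} (\<lambda>_. borel) \<Otimes>\<^sub>M (borel :: real measure))
        (PiM (insert N {l..<N}) (\<lambda>_. borel))" by (rule measurable_add_dim)
    have U: "?U (Suc N) = (\<lambda>\<omega>. (\<lambda>(u, z). u(N := z)) (?U N \<omega>, B (t (Suc N)) \<omega> - B (t N) \<omega>))"
      using step by (auto simp: fun_eq_iff restrict_def)
    have I: "{l..<Suc N} = insert N {l..<N}" using step by auto
    have "indep_rv K V (PiM {l..<Suc N} (\<lambda>_. borel))
        (\<lambda>\<omega>. (\<lambda>(u, z). u(N := z)) (?U N \<omega>, B (t (Suc N)) \<omega> - B (t N) \<omega>))"
      unfolding I by (rule indep_rv_compose[OF ind _ ext, of "\<lambda>x. x" K]) simp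
    from back_subst[of "indep_rv K V (PiM {l..<Suc N} (\<lambda>_. borel))", OF this U[symmetric]]
    show ?case .
  }
qed

end

text \<open>The start at 0 holds at every sample point, so that terms at time 0 are deterministic
  without an exceptional set. The general case reduces to this one by subtracting
  \<open>B 0\<close>.\<close>

locale centered_brownian_motion = brownian_motion +
  assumes B_0: "\<omega> \<in> space M \<Longrightarrow> B 0 \<omega> = 0"
begin

section \<open>Law and density bounds of Brownian motion started at 0\<close>

lemma B_distributed:
  assumes "0 < t" shows "distributed M lborel (B t) (normal_density 0 (sqrt t))"
proof -
  have D: "distributed M lborel (\<lambda>\<omega>. B t \<omega> - B 0 \<omega>) (normal_density 0 (sqrt t))"
    using B_normal_increments[of 0 t] assms by simp
  have "distr M lborel (B t) = distr M lborel (\<lambda>\<omega>. B t \<omega> - B 0 \<omega>)"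
    by (rule distr_cong) (simp_all add: B_0)
  moreover have "B t \<in> borel_measurable M" using assms by (intro B_measurable) simp
  ultimately show ?thesis using D by (simp add: distributed_def)
qed

text \<open>The constant \<open>c\<close> has to bound the density only where \<open>u\<close> is
  nonzero, hence the factor \<open>u\<close> on both sides of the hypothesis.\<close>

lemma expectation_B_le:
  assumes "0 < t" and [measurable]: "u \<in> borel_measurable borel" and u: "\<And>x. 0 \<le> u x" "integrable lborel u"
    and c: "\<And>x. normal_density 0 (sqrt t) x * u x \<le> c * u x"
  shows "integrable M (\<lambda>\<omega>. u (B t \<omega>))" "(\<integral>\<omega>. u (B t \<omega>) \<partial>M) \<le> c * (\<integral>x. u x \<partial>lborel)"
proof -
  have int: "integrable lborel (\<lambda>x. normal_density 0 (sqrt t) x * u x)"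
  proof (rule Bochner_Integration.integrable_bound)
    show "integrable lborel (\<lambda>x. c * u x)" using u by simp
    show "AE x in lborel. norm (normal_density 0 (sqrt t) x * u x) \<le> norm (c * u x)"
      using c u(1) by (intro AE_I2) (smt (verit) mult_nonneg_nonneg normal_density_nonneg real_norm_def)
  qed simp
  show "integrable M (\<lambda>\<omega>. u (B t \<omega>))"
    using distributed_integrable[OF B_distributed[OF \<open>0 < t\<close>], of u] int by simp
  have "(\<integral>\<omega>. u (B t \<omega>) \<partial>M) = (\<integral>x. normal_density 0 (sqrt t) x * u x \<partial>lborel)"
    using distributed_integral[OF B_distributed[OF \<open>0 < t\<close>], of u] by simp
  also have "\<dots> \<le> (\<integral>x. c * u x \<partial>lborel)"
    using int u c by (intro integral_mono) auto
  finally show "(\<integral>\<omega>. u (B t \<omega>) \<partial>M) \<le> c * (\<integral>x. u x \<partial>lborel)" by simp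
qed

lemma expectation_B_le_sqrt:
  assumes "0 < t" and "u \<in> borel_measurable borel" and u: "\<And>x. 0 \<le> u x" "integrable lborel u"
  shows "integrable M (\<lambda>\<omega>. u (B t \<omega>))" "(\<integral>\<omega>. u (B t \<omega>) \<partial>M) \<le> (\<integral>x. u x \<partial>lborel) / sqrt t"
proof -
  have "normal_density 0 (sqrt t) x \<le> 1 / sqrt t" for x
  proof -
    have "normal_density 0 (sqrt t) x = exp (- (x\<^sup>2 / (2 * t))) / sqrt (2 * pi * t)"
      using \<open>0 < t\<close> by (simp add: normal_density_def)
    also have "\<dots> \<le> 1 / sqrt t"
    proof (rule frac_le)
      show "exp (- (x\<^sup>2 / (2 * t))) \<le> 1" using \<open>0 < t\<close> by simp
      have "1 * t \<le> 2 * pi * t" using \<open>0 < t\<close> pi_gt3 by (intro mult_right_mono) linarith+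
      then show "sqrt t \<le> sqrt (2 * pi * t)" by simp
    qed (use \<open>0 < t\<close> in auto)
    finally show ?thesis .
  qed
  then have "normal_density 0 (sqrt t) x * u x \<le> 1 / sqrt t * u x" for x
    using u(1) by (rule mult_right_mono)
  from expectation_B_le[OF assms this]
  show "integrable M (\<lambda>\<omega>. u (B t \<omega>))" "(\<integral>\<omega>. u (B t \<omega>) \<partial>M) \<le> (\<integral>x. u x \<partial>lborel) / sqrt t" by auto
qed

text \<open>Away from \<open>0\<close> the density of \<open>B\<^sub>t\<close> is bounded uniformly in \<open>t\<close>, since
  \<open>exp (- y\<^sup>2 / 2) \<le> 1 / y\<close>.\<close>

lemma expectation_B_le_away_from_0:
  assumes "0 < t" and "u \<in> borel_measurable borel" and u: "\<And>x. 0 \<le> u x" "integrable lborel u"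
    and "0 < \<delta>" "\<And>x. \<bar>x\<bar> < \<delta> \<Longrightarrow> u x = 0"
  shows "(\<integral>\<omega>. u (B t \<omega>) \<partial>M) \<le> (\<integral>x. u x \<partial>lborel) / \<delta>"
proof -
  have "normal_density 0 (sqrt t) x \<le> 1 / \<delta>" if "\<delta> \<le> \<bar>x\<bar>" for x
  proof -
    define y where "y = \<bar>x\<bar> / sqrt t"
    have y: "0 < y" using that \<open>0 < t\<close> \<open>0 < \<delta>\<close> by (simp add: y_def)
    have "y \<le> 1 + y\<^sup>2 / 2" using zero_le_power2[of "y - 1"] by (simp add: power2_diff)
    also have "\<dots> \<le> exp (y\<^sup>2 / 2)" by (rule exp_ge_add_one_self)
    finally have "1 / exp (y\<^sup>2 / 2) \<le> 1 / y" using y by (intro divide_left_mono) auto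
    then have e: "exp (- (y\<^sup>2 / 2)) \<le> sqrt t / \<bar>x\<bar>" by (simp add: exp_minus inverse_eq_divide y_def)
    have "y\<^sup>2 / 2 = x\<^sup>2 / (2 * t)" using \<open>0 < t\<close> by (simp add: y_def power_divide)
    then have "normal_density 0 (sqrt t) x = exp (- (y\<^sup>2 / 2)) / sqrt (2 * pi * t)"
      using \<open>0 < t\<close> by (simp add: normal_density_def)
    also have "\<dots> \<le> (sqrt t / \<delta>) / sqrt t"
    proof (rule frac_le)
      show "exp (- (y\<^sup>2 / 2)) \<le> sqrt t / \<delta>"
      proof -
        have "sqrt t / \<bar>x\<bar> \<le> sqrt t / \<delta>" using that \<open>0 < \<delta>\<close> \<open>0 < t\<close> by (intro divide_left_mono) auto
        with e show ?thesis by linarith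
      qed
      have "1 * t \<le> 2 * pi * t" using \<open>0 < t\<close> pi_gt3 by (intro mult_right_mono) linarith+
      then show "sqrt t \<le> sqrt (2 * pi * t)" by simp
    qed (use \<open>0 < t\<close> \<open>0 < \<delta>\<close> in auto)
    finally show ?thesis using \<open>0 < t\<close> by simp
  qed
  then have "normal_density 0 (sqrt t) x * u x \<le> 1 / \<delta> * u x" for x
    using u(1)[of x] assms(6)[of x] mult_right_mono[of "normal_density 0 (sqrt t) x" "1 / \<delta>" "u x"]
    by (cases "\<delta> \<le> \<bar>x\<bar>") auto
  from expectation_B_le(2)[OF assms(1-4) this] show ?thesis by simp
qed

section \<open>Brownian bridges pinned to 0 at times 0 and \<open>u\<close>, and sums in reversed
  time\<close>

definition bridge :: "real \<Rightarrow> real \<Rightarrow> 'a \<Rightarrow> real" where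
  "bridge s u \<omega> = B s \<omega> - s / u * B u \<omega>"

lemma bridge_measurable: "0 \<le> s \<Longrightarrow> 0 \<le> u \<Longrightarrow> bridge s u \<in> borel_measurable M"
  unfolding bridge_def using B_measurable[of s] B_measurable[of u] by simp

lemma bridge_0: "\<omega> \<in> space M \<Longrightarrow> bridge 0 u \<omega> = 0"
  by (simp add: bridge_def B_0)

text \<open>\<open>B u\<close> is the sum of the independent Gaussians \<open>B s\<close> and
  \<open>B u - B s\<close>. At \<open>s = 0\<close> the first of them has no density; there the
  bridge vanishes identically and is treated separately.\<close>

lemma bridge_indep:
  assumes "0 < s" "s < u"
  shows "indep_rv borel (bridge s u) borel (B u)"
proof -
  have "distributed M lborel (\<lambda>\<omega>. B u \<omega> - B s \<omega>) (normal_density 0 (sqrt (u - s)))"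
    using assms by (intro B_normal_increments) auto
  moreover have "indep_rv borel (B s) borel (\<lambda>\<omega>. B u \<omega> - B s \<omega>)"
    using assms by (intro indep_increment B_measurable_F) auto
  ultimately have "indep_rv borel (\<lambda>\<omega>. B s \<omega> - s / (s + (u - s)) * (B s \<omega> + (B u \<omega> - B s \<omega>)))
      borel (\<lambda>\<omega>. B s \<omega> + (B u \<omega> - B s \<omega>))"
    using assms by (intro gaussian_bridge_indep B_distributed) auto
  then show ?thesis by (simp add: bridge_def[abs_def])
qed

lemma B_second_moment:
  assumes "0 \<le> t" shows "integrable M (\<lambda>\<omega>. (B t \<omega>)\<^sup>2)" "(\<integral>\<omega>. (B t \<omega>)\<^sup>2 \<partial>M) = t" "(\<integral>\<omega>. B t \<omega> \<partial>M) = 0"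
proof -
  have *: "integrable M (\<lambda>\<omega>. (B t \<omega>)\<^sup>2) \<longleftrightarrow> integrable M (\<lambda>\<omega>. (B t \<omega> - B 0 \<omega>)\<^sup>2)"
    "(\<integral>\<omega>. (B t \<omega>)\<^sup>2 \<partial>M) = (\<integral>\<omega>. (B t \<omega> - B 0 \<omega>)\<^sup>2 \<partial>M)"
    "(\<integral>\<omega>. B t \<omega> \<partial>M) = (\<integral>\<omega>. B t \<omega> - B 0 \<omega> \<partial>M)"
    by (auto intro!: Bochner_Integration.integrable_cong Bochner_Integration.integral_cong simp: B_0)
  show "integrable M (\<lambda>\<omega>. (B t \<omega>)\<^sup>2)" "(\<integral>\<omega>. (B t \<omega>)\<^sup>2 \<partial>M) = t" "(\<integral>\<omega>. B t \<omega> \<partial>M) = 0"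
    unfolding * using increment_moments(1-3)[of 0 t] assms by (cases "t = 0"; simp)+
qed

text \<open>The exact variance is \<open>s * (u - s) / u\<close>. Bounding it by the length of the
  interval puts the bridge on the same footing as the increment \<open>B u - B s\<close>.\<close>

lemma bridge_moments:
  assumes "0 \<le> s" "s < u"
  shows "integrable M (\<lambda>\<omega>. (bridge s u \<omega>)\<^sup>2)" "(\<integral>\<omega>. (bridge s u \<omega>)\<^sup>2 \<partial>M) \<le> u - s" "(\<integral>\<omega>. bridge s u \<omega> \<partial>M) = 0"
proof -
  define r where "r = s / u"
  define Z where "Z \<omega> = B u \<omega> - B s \<omega>" for \<omega>
  note Z = increment_moments(1-3)[OF assms, folded Z_def]
  note X = B_second_moment[OF \<open>0 \<le> s\<close>]
  have ind: "indep_rv borel (B s) borel Z"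
    unfolding Z_def[abs_def] using assms by (intro indep_increment B_measurable_F) auto
  then have [measurable]: "B s \<in> borel_measurable M" "Z \<in> borel_measurable M" by (auto simp: indep_rv_def)
  have XZ: "integrable M (\<lambda>\<omega>. B s \<omega> * Z \<omega>)" "(\<integral>\<omega>. B s \<omega> * Z \<omega> \<partial>M) = 0"
    using indep_rv_integral_mult[OF ind integrable_of_square integrable_of_square] X Z by auto
  have eq: "bridge s u \<omega> = (1 - r) * B s \<omega> - r * Z \<omega>" for \<omega>
    by (simp add: bridge_def Z_def r_def algebra_simps)
  have sq: "(bridge s u \<omega>)\<^sup>2 = (1 - r)\<^sup>2 * (B s \<omega>)\<^sup>2 - 2 * (1 - r) * r * (B s \<omega> * Z \<omega>) + r\<^sup>2 * (Z \<omega>)\<^sup>2" for \<omega>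
    by (simp add: eq power2_eq_square algebra_simps)
  show "integrable M (\<lambda>\<omega>. (bridge s u \<omega>)\<^sup>2)" unfolding sq using X Z XZ by simp
  have "(\<integral>\<omega>. (bridge s u \<omega>)\<^sup>2 \<partial>M) = (1 - r)\<^sup>2 * s + r\<^sup>2 * (u - s)"
    unfolding sq using X Z XZ by simp
  also have "\<dots> = r * (u - s)" using assms by (simp add: r_def field_simps power2_eq_square)
  also have "\<dots> \<le> u - s" using assms by (intro mult_left_le_one_le) (auto simp: r_def)
  finally show "(\<integral>\<omega>. (bridge s u \<omega>)\<^sup>2 \<partial>M) \<le> u - s" .
  have "integrable M (B s)" "integrable M Z" using X Z by (auto intro: integrable_of_square)
  then show "(\<integral>\<omega>. bridge s u \<omega> \<partial>M) = 0" unfolding eq using X Z by simp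
qed

text \<open>Read backwards in time, the terms \<open>g (B\<^bsub>t (k+1)\<^esub>) (B\<^bsub>t k\<^esub> - t k / t (k+1) B\<^bsub>t (k+1)\<^esub>)\<close> are orthogonal
  differences: the bridge is independent of \<open>B\<^bsub>t (k+1)\<^esub>\<close> and of the later increments.\<close>

lemma bridges_maximal:
  fixes g :: "real \<Rightarrow> real"
  assumes t: "strict_mono t" "t 0 = 0" and g[measurable]: "g \<in> borel_measurable borel"
    and g_sq: "\<And>k. k < N \<Longrightarrow> integrable M (\<lambda>\<omega>. (g (B (t (Suc k)) \<omega>))\<^sup>2)" and "0 < l"
  shows "off_event M ((\<Sum>k<N. (\<integral>\<omega>. (g (B (t (Suc k)) \<omega>))\<^sup>2 \<partial>M) * (t (Suc k) - t k)) / l\<^sup>2)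
    (\<lambda>\<omega>. \<forall>j\<le>N. \<bar>\<Sum>k<j. g (B (t (Suc k)) \<omega>) * bridge (t k) (t (Suc k)) \<omega>\<bar> < 2 * l)"
proof -
  have tk: "0 \<le> t k" "t k < t (Suc k)" "0 < t (Suc k)" for k
    using t strict_mono_less_eq[OF t(1), of 0] strict_monoD[OF t(1)] by (auto dest: strict_monoD[of t 0])
  have B_meas[measurable]: "B (t k) \<in> borel_measurable M" for k using B_measurable tk by auto
  have W_meas[measurable]: "bridge (t k) (t (Suc k)) \<in> borel_measurable M" for k
    using tk by (intro bridge_measurable) (auto intro: less_imp_le)
  define e where "e k \<omega> = g (B (t (Suc k)) \<omega>) * bridge (t k) (t (Suc k)) \<omega>" for k \<omega>
  have e_meas[measurable]: "e k \<in> borel_measurable M" for k unfolding e_def by measurable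
  have e_0: "e 0 \<omega> = 0" if "\<omega> \<in> space M" for \<omega>
    using bridge_0[OF that] t by (simp add: e_def)
  have e_sq: "integrable M (\<lambda>\<omega>. (e k \<omega>)\<^sup>2)"
    "(\<integral>\<omega>. (e k \<omega>)\<^sup>2 \<partial>M) \<le> (\<integral>\<omega>. (g (B (t (Suc k)) \<omega>))\<^sup>2 \<partial>M) * (t (Suc k) - t k)" if "k < N" for k
  proof -
    note W = bridge_moments[OF tk(1,2)[of k]]
    have "integrable M (\<lambda>\<omega>. (e k \<omega>)\<^sup>2) \<and>
      (\<integral>\<omega>. (e k \<omega>)\<^sup>2 \<partial>M) = (\<integral>\<omega>. (g (B (t (Suc k)) \<omega>))\<^sup>2 \<partial>M) * (\<integral>\<omega>. (bridge (t k) (t (Suc k)) \<omega>)\<^sup>2 \<partial>M)"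
    \<comment> \<open>The first partition point is 0, where the bridge is identically zero;
      independence of bridge and end point is available for positive times only.\<close>
    proof (cases "k = 0")
      case True
      have z: "(e k \<omega>)\<^sup>2 = 0" "(bridge (t k) (t (Suc k)) \<omega>)\<^sup>2 = 0" if "\<omega> \<in> space M" for \<omega>
        using True t that by (simp_all add: e_0 bridge_0)
      have "integrable M (\<lambda>\<omega>. (e k \<omega>)\<^sup>2)"
        by (subst Bochner_Integration.integrable_cong[OF refl z(1)]) auto
      moreover have "(\<integral>\<omega>. (e k \<omega>)\<^sup>2 \<partial>M) = (\<integral>\<omega>. 0 \<partial>M)" "(\<integral>\<omega>. (bridge (t k) (t (Suc k)) \<omega>)\<^sup>2 \<partial>M) = (\<integral>\<omega>. 0 \<partial>M)"
        by (rule Bochner_Integration.integral_cong; simp add: z)+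
      ultimately show ?thesis by simp
    next
      case False
      then have "0 < t k" using strict_monoD[OF t(1), of 0 k] t by simp
      from indep_rv_compose[OF bridge_indep[OF this tk(2)], of "\<lambda>x. x" borel g borel]
      have "indep_rv borel (bridge (t k) (t (Suc k))) borel (\<lambda>\<omega>. g (B (t (Suc k)) \<omega>))" by simp
      from indep_rv_integral_square_mult(1,2)[OF this W(1) g_sq[OF that]] show ?thesis
        by (simp add: e_def mult.commute)
    qed
    then show "integrable M (\<lambda>\<omega>. (e k \<omega>)\<^sup>2)"
      "(\<integral>\<omega>. (e k \<omega>)\<^sup>2 \<partial>M) \<le> (\<integral>\<omega>. (g (B (t (Suc k)) \<omega>))\<^sup>2 \<partial>M) * (t (Suc k) - t k)"
      using W(2) by (auto intro!: mult_left_mono)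
  qed
  have "off_event M ((\<Sum>k<N. \<integral>\<omega>. (e (N - Suc k) \<omega>)\<^sup>2 \<partial>M) / l\<^sup>2) (\<lambda>\<omega>. \<forall>j\<le>N. \<bar>\<Sum>k<j. e (N - Suc k) \<omega>\<bar> < l)"
  proof (rule maximal_inequality)
    fix k and \<Phi> :: "(nat \<Rightarrow> real) \<Rightarrow> real"
    assume k: "k < N" and [measurable]: "\<Phi> \<in> borel_measurable (PiM {..<k} (\<lambda>_. borel :: real measure))"
      and \<Phi>_sq: "integrable M (\<lambda>\<omega>. (\<Phi> (\<lambda>i\<in>{..<k}. e (N - Suc i) \<omega>))\<^sup>2)"
    define m where "m = N - Suc k"
    have m: "m < N" "\<And>i. i < k \<Longrightarrow> Suc m \<le> N - Suc i" using k by (auto simp: m_def)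
    let ?V = "\<lambda>\<omega>. \<lambda>i\<in>{..<k}. e (N - Suc i) \<omega>"
    have V_meas[measurable]: "?V \<in> measurable M (PiM {..<k} (\<lambda>_. borel))" by (rule measurable_restrict) measurable
    show "(\<integral>\<omega>. \<Phi> (?V \<omega>) * e (N - Suc k) \<omega> \<partial>M) = 0"
    proof (cases "m = 0")
      case True
      then have "(\<integral>\<omega>. \<Phi> (?V \<omega>) * e (N - Suc k) \<omega> \<partial>M) = (\<integral>\<omega>. 0 \<partial>M)"
        using e_0 unfolding m_def[symmetric] by (intro Bochner_Integration.integral_cong) auto
      then show ?thesis by simp
    next
      case False
      then have tm: "0 < t m" using strict_monoD[OF t(1), of 0 m] t by simp
      let ?I = "{Suc m..<N}" and ?W = "bridge (t m) (t (Suc m))" and ?Y = "B (t (Suc m))"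
      let ?U = "\<lambda>\<omega>. \<lambda>i\<in>?I. B (t (Suc i)) \<omega> - B (t i) \<omega>"
      \<comment> \<open>All values \<open>B (t i)\<close> from step \<open>Suc m\<close> on are
        reconstructed from \<open>B (t (Suc m))\<close> and the increments after it, which are
        jointly independent of the bridge of step \<open>m\<close>.\<close>
      define path :: "nat \<Rightarrow> real \<times> (nat \<Rightarrow> real) \<Rightarrow> real" where "path i z = fst z + (\<Sum>j\<in>{Suc m..<i}. snd z j)" for i z
      have path_meas[measurable]: "path i \<in> borel_measurable (borel \<Otimes>\<^sub>M PiM ?I (\<lambda>_. borel))" if "i \<le> N" for i
      proof -
        have "(\<lambda>z. snd z j) \<in> borel_measurable ((borel :: real measure) \<Otimes>\<^sub>M PiM ?I (\<lambda>_. borel :: real measure))"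
          if "j \<in> {Suc m..<i}" for j
          using that \<open>i \<le> N\<close> by (intro measurable_compose[OF measurable_snd] measurable_component_singleton) auto
        then show ?thesis unfolding path_def
          by (intro borel_measurable_add borel_measurable_sum measurable_fst) auto
      qed
      have path: "path i (?Y \<omega>, ?U \<omega>) = B (t i) \<omega>" if "Suc m \<le> i" "i \<le> N" for i \<omega>
      proof -
        have "(\<Sum>j\<in>{Suc m..<i}. ?U \<omega> j) = (\<Sum>j\<in>{Suc m..<i}. B (t (Suc j)) \<omega> - B (t j) \<omega>)"
          using that by (intro sum.cong) auto
        also have "\<dots> = B (t i) \<omega> - ?Y \<omega>" using sum_Suc_diff'[OF that(1), of "\<lambda>j. B (t j) \<omega>"] .
        finally show ?thesis by (simp add: path_def)
      qed
      define E where "E i z = g (path (Suc i) z) * (path i z - t i / t (Suc i) * path (Suc i) z)" for i z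
      have E_meas: "E i \<in> borel_measurable (borel \<Otimes>\<^sub>M PiM ?I (\<lambda>_. borel))" if "Suc i \<le> N" for i
      proof -
        have [measurable]: "path i \<in> borel_measurable (borel \<Otimes>\<^sub>M PiM ?I (\<lambda>_. borel))"
          "path (Suc i) \<in> borel_measurable (borel \<Otimes>\<^sub>M PiM ?I (\<lambda>_. borel))" using that path_meas by auto
        show ?thesis unfolding E_def by measurable
      qed
      have E: "E i (?Y \<omega>, ?U \<omega>) = e i \<omega>" if "Suc m \<le> i" "Suc i \<le> N" for i \<omega>
        using that by (simp add: E_def e_def path bridge_def)
      \<comment> \<open>Everything that multiplies the bridge of step \<open>m\<close> in the
        orthogonality relation, as one function of \<open>B (t (Suc m))\<close> and the later
        increments.\<close>
      define \<Psi> where "\<Psi> z = \<Phi> (\<lambda>i\<in>{..<k}. E (N - Suc i) z) * g (fst z)" for z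
      have [measurable]: "(\<lambda>z. \<lambda>i\<in>{..<k}. E (N - Suc i) z) \<in> measurable (borel \<Otimes>\<^sub>M PiM ?I (\<lambda>_. borel)) (PiM {..<k} (\<lambda>_. borel))"
        using k by (intro measurable_restrict E_meas) auto
      have \<Psi>_meas: "\<Psi> \<in> borel_measurable (borel \<Otimes>\<^sub>M PiM ?I (\<lambda>_. borel))" unfolding \<Psi>_def by measurable
      have \<Psi>: "\<Psi> (?Y \<omega>, ?U \<omega>) = \<Phi> (?V \<omega>) * g (?Y \<omega>)" for \<omega>
      proof -
        have "(\<lambda>i\<in>{..<k}. E (N - Suc i) (?Y \<omega>, ?U \<omega>)) = ?V \<omega>"
          using k m(2) by (intro restrict_ext E) auto
        then show ?thesis by (simp add: \<Psi>_def)
      qed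
      have "(\<lambda>\<omega>. (?W \<omega>, ?Y \<omega>)) \<in> measurable (F (t (Suc m))) (borel \<Otimes>\<^sub>M borel)"
      proof -
        have [measurable]: "?Y \<in> borel_measurable (F (t (Suc m)))" "B (t m) \<in> borel_measurable (F (t (Suc m)))"
          using tk[of m] by (auto intro!: B_measurable_F)
        show ?thesis unfolding bridge_def by measurable
      qed
      then have "indep_rv (borel \<Otimes>\<^sub>M borel) (\<lambda>\<omega>. (?W \<omega>, ?Y \<omega>)) (PiM ?I (\<lambda>_. borel)) ?U"
        using t m(1) by (intro indep_future_increments) auto
      from indep_rv_assoc[OF bridge_indep[OF tm tk(2)] this]
      have "indep_rv borel ?W (borel \<Otimes>\<^sub>M PiM ?I (\<lambda>_. borel)) (\<lambda>\<omega>. (?Y \<omega>, ?U \<omega>))" .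
      from indep_rv_compose[OF this _ \<Psi>_meas, of "\<lambda>x. x" borel]
      have ind: "indep_rv borel ?W borel (\<lambda>\<omega>. \<Phi> (?V \<omega>) * g (?Y \<omega>))" by (simp add: \<Psi>)
      have i1: "integrable M (\<lambda>\<omega>. \<Phi> (?V \<omega>) * g (?Y \<omega>))"
        using \<Phi>_sq g_sq[OF m(1)] by (intro integrable_mult_of_squares) auto
      have i2: "integrable M ?W" using bridge_moments(1)[OF tk(1,2), of m] by (intro integrable_of_square[OF W_meas])
      have "(\<integral>\<omega>. \<Phi> (?V \<omega>) * e (N - Suc k) \<omega> \<partial>M) = (\<integral>\<omega>. ?W \<omega> * (\<Phi> (?V \<omega>) * g (?Y \<omega>)) \<partial>M)"
        unfolding m_def[symmetric] by (simp add: e_def ac_simps)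
      also have "\<dots> = 0"
        unfolding indep_rv_integral_mult(2)[OF ind i2 i1] using bridge_moments(3)[OF tk(1,2), of m] by simp
      finally show ?thesis .
    qed
  qed (use e_sq(1) \<open>0 < l\<close> in auto)
  moreover have "(\<Sum>k<N. \<integral>\<omega>. (e (N - Suc k) \<omega>)\<^sup>2 \<partial>M) = (\<Sum>k<N. \<integral>\<omega>. (e k \<omega>)\<^sup>2 \<partial>M)"
    by (rule sum.nat_diff_reindex)
  moreover have "(\<Sum>k<N. \<integral>\<omega>. (e k \<omega>)\<^sup>2 \<partial>M) \<le> (\<Sum>k<N. (\<integral>\<omega>. (g (B (t (Suc k)) \<omega>))\<^sup>2 \<partial>M) * (t (Suc k) - t k))"
    using e_sq(2) by (intro sum_mono) auto
  ultimately show ?thesis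
  proof (elim off_event_mono)
    fix \<omega> assume *: "\<forall>j\<le>N. \<bar>\<Sum>k<j. e (N - Suc k) \<omega>\<bar> < l"
    \<comment> \<open>A sum over the first steps is the full sum minus a tail, and both of these are
      partial sums in reversed time. This is the origin of the bound \<open>2 * l\<close>.\<close>
    have rev: "(\<Sum>k<i. e (N - Suc k) \<omega>) = (\<Sum>k<N. e k \<omega>) - (\<Sum>k<N - i. e k \<omega>)" if "i \<le> N" for i
      using that
    proof (induction i)
      case (Suc i)
      then have "N - i = Suc (N - Suc i)" by simp
      then show ?case using Suc by simp
    qed simp
    have "\<bar>\<Sum>k<j. e k \<omega>\<bar> < 2 * l" if "j \<le> N" for j
    proof -
      have "(\<Sum>k<j. e k \<omega>) = (\<Sum>k<N. e (N - Suc k) \<omega>) - (\<Sum>k<N - j. e (N - Suc k) \<omega>)"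
        using rev[of N] rev[of "N - j"] that by simp
      moreover have "\<bar>\<Sum>k<N. e (N - Suc k) \<omega>\<bar> < l" "\<bar>\<Sum>k<N - j. e (N - Suc k) \<omega>\<bar> < l" using * by auto
      ultimately show ?thesis by linarith
    qed
    then show "\<forall>j\<le>N. \<bar>\<Sum>k<j. g (B (t (Suc k)) \<omega>) * bridge (t k) (t (Suc k)) \<omega>\<bar> < 2 * l"
      by (simp add: e_def)
  qed (simp add: divide_right_mono)
qed

end

section \<open>Partitions\<close>

text \<open>Equivalently, the number of partition points strictly before \<open>s\<close>. For
  \<open>s > 0\<close> the last increment of a sum over \<open>D n k < s\<close> ends at the point
  with this index, so the sums overshoot \<open>s\<close> by less than one step.\<close>

definition part_index :: "(nat \<Rightarrow> nat \<Rightarrow> real) \<Rightarrow> nat \<Rightarrow> real \<Rightarrow> nat" where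
  "part_index D n s = (LEAST k. s \<le> D n k)"

context
  fixes D assumes D: "partition_sequence D"
begin

lemma partition_0: "D n 0 = 0" and partition_strict_mono: "strict_mono (D n)"
  using D by (auto simp: partition_sequence_def)

lemma partition_Suc: "D n k < D n (Suc k)"
  using partition_strict_mono by (simp add: strict_mono_def)

lemma partition_nonneg: "0 \<le> D n k"
  using strict_mono_less_eq[OF partition_strict_mono, of n 0 k] partition_0 by simp

lemma partition_mesh: "0 < \<delta> \<Longrightarrow> \<forall>\<^sub>F n in sequentially. \<forall>k. D n (Suc k) - D n k < \<delta>"
  using D by (auto simp: partition_sequence_def)

lemma part_index_le: "s \<le> D n (part_index D n s)"
proof -
  have "filterlim (D n) at_top sequentially" using D by (auto simp: partition_sequence_def)
  then have "\<forall>\<^sub>F k in sequentially. s \<le> D n k" by (simp add: filterlim_at_top)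
  then obtain k where "s \<le> D n k" by (auto dest: eventually_happens)
  then show ?thesis unfolding part_index_def by (rule LeastI)
qed

lemma less_part_index: "k < part_index D n s \<Longrightarrow> D n k < s"
  unfolding part_index_def using not_less_Least not_le by blast

lemma before_eq_lessThan: "{k. D n k < s} = {..<part_index D n s}"
proof (intro set_eqI iffI)
  fix k assume "k \<in> {k. D n k < s}"
  then have "D n k < D n (part_index D n s)" using part_index_le[of s n] by simp
  then show "k \<in> {..<part_index D n s}" using strict_mono_less[OF partition_strict_mono] by simp
qed (auto dest: less_part_index)

lemma part_index_mono: "s \<le> u \<Longrightarrow> part_index D n s \<le> part_index D n u"
  by (metis less_part_index linorder_not_less order.trans part_index_le)

lemma part_index_less:
  assumes "0 \<le> s" "\<And>k. D n (Suc k) - D n k < \<delta>" "0 < \<delta>"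
  shows "D n (part_index D n s) < s + \<delta>"
proof (cases "part_index D n s")
  case 0
  then show ?thesis using assms partition_0[of n] by simp
next
  case (Suc k)
  then have "D n k < s" by (intro less_part_index) simp
  then show ?thesis using assms(2)[of k] Suc by simp
qed

end

section \<open>Sums of partition steps weighted by negative powers of time\<close>

lemma sum_increments: "(\<Sum>k<N. t (Suc k) - t k) = t N - (t 0 :: real)"
  by (rule sum_lessThan_telescope)

text \<open>With \<open>x\<close>, \<open>y\<close> the roots of consecutive times,
  \<open>(y\<^sup>2 - x\<^sup>2) / y \<le> 2 * y - 2 * x\<close>, which telescopes. The sum is a
  lower Riemann sum for \<open>1 / sqrt u\<close>, thanks to the evaluation at right end
  points.\<close>

lemma sum_increments_over_sqrt:
  fixes t :: "nat \<Rightarrow> real"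
  assumes "strict_mono t" "t 0 = 0"
  shows "(\<Sum>k<N. (t (Suc k) - t k) / sqrt (t (Suc k))) \<le> 2 * sqrt (t N)"
proof -
  have "(t (Suc k) - t k) / sqrt (t (Suc k)) \<le> 2 * sqrt (t (Suc k)) - 2 * sqrt (t k)" for k
  proof -
    define x y where "x = sqrt (t k)" and "y = sqrt (t (Suc k))"
    have "0 \<le> t k" using strict_mono_less_eq[OF assms(1), of 0 k] assms(2) by simp
    moreover have "t k < t (Suc k)" using assms(1) by (simp add: strict_mono_def)
    ultimately have xy: "0 \<le> x" "x < y" "t k = x\<^sup>2" "t (Suc k) = y\<^sup>2" by (auto simp: x_def y_def)
    have "y\<^sup>2 - x\<^sup>2 = (y - x) * (y + x)" by (simp add: power2_eq_square algebra_simps)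
    also have "\<dots> \<le> (y - x) * (2 * y)" using xy by (intro mult_left_mono) auto
    finally have "(y\<^sup>2 - x\<^sup>2) / y \<le> 2 * y - 2 * x" using xy by (simp add: field_simps)
    then show ?thesis unfolding x_def[symmetric] y_def[symmetric] unfolding xy(3,4) .
  qed
  then have "(\<Sum>k<N. (t (Suc k) - t k) / sqrt (t (Suc k))) \<le> (\<Sum>k<N. 2 * sqrt (t (Suc k)) - 2 * sqrt (t k))"
    by (rule sum_mono)
  also have "\<dots> = 2 * sqrt (t N)" using assms(2) by (simp add: sum_lessThan_telescope[of "\<lambda>k. 2 * sqrt (t k)"])
  finally show ?thesis .
qed

text \<open>The same comparison for \<open>u powr (- 3/4)\<close>, with fourth roots and a
  factorised difference of fourth powers. The exponent is that of the drift of the backward sums: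
  \<open>1 / u\<close> from the bridge, \<open>sqrt u\<close> from the size of \<open>B u\<close>,
  and \<open>u powr (- 1/4)\<close> from the root of the density bound.\<close>

lemma sum_increments_over_three_quarters:
  fixes t :: "nat \<Rightarrow> real"
  assumes "strict_mono t" "t 0 = 0"
  shows "(\<Sum>k<N. (t (Suc k) - t k) / (sqrt (sqrt (t (Suc k)))) ^ 3) \<le> 4 * sqrt (sqrt (t N))"
proof -
  have "(t (Suc k) - t k) / (sqrt (sqrt (t (Suc k)))) ^ 3 \<le> 4 * sqrt (sqrt (t (Suc k))) - 4 * sqrt (sqrt (t k))" for k
  proof -
    define x y where "x = sqrt (sqrt (t k))" and "y = sqrt (sqrt (t (Suc k)))"
    have p: "(sqrt (sqrt u))^4 = u" if "0 \<le> u" for u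
    proof -
      have "(sqrt (sqrt u))^4 = ((sqrt (sqrt u))\<^sup>2)\<^sup>2" by (simp flip: power_mult)
      then show ?thesis using that by simp
    qed
    have "0 \<le> t k" using strict_mono_less_eq[OF assms(1), of 0 k] assms(2) by simp
    moreover have "t k < t (Suc k)" using assms(1) by (simp add: strict_mono_def)
    ultimately have xy: "0 \<le> x" "x < y" "t k = x^4" "t (Suc k) = y^4" by (auto simp: x_def y_def p)
    have "y^4 - x^4 = (y - x) * (y^3 + y^2 * x + y * x^2 + x^3)"
      by (simp add: power2_eq_square power3_eq_cube power4_eq_xxxx algebra_simps)
    also have "\<dots> \<le> (y - x) * (4 * y^3)"
    proof (rule mult_left_mono)
      have "y^2 * x \<le> y^2 * y" "y * x^2 \<le> y * y^2" "x^3 \<le> y^3"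
        using xy by (auto intro!: mult_left_mono power_mono)
      then show "y^3 + y^2 * x + y * x^2 + x^3 \<le> 4 * y^3" by (simp add: power2_eq_square power3_eq_cube)
    qed (use xy in simp)
    finally have "(y^4 - x^4) / y^3 \<le> 4 * y - 4 * x" using xy by (simp add: field_simps)
    then show ?thesis unfolding x_def[symmetric] y_def[symmetric] unfolding xy(3,4) .
  qed
  then have "(\<Sum>k<N. (t (Suc k) - t k) / (sqrt (sqrt (t (Suc k)))) ^ 3) \<le>
      (\<Sum>k<N. 4 * sqrt (sqrt (t (Suc k))) - 4 * sqrt (sqrt (t k)))"
    by (rule sum_mono)
  also have "\<dots> = 4 * sqrt (sqrt (t N))" using assms(2)
    by (simp add: sum_lessThan_telescope[of "\<lambda>k. 4 * sqrt (sqrt (t k))"])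
  finally show ?thesis .
qed

text \<open>A bounded ratio of consecutive points lets the left end points replace the right ones.\<close>

lemma sum_increments_over_sqrt_left:
  fixes t :: "nat \<Rightarrow> real"
  assumes "strict_mono t" "t 0 = 0" "0 \<le> K" and K: "\<And>k. 1 \<le> k \<Longrightarrow> t (Suc k) \<le> K * t k"
  shows "(\<Sum>k\<in>{1..<N}. (t (Suc k) - t k) / sqrt (t k)) \<le> 2 * sqrt K * sqrt (t N)"
proof -
  have pos: "0 < t k" if "1 \<le> k" for k using strict_monoD[OF assms(1), of 0 k] assms(2) that by simp
  have step: "t k < t (Suc k)" for k using assms(1) by (simp add: strict_mono_def)
  have "(\<Sum>k\<in>{1..<N}. (t (Suc k) - t k) / sqrt (t k)) \<le>
      (\<Sum>k\<in>{1..<N}. sqrt K * ((t (Suc k) - t k) / sqrt (t (Suc k))))"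
  proof (rule sum_mono)
    fix k assume "k \<in> {1..<N}"
    then have k: "1 \<le> k" by simp
    have "sqrt (t (Suc k)) \<le> sqrt K * sqrt (t k)" using K[OF k] by (simp flip: real_sqrt_mult)
    then have "1 / sqrt (t k) \<le> sqrt K / sqrt (t (Suc k))"
      using pos[OF k] pos[of "Suc k"] by (simp add: field_simps)
    then have "(t (Suc k) - t k) * (1 / sqrt (t k)) \<le> (t (Suc k) - t k) * (sqrt K / sqrt (t (Suc k)))"
      using step[of k] by (intro mult_left_mono) auto
    then show "(t (Suc k) - t k) / sqrt (t k) \<le> sqrt K * ((t (Suc k) - t k) / sqrt (t (Suc k)))"
      by (simp add: mult.commute)
  qed
  also have "\<dots> \<le> (\<Sum>k<N. sqrt K * ((t (Suc k) - t k) / sqrt (t (Suc k))))"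
  proof (rule sum_mono2)
    fix k
    have "0 \<le> (t (Suc k) - t k) / sqrt (t (Suc k))"
      using pos[of "Suc k"] step[of k] by (intro divide_nonneg_nonneg) auto
    then show "0 \<le> sqrt K * ((t (Suc k) - t k) / sqrt (t (Suc k)))"
      using \<open>0 \<le> K\<close> by (intro mult_nonneg_nonneg) auto
  qed auto
  also have "\<dots> = sqrt K * (\<Sum>k<N. (t (Suc k) - t k) / sqrt (t (Suc k)))" by (simp add: sum_distrib_left)
  also have "\<dots> \<le> sqrt K * (2 * sqrt (t N))"
    using assms by (intro mult_left_mono sum_increments_over_sqrt) auto
  finally show ?thesis by (simp add: ac_simps)
qed

lemma Riemann_sum_error:
  fixes \<phi> :: "real \<Rightarrow> real"
  assumes t: "strict_mono t" "t 0 = 0" and \<phi>: "continuous_on {0..} \<phi>"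
    and \<kappa>: "\<And>k s. k < j \<Longrightarrow> t k \<le> s \<Longrightarrow> s \<le> t (Suc k) \<Longrightarrow> \<bar>\<phi> s - \<phi> (t k)\<bar> \<le> \<kappa>"
  shows "\<bar>(\<Sum>k<j. \<phi> (t k) * (t (Suc k) - t k)) - integral {0..t j} \<phi>\<bar> \<le> \<kappa> * t j"
  using \<kappa>
proof (induction j)
  case (Suc j)
  have nn: "0 \<le> t j" using strict_mono_less_eq[OF t(1), of 0 j] t(2) by simp
  have lt: "t j < t (Suc j)" using t(1) by (simp add: strict_mono_def)
  have c: "continuous_on {a..b} \<phi>" if "0 \<le> a" for a b using \<phi> by (rule continuous_on_subset) (use that in auto)
  have "integral {0..t (Suc j)} \<phi> = integral {0..t j} \<phi> + integral {t j..t (Suc j)} \<phi>"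
    using nn lt by (intro Henstock_Kurzweil_Integration.integral_combine[symmetric] integrable_continuous_real c) auto
  moreover have "\<phi> (t j) * (t (Suc j) - t j) - integral {t j..t (Suc j)} \<phi> = - integral {t j..t (Suc j)} (\<lambda>s. \<phi> s - \<phi> (t j))"
    using lt nn by (subst Henstock_Kurzweil_Integration.integral_diff; auto intro!: integrable_continuous_real c)
  moreover have "\<bar>integral {t j..t (Suc j)} (\<lambda>s. \<phi> s - \<phi> (t j))\<bar> \<le> \<kappa> * (t (Suc j) - t j)"
    using lt nn Suc.prems[of j] by (intro integral_bound[where 'a=real, unfolded real_norm_def] continuous_intros c) auto
  moreover have "\<bar>(\<Sum>k<j. \<phi> (t k) * (t (Suc k) - t k)) - integral {0..t j} \<phi>\<bar> \<le> \<kappa> * t j"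
    using Suc by auto
  ultimately show ?case by (simp add: algebra_simps)
qed (simp add: t)

section \<open>Continuity of paths\<close>

text \<open>Continuity from above turns a bound whose constant depends on the path into one with a
  uniform constant off a small event: \<open>C n\<close> will be the event that the
  \<open>n\<close>-th constant does not suffice.\<close>

lemma (in prob_space) decreasing_to_empty:
  assumes "\<And>n. C n \<in> sets M" "decseq C" "(\<Inter>n. C n) = {}" "0 < \<eta>"
  obtains n :: nat where "measure M (C n) \<le> \<eta>"
proof -
  have "(\<lambda>n. measure M (C n)) \<longlonglongrightarrow> measure M (\<Inter>n. C n)"
    using assms by (intro finite_Lim_measure_decseq) auto
  then have "\<forall>\<^sub>F n in sequentially. measure M (C n) < \<eta>"
    using assms by (intro order_tendstoD) auto
  then obtain n where "measure M (C n) < \<eta>" by (auto dest: eventually_happens)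
  then show ?thesis by (intro that[of n]) simp
qed

context brownian_motion
begin

lemma path_continuous: "\<omega> \<in> space M \<Longrightarrow> continuous_on {0..} (\<lambda>t. B t \<omega>)"
  using B_continuous by (auto simp: continuous_process_def)

text \<open>Events over uncountably many times are replaced by events over rational times, which are
  measurable. The rational time lies after \<open>s\<close> and so stays nonnegative; the price is
  the horizon \<open>T + 1\<close> in the two estimates below.\<close>

lemma rational_time_after:
  assumes "\<omega> \<in> space M" "0 \<le> s" "0 < \<delta>" "0 < \<epsilon>"
  obtains q where "q \<in> \<rat>" "s < q" "q < s + \<delta>" "\<bar>B q \<omega> - B s \<omega>\<bar> < \<epsilon>"
proof -
  from path_continuous[OF assms(1)] assms
  obtain d where d: "0 < d" "\<And>u. 0 \<le> u \<Longrightarrow> dist u s < d \<Longrightarrow> dist (B u \<omega>) (B s \<omega>) < \<epsilon>"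
    unfolding continuous_on_iff by (metis atLeast_iff)
  obtain q where q: "q \<in> \<rat>" "s < q" "q < s + min \<delta> d"
    using Rats_dense_in_real[of s "s + min \<delta> d"] assms d by auto
  then show ?thesis using d(2)[of q] assms by (intro that[of q]) (auto simp: dist_real_def)
qed

lemma path_bounded:
  assumes "0 \<le> T" "0 < \<eta>"
  obtains R where "0 < R" "off_event M \<eta> (\<lambda>\<omega>. \<forall>s\<in>{0..T}. \<bar>B s \<omega>\<bar> \<le> R)"
proof -
  define Q where "Q = \<rat> \<inter> {0..T + 1}"
  have "countable Q" unfolding Q_def using countable_rat by (intro countable_Int1) auto
  define C where "C n = {\<omega> \<in> space M. \<exists>q\<in>Q. real n < \<bar>B q \<omega>\<bar>}" for n :: nat
  have meas: "C n \<in> sets M" for n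
  proof -
    have "{\<omega> \<in> space M. real n < \<bar>B q \<omega>\<bar>} \<in> sets M" if "q \<in> Q" for q
    proof -
      have [measurable]: "B q \<in> borel_measurable M" using that by (intro B_measurable) (auto simp: Q_def)
      show ?thesis by measurable
    qed
    then have "(\<Union>q\<in>Q. {\<omega> \<in> space M. real n < \<bar>B q \<omega>\<bar>}) \<in> sets M"
      using \<open>countable Q\<close> by (intro sets.countable_UN') auto
    moreover have "C n = (\<Union>q\<in>Q. {\<omega> \<in> space M. real n < \<bar>B q \<omega>\<bar>})" by (auto simp: C_def)
    ultimately show ?thesis by simp
  qed
  have "decseq C" by (intro antimonoI) (force simp: C_def)
  moreover have "(\<Inter>n. C n) = {}"
  proof -
    have "\<exists>n. \<omega> \<notin> C n" if "\<omega> \<in> space M" for \<omega>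
    proof -
      have "compact ((\<lambda>s. B s \<omega>) ` {0..T + 1})"
        by (intro compact_continuous_image continuous_on_subset[OF path_continuous[OF that]]) auto
      then obtain b where b: "\<forall>s\<in>{0..T+1}. \<bar>B s \<omega>\<bar> \<le> b"
        using compact_imp_bounded[of "(\<lambda>s. B s \<omega>) ` {0..T + 1}"] unfolding bounded_iff by auto
      obtain n where "b \<le> real n" using real_arch_simple by blast
      then have "\<omega> \<notin> C n" using b by (force simp: C_def Q_def)
      then show ?thesis by blast
    qed
    then show ?thesis by (force simp: C_def)
  qed
  ultimately obtain n where n: "measure M (C n) \<le> \<eta>"
    by (rule decreasing_to_empty[OF meas _ _ \<open>0 < \<eta>\<close>])
  show ?thesis
  proof (rule that[of "real n + 1"])
    show "off_event M \<eta> (\<lambda>\<omega>. \<forall>s\<in>{0..T}. \<bar>B s \<omega>\<bar> \<le> real n + 1)"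
    proof (rule off_eventI[OF meas n], rule ballI)
      fix \<omega> s assume \<omega>: "\<omega> \<in> space M" "\<omega> \<notin> C n" and s: "s \<in> {0..T}"
      obtain q where "q \<in> \<rat>" "s < q" "q < s + 1" "\<bar>B q \<omega> - B s \<omega>\<bar> < 1"
        using rational_time_after[OF \<omega>(1), of s 1 1] s by auto
      moreover have "\<bar>B q \<omega>\<bar> \<le> real n" using \<omega> s calculation by (auto simp: C_def Q_def not_less)
      ultimately show "\<bar>B s \<omega>\<bar> \<le> real n + 1" by linarith
    qed
  qed simp
qed

lemma path_modulus:
  assumes "0 \<le> T" "0 < \<eta>" "0 < \<epsilon>"
  obtains \<delta> where "0 < \<delta>"
    "off_event M \<eta> (\<lambda>\<omega>. \<forall>s\<in>{0..T}. \<forall>u\<in>{0..T}. \<bar>s - u\<bar> < \<delta> \<longrightarrow> \<bar>B s \<omega> - B u \<omega>\<bar> \<le> \<epsilon>)"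
proof -
  define Q where "Q n = {z \<in> (\<rat> \<inter> {0..T + 1}) \<times> (\<rat> \<inter> {0..T + 1}). \<bar>fst z - snd z\<bar> < 1 / real (Suc n)}" for n
  have "countable ((\<rat> \<inter> {0..T + 1}) \<times> (\<rat> \<inter> {0..T + 1}))"
    using countable_rat by (intro countable_SIGMA countable_Int1) auto
  then have "countable (Q n)" for n unfolding Q_def by (rule countable_subset[rotated]) auto
  define C where "C n = {\<omega> \<in> space M. \<exists>z\<in>Q n. \<epsilon>/2 < \<bar>B (fst z) \<omega> - B (snd z) \<omega>\<bar>}" for n :: nat
  have meas: "C n \<in> sets M" for n
  proof -
    have "{\<omega> \<in> space M. \<epsilon>/2 < \<bar>B (fst z) \<omega> - B (snd z) \<omega>\<bar>} \<in> sets M" if "z \<in> Q n" for z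
    proof -
      have [measurable]: "B (fst z) \<in> borel_measurable M" "B (snd z) \<in> borel_measurable M"
        using that by (auto intro!: B_measurable simp: Q_def)
      show ?thesis by measurable
    qed
    then have "(\<Union>z\<in>Q n. {\<omega> \<in> space M. \<epsilon>/2 < \<bar>B (fst z) \<omega> - B (snd z) \<omega>\<bar>}) \<in> sets M"
      using \<open>countable (Q n)\<close> by (intro sets.countable_UN') auto
    moreover have "C n = (\<Union>z\<in>Q n. {\<omega> \<in> space M. \<epsilon>/2 < \<bar>B (fst z) \<omega> - B (snd z) \<omega>\<bar>})" by (auto simp: C_def)
    ultimately show ?thesis by simp
  qed
  have "decseq C"
  proof (rule decseq_SucI)
    fix n
    have "1 / real (Suc (Suc n)) \<le> 1 / real (Suc n)" by (simp add: frac_le)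
    then have "Q (Suc n) \<subseteq> Q n" unfolding Q_def by (auto simp del: of_nat_Suc)
    then show "C (Suc n) \<subseteq> C n" unfolding C_def by blast
  qed
  moreover have "(\<Inter>n. C n) = {}"
  proof -
    have "\<exists>n. \<omega> \<notin> C n" if "\<omega> \<in> space M" for \<omega>
    proof -
      have "uniformly_continuous_on {0..T + 1} (\<lambda>s. B s \<omega>)"
        by (intro compact_uniformly_continuous continuous_on_subset[OF path_continuous[OF that]]) auto
      then obtain d where d: "0 < d"
        "\<And>s u. s \<in> {0..T + 1} \<Longrightarrow> u \<in> {0..T + 1} \<Longrightarrow> dist u s < d \<Longrightarrow> dist (B u \<omega>) (B s \<omega>) < \<epsilon>/2"
        unfolding uniformly_continuous_on_def using \<open>0 < \<epsilon>\<close> by (meson half_gt_zero)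
      obtain n where n: "1 / real (Suc n) < d" using nat_approx_posE[OF d(1)] by blast
      have "\<omega> \<notin> C n"
      proof
        assume "\<omega> \<in> C n"
        then obtain z where z: "z \<in> Q n" "\<epsilon>/2 < \<bar>B (fst z) \<omega> - B (snd z) \<omega>\<bar>" by (auto simp: C_def)
        then have "fst z \<in> {0..T+1}" "snd z \<in> {0..T+1}" "dist (fst z) (snd z) < d"
          using n by (auto simp: Q_def dist_real_def simp del: of_nat_Suc)
        with d(2)[of "snd z" "fst z"] z(2) show False by (simp add: dist_real_def)
      qed
      then show ?thesis by blast
    qed
    then show ?thesis by (force simp: C_def)
  qed
  ultimately obtain n where n: "measure M (C n) \<le> \<eta>"
    by (rule decreasing_to_empty[OF meas _ _ \<open>0 < \<eta>\<close>])
  show ?thesis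
  proof (rule that[of "1 / real (Suc n)"])
    show "off_event M \<eta> (\<lambda>\<omega>. \<forall>s\<in>{0..T}. \<forall>u\<in>{0..T}. \<bar>s - u\<bar> < 1 / real (Suc n) \<longrightarrow> \<bar>B s \<omega> - B u \<omega>\<bar> \<le> \<epsilon>)"
    proof (rule off_eventI[OF meas n], intro ballI impI)
      fix \<omega> s u assume \<omega>: "\<omega> \<in> space M" "\<omega> \<notin> C n" and s: "s \<in> {0..T}" "u \<in> {0..T}"
        and su: "\<bar>s - u\<bar> < 1 / real (Suc n)"
      \<comment> \<open>Room for moving both times to rationals: within 1 they stay below
        \<open>T + 1\<close>, and within the slack they stay closer than \<open>1 / Suc n\<close>.
        The error is \<epsilon>/2 between the rationals and \<epsilon>/4 for each move.\<close>
      define \<tau> where "\<tau> = min 1 (1 / real (Suc n) - \<bar>s - u\<bar>)"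
      have \<tau>: "0 < \<tau>" "\<tau> \<le> 1" "\<tau> + \<bar>s - u\<bar> \<le> 1 / real (Suc n)" using su by (auto simp: \<tau>_def)
      obtain q where q: "q \<in> \<rat>" "s < q" "q < s + \<tau>" "\<bar>B q \<omega> - B s \<omega>\<bar> < \<epsilon>/4"
        using rational_time_after[OF \<omega>(1), of s \<tau> "\<epsilon>/4"] s \<tau> \<open>0 < \<epsilon>\<close> by auto
      obtain r where r: "r \<in> \<rat>" "u < r" "r < u + \<tau>" "\<bar>B r \<omega> - B u \<omega>\<bar> < \<epsilon>/4"
        using rational_time_after[OF \<omega>(1), of u \<tau> "\<epsilon>/4"] s \<tau> \<open>0 < \<epsilon>\<close> by auto
      have "\<bar>q - r\<bar> < \<tau> + \<bar>s - u\<bar>" using q r by linarith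
      then have "\<bar>q - r\<bar> < 1 / real (Suc n)" using \<tau> by linarith
      then have "(q, r) \<in> Q n" using q r s \<tau> by (auto simp: Q_def simp del: of_nat_Suc)
      then have "\<bar>B q \<omega> - B r \<omega>\<bar> \<le> \<epsilon>/2" using \<omega> by (force simp: C_def not_less)
      then show "\<bar>B s \<omega> - B u \<omega>\<bar> \<le> \<epsilon>" using q r by linarith
    qed
  qed simp
qed

end

section \<open>Forward and backward sums\<close>

context centered_brownian_motion
begin

lemma forward_maximal:
  fixes g :: "real \<Rightarrow> real"
  assumes t: "strict_mono t" "t 0 = 0" and g[measurable]: "g \<in> borel_measurable borel"
    and g_sq: "\<And>k. k < N \<Longrightarrow> integrable M (\<lambda>\<omega>. (g (B (t k) \<omega>))\<^sup>2)" and "0 < l"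
  shows "off_event M ((\<Sum>k<N. (\<integral>\<omega>. (g (B (t k) \<omega>))\<^sup>2 \<partial>M) * (t (Suc k) - t k)) / l\<^sup>2)
    (\<lambda>\<omega>. \<forall>j\<le>N. \<bar>\<Sum>k<j. g (B (t k) \<omega>) * (B (t (Suc k)) \<omega> - B (t k) \<omega>)\<bar> < l)"
proof -
  have tk: "0 \<le> t k" "t k < t (Suc k)" for k
    using t strict_mono_less_eq[OF t(1), of 0 k] by (auto simp: strict_mono_def)
  note Z = increment_moments[OF tk]
  have c: "(\<lambda>\<omega>. g (B (t k) \<omega>)) \<in> borel_measurable (F (t k))" for k
    using B_measurable_F[OF tk(1), of k "t k"] by measurable
  have "off_event M ((\<Sum>k<N. (\<integral>\<omega>. (g (B (t k) \<omega>))\<^sup>2 \<partial>M) * (\<integral>\<omega>. (B (t (Suc k)) \<omega> - B (t k) \<omega>)\<^sup>2 \<partial>M)) / l\<^sup>2)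
    (\<lambda>\<omega>. \<forall>j\<le>N. \<bar>\<Sum>k<j. g (B (t k) \<omega>) * (B (t (Suc k)) \<omega> - B (t k) \<omega>)\<bar> < l)"
    using increments_maximal[of t N "\<lambda>k \<omega>. g (B (t k) \<omega>)" "\<lambda>_ x. x" l] t c g_sq Z \<open>0 < l\<close> by simp
  then show ?thesis using Z by simp
qed

text \<open>With \<open>u = t (Suc k)\<close>, the increment over a step is
  \<open>(u - t k) / u * B u\<close> minus the bridge. The bridges obey the maximal inequality in
  reversed time and contribute \<open>2 * l\<close>; the drift is summed in absolute value,
  estimated by Markov's inequality, and contributes \<open>l\<close>.\<close>

lemma backward_maximal:
  fixes g :: "real \<Rightarrow> real"
  assumes t: "strict_mono t" "t 0 = 0" and g[measurable]: "g \<in> borel_measurable borel"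
    and g_sq: "integrable lborel (\<lambda>x. (g x)\<^sup>2)" "(\<integral>x. (g x)\<^sup>2 \<partial>lborel) \<le> \<epsilon>\<^sup>2" and "0 < \<epsilon>" "0 < l"
  shows "off_event M (\<epsilon>\<^sup>2 * (2 * sqrt (t N)) / l\<^sup>2 + \<epsilon> * (4 * sqrt (sqrt (t N))) / l)
    (\<lambda>\<omega>. \<forall>j\<le>N. \<bar>\<Sum>k<j. g (B (t (Suc k)) \<omega>) * (B (t (Suc k)) \<omega> - B (t k) \<omega>)\<bar> < 3 * l)"
proof -
  have tk: "0 \<le> t k" "t k < t (Suc k)" "0 < t (Suc k)" for k
    using t strict_mono_less_eq[OF t(1), of 0] strict_monoD[OF t(1)] by (auto dest: strict_monoD[of t 0])
  have B_meas[measurable]: "B (t k) \<in> borel_measurable M" for k using B_measurable tk by auto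
  have E: "integrable M (\<lambda>\<omega>. (g (B (t (Suc k)) \<omega>))\<^sup>2)"
    "(\<integral>\<omega>. (g (B (t (Suc k)) \<omega>))\<^sup>2 \<partial>M) \<le> \<epsilon>\<^sup>2 / sqrt (t (Suc k))" for k
  proof -
    note * = expectation_B_le_sqrt[OF tk(3), of "\<lambda>x. (g x)\<^sup>2" k]
    show "integrable M (\<lambda>\<omega>. (g (B (t (Suc k)) \<omega>))\<^sup>2)" using * g_sq by simp
    have "(\<integral>\<omega>. (g (B (t (Suc k)) \<omega>))\<^sup>2 \<partial>M) \<le> (\<integral>x. (g x)\<^sup>2 \<partial>lborel) / sqrt (t (Suc k))" using * g_sq by simp
    also have "\<dots> \<le> \<epsilon>\<^sup>2 / sqrt (t (Suc k))" using g_sq tk(3)[of k] by (intro divide_right_mono) auto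
    finally show "(\<integral>\<omega>. (g (B (t (Suc k)) \<omega>))\<^sup>2 \<partial>M) \<le> \<epsilon>\<^sup>2 / sqrt (t (Suc k))" .
  qed
  have mart: "off_event M (\<epsilon>\<^sup>2 * (2 * sqrt (t N)) / l\<^sup>2)
    (\<lambda>\<omega>. \<forall>j\<le>N. \<bar>\<Sum>k<j. g (B (t (Suc k)) \<omega>) * bridge (t k) (t (Suc k)) \<omega>\<bar> < 2 * l)"
  proof (rule off_event_weaken[OF bridges_maximal[OF t g E(1) \<open>0 < l\<close>]])
    have "(\<Sum>k<N. (\<integral>\<omega>. (g (B (t (Suc k)) \<omega>))\<^sup>2 \<partial>M) * (t (Suc k) - t k)) \<le>
        (\<Sum>k<N. \<epsilon>\<^sup>2 / sqrt (t (Suc k)) * (t (Suc k) - t k))"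
      using E(2) tk(2) by (intro sum_mono mult_right_mono) (auto intro: less_imp_le)
    also have "\<dots> = \<epsilon>\<^sup>2 * (\<Sum>k<N. (t (Suc k) - t k) / sqrt (t (Suc k)))" by (simp add: sum_distrib_left)
    also have "\<dots> \<le> \<epsilon>\<^sup>2 * (2 * sqrt (t N))" using t by (intro mult_left_mono sum_increments_over_sqrt) auto
    finally show "(\<Sum>k<N. (\<integral>\<omega>. (g (B (t (Suc k)) \<omega>))\<^sup>2 \<partial>M) * (t (Suc k) - t k)) / l\<^sup>2 \<le> \<epsilon>\<^sup>2 * (2 * sqrt (t N)) / l\<^sup>2"
      by (rule divide_right_mono) simp
  qed
  define f where "f k \<omega> = \<bar>g (B (t (Suc k)) \<omega>) * B (t (Suc k)) \<omega>\<bar> * ((t (Suc k) - t k) / t (Suc k))" for k \<omega>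
  have f_nonneg: "0 \<le> f k \<omega>" for k \<omega>
    using tk(2,3)[of k] by (auto simp: f_def intro!: mult_nonneg_nonneg divide_nonneg_nonneg)
  have f: "integrable M (f k)" "(\<integral>\<omega>. f k \<omega> \<partial>M) \<le> \<epsilon> * ((t (Suc k) - t k) / (sqrt (sqrt (t (Suc k)))) ^ 3)" for k
  proof -
    let ?u = "t (Suc k)"
    define r where "r = sqrt (sqrt ?u)"
    have r: "0 < r" "sqrt ?u = r\<^sup>2" using tk(3)[of k] by (simp_all add: r_def)
    have r4: "?u = r^4"
    proof -
      have "?u = (sqrt ?u)\<^sup>2" using tk(3)[of k] by simp
      then show ?thesis unfolding r(2) by (simp flip: power_mult)
    qed
    let ?G = "\<lambda>\<omega>. (g (B ?u \<omega>))\<^sup>2" and ?S = "\<lambda>\<omega>. (B ?u \<omega>)\<^sup>2"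
    have S: "integrable M ?S" "(\<integral>\<omega>. ?S \<omega> \<partial>M) = r^4" using B_second_moment[of ?u] tk(3)[of k] r4 by auto
    have iGB: "integrable M (\<lambda>\<omega>. \<bar>g (B ?u \<omega>) * B ?u \<omega>\<bar>)"
      using integrable_mult_of_squares[of "\<lambda>\<omega>. g (B ?u \<omega>)" M "B ?u"] E(1)[of k] S(1) by simp
    then show "integrable M (f k)" unfolding f_def by simp
    \<comment> \<open>The weight \<open>r^3 / \<epsilon>\<close>, with \<open>r\<close> the fourth
      root of the time, balances the two second moments: with
      \<open>\<epsilon>\<^sup>2 / r\<^sup>2\<close> for \<open>g\<close> and \<open>r^4\<close> for
      \<open>B\<close>, both terms become \<open>\<epsilon> * r\<close>.\<close>
    have amgm: "\<bar>x * y\<bar> \<le> (r^3 / \<epsilon> * x\<^sup>2 + \<epsilon> / r^3 * y\<^sup>2) / 2" for x y :: real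
    proof -
      define c where "c = sqrt (r^3 / \<epsilon>)"
      have c: "0 < c" "c\<^sup>2 = r^3 / \<epsilon>" using r(1) \<open>0 < \<epsilon>\<close> by (auto simp: c_def)
      have "2 * (c * \<bar>x\<bar>) * (\<bar>y\<bar> / c) \<le> (c * \<bar>x\<bar>)\<^sup>2 + (\<bar>y\<bar> / c)\<^sup>2" by (rule sum_squares_bound)
      then have "2 * \<bar>x * y\<bar> \<le> c\<^sup>2 * x\<^sup>2 + y\<^sup>2 / c\<^sup>2"
        using c(1) by (simp add: power_mult_distrib power_divide abs_mult)
      then show ?thesis unfolding c(2) by (simp add: ac_simps)
    qed
    have "(\<integral>\<omega>. \<bar>g (B ?u \<omega>) * B ?u \<omega>\<bar> \<partial>M) \<le> (\<integral>\<omega>. (r^3 / \<epsilon> * ?G \<omega> + \<epsilon> / r^3 * ?S \<omega>) / 2 \<partial>M)"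
      using iGB E(1)[of k] S(1) amgm by (intro integral_mono) auto
    also have "\<dots> = (r^3 / \<epsilon> * (\<integral>\<omega>. ?G \<omega> \<partial>M) + \<epsilon> / r^3 * r^4) / 2"
      using E(1)[of k] S by simp
    also have "\<dots> \<le> (r^3 / \<epsilon> * (\<epsilon>\<^sup>2 / r\<^sup>2) + \<epsilon> / r^3 * r^4) / 2"
      using E(2)[of k] r \<open>0 < \<epsilon>\<close> by (intro divide_right_mono add_right_mono mult_left_mono) auto
    also have "\<dots> = \<epsilon> * r" using r(1) \<open>0 < \<epsilon>\<close>
      by (simp add: field_simps power2_eq_square power3_eq_cube power4_eq_xxxx)
    finally have le: "(\<integral>\<omega>. \<bar>g (B ?u \<omega>) * B ?u \<omega>\<bar> \<partial>M) \<le> \<epsilon> * r" .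
    have "(\<integral>\<omega>. f k \<omega> \<partial>M) = (\<integral>\<omega>. \<bar>g (B ?u \<omega>) * B ?u \<omega>\<bar> \<partial>M) * ((?u - t k) / ?u)"
      unfolding f_def by simp
    also have "\<dots> \<le> \<epsilon> * r * ((?u - t k) / ?u)"
      using le tk(2,3)[of k] by (intro mult_right_mono) (auto intro!: divide_nonneg_nonneg)
    also have "\<dots> = \<epsilon> * ((?u - t k) / r^3)"
    proof -
      have "r / ?u = 1 / r^3" unfolding r4 using r(1) by (simp add: power3_eq_cube power4_eq_xxxx)
      then have "\<epsilon> * (?u - t k) * (r / ?u) = \<epsilon> * (?u - t k) * (1 / r^3)" by simp
      then show ?thesis by (simp add: ac_simps)
    qed
    finally show "(\<integral>\<omega>. f k \<omega> \<partial>M) \<le> \<epsilon> * ((?u - t k) / (sqrt (sqrt ?u)) ^ 3)" by (simp add: r_def)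
  qed
  have drift: "off_event M (\<epsilon> * (4 * sqrt (sqrt (t N))) / l) (\<lambda>\<omega>. (\<Sum>k<N. f k \<omega>) < l)"
  proof (rule off_event_weaken[OF off_event_Markov])
    show "integrable M (\<lambda>\<omega>. \<Sum>k<N. f k \<omega>)" using f(1) by simp
    show "0 \<le> (\<Sum>k<N. f k \<omega>)" for \<omega> using f_nonneg by (intro sum_nonneg) auto
    have "(\<integral>\<omega>. (\<Sum>k<N. f k \<omega>) \<partial>M) = (\<Sum>k<N. \<integral>\<omega>. f k \<omega> \<partial>M)" using f(1) by simp
    also have "\<dots> \<le> (\<Sum>k<N. \<epsilon> * ((t (Suc k) - t k) / (sqrt (sqrt (t (Suc k)))) ^ 3))"
      using f(2) by (rule sum_mono)
    also have "\<dots> = \<epsilon> * (\<Sum>k<N. (t (Suc k) - t k) / (sqrt (sqrt (t (Suc k)))) ^ 3)" by (simp add: sum_distrib_left)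
    also have "\<dots> \<le> \<epsilon> * (4 * sqrt (sqrt (t N)))"
      using t \<open>0 < \<epsilon>\<close> by (intro mult_left_mono sum_increments_over_three_quarters) auto
    finally show "(\<integral>\<omega>. (\<Sum>k<N. f k \<omega>) \<partial>M) / l \<le> \<epsilon> * (4 * sqrt (sqrt (t N))) / l"
      using \<open>0 < l\<close> by (intro divide_right_mono) auto
  qed (rule \<open>0 < l\<close>)
  show ?thesis
  proof (rule off_event_mono[OF off_event_conj[OF mart drift] order_refl])
    fix \<omega> assume *: "(\<forall>j\<le>N. \<bar>\<Sum>k<j. g (B (t (Suc k)) \<omega>) * bridge (t k) (t (Suc k)) \<omega>\<bar> < 2 * l) \<and>
      (\<Sum>k<N. f k \<omega>) < l"
    show "\<forall>j\<le>N. \<bar>\<Sum>k<j. g (B (t (Suc k)) \<omega>) * (B (t (Suc k)) \<omega> - B (t k) \<omega>)\<bar> < 3 * l"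
    proof (intro allI impI)
      fix j assume "j \<le> N"
      let ?d = "\<lambda>k. g (B (t (Suc k)) \<omega>) * B (t (Suc k)) \<omega> * ((t (Suc k) - t k) / t (Suc k))"
      have "g (B (t (Suc k)) \<omega>) * (B (t (Suc k)) \<omega> - B (t k) \<omega>) =
          ?d k - g (B (t (Suc k)) \<omega>) * bridge (t k) (t (Suc k)) \<omega>" for k
        using tk(3)[of k] by (simp add: bridge_def field_simps)
      then have "(\<Sum>k<j. g (B (t (Suc k)) \<omega>) * (B (t (Suc k)) \<omega> - B (t k) \<omega>)) =
          (\<Sum>k<j. ?d k) - (\<Sum>k<j. g (B (t (Suc k)) \<omega>) * bridge (t k) (t (Suc k)) \<omega>)"
        by (simp add: sum_subtractf)
      moreover have "\<bar>\<Sum>k<j. ?d k\<bar> < l"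
      proof -
        have "\<bar>\<Sum>k<j. ?d k\<bar> \<le> (\<Sum>k<j. \<bar>?d k\<bar>)" by (rule sum_abs)
        also have "\<dots> = (\<Sum>k<j. f k \<omega>)"
          using tk(2,3) by (intro sum.cong refl) (simp add: f_def abs_mult less_imp_le)
        also have "\<dots> \<le> (\<Sum>k<N. f k \<omega>)" using \<open>j \<le> N\<close> f_nonneg by (intro sum_mono2) auto
        finally show ?thesis using * by simp
      qed
      moreover have "\<bar>\<Sum>k<j. g (B (t (Suc k)) \<omega>) * bridge (t k) (t (Suc k)) \<omega>\<bar> < 2 * l" using * \<open>j \<le> N\<close> by blast
      ultimately show "\<bar>\<Sum>k<j. g (B (t (Suc k)) \<omega>) * (B (t (Suc k)) \<omega> - B (t k) \<omega>)\<bar> < 3 * l" by linarith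
    qed
  qed
qed

end

section \<open>Smooth integrands\<close>

locale partitioned_brownian_motion = centered_brownian_motion +
  fixes D :: "nat \<Rightarrow> nat \<Rightarrow> real"
  assumes D: "partition_sequence D"
begin

abbreviation Bn :: "nat \<Rightarrow> nat \<Rightarrow> 'a \<Rightarrow> real" where
  "Bn n k \<omega> \<equiv> B (D n k) \<omega>"

abbreviation dt :: "nat \<Rightarrow> nat \<Rightarrow> real" where
  "dt n k \<equiv> D n (Suc k) - D n k"

definition dB :: "nat \<Rightarrow> nat \<Rightarrow> 'a \<Rightarrow> real" where
  "dB n k \<omega> = Bn n (Suc k) \<omega> - Bn n k \<omega>"

definition fwd :: "(real \<Rightarrow> real) \<Rightarrow> nat \<Rightarrow> nat \<Rightarrow> 'a \<Rightarrow> real" where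
  "fwd f n j \<omega> = (\<Sum>k<j. f (Bn n k \<omega>) * dB n k \<omega>)"

definition bwd :: "(real \<Rightarrow> real) \<Rightarrow> nat \<Rightarrow> nat \<Rightarrow> 'a \<Rightarrow> real" where
  "bwd f n j \<omega> = (\<Sum>k<j. f (Bn n (Suc k) \<omega>) * dB n k \<omega>)"

text \<open>Oscillation is measured over times at most one partition step apart; naming a step
  \<open>k\<close> avoids a supremum over all steps. The horizon is \<open>T + 1\<close> because the
  partition point reached after \<open>T\<close> overshoots by less than 1 once the mesh is below
  1.\<close>

abbreviation controlled :: "real \<Rightarrow> real \<Rightarrow> real \<Rightarrow> nat \<Rightarrow> 'a \<Rightarrow> bool" where
  "controlled T R \<kappa> n \<omega> \<equiv> (\<forall>s\<in>{0..T + 1}. \<bar>B s \<omega>\<bar> \<le> R) \<and>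
    (\<forall>s\<in>{0..T + 1}. \<forall>u\<in>{0..T + 1}. (\<exists>k. \<bar>s - u\<bar> \<le> dt n k) \<longrightarrow> \<bar>B s \<omega> - B u \<omega>\<bar> \<le> \<kappa>)"

text \<open>Here \<open>f\<close> is meant as a smooth approximation of \<open>h\<close>, with
  primitives \<Phi> and \<open>H\<close>. The primitives are compared through their increments from
  0, where \<open>B\<close> starts.\<close>

abbreviation sums_close ::
  "(real \<Rightarrow> real) \<Rightarrow> (real \<Rightarrow> real) \<Rightarrow> (real \<Rightarrow> real) \<Rightarrow> (real \<Rightarrow> real) \<Rightarrow> real \<Rightarrow> real \<Rightarrow> nat \<Rightarrow> 'a \<Rightarrow> bool" where
  "sums_close h H f \<Phi> \<tau> T n \<omega> \<equiv> \<forall>j\<le>part_index D n T.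
    \<bar>fwd h n j \<omega> - fwd f n j \<omega>\<bar> \<le> \<tau> \<and> \<bar>bwd h n j \<omega> - bwd f n j \<omega>\<bar> \<le> \<tau> \<and>
    \<bar>(H (Bn n j \<omega>) - H 0) - (\<Phi> (Bn n j \<omega>) - \<Phi> 0)\<bar> \<le> \<tau>"

lemmas partition_facts = partition_0[OF D] partition_strict_mono[OF D] partition_Suc[OF D]
  partition_nonneg[OF D]

lemma part_index_range:
  assumes "0 \<le> T" "\<And>k. dt n k < 1" "j \<le> part_index D n T"
  shows "0 \<le> D n j" "D n j \<le> T + 1"
proof -
  have "D n j \<le> D n (part_index D n T)"
    using assms(3) strict_mono_less_eq[OF partition_strict_mono[OF D]] by simp
  also have "\<dots> < T + 1" using assms by (intro part_index_less[OF D]) auto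
  finally show "0 \<le> D n j" "D n j \<le> T + 1" using partition_facts by auto
qed

text \<open>The expected sum is of order the root of the mesh, and Markov's inequality does the
  rest; \<open>\<delta>\<close> is the mesh size for which the bound on the expectation becomes
  \<open>\<eta> * \<epsilon>\<close>.\<close>

lemma increment_cubes_small:
  assumes "0 \<le> T" "0 < \<epsilon>" "0 < \<eta>"
  shows "\<forall>\<^sub>F n in sequentially. off_event M \<eta> (\<lambda>\<omega>. (\<Sum>k<part_index D n T. \<bar>dB n k \<omega>\<bar> ^ 3) < \<epsilon>)"
proof -
  define \<delta> where "\<delta> = (\<eta> * \<epsilon> / (2 * (T + 1)))\<^sup>2"
  have "sqrt \<delta> = \<eta> * \<epsilon> / (2 * (T + 1))" unfolding \<delta>_def real_sqrt_abs using assms by simp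
  then have \<delta>: "0 < \<delta>" "2 * sqrt \<delta> * (T + 1) = \<eta> * \<epsilon>"
    using assms by (simp_all add: \<delta>_def field_simps)
  have "\<forall>\<^sub>F n in sequentially. \<forall>k. dt n k < min 1 \<delta>"
    using \<delta> by (intro partition_mesh[OF D]) auto
  then show ?thesis
  proof eventually_elim
    case (elim n)
    let ?N = "part_index D n T"
    note mom = increment_moments(7,8)[OF partition_nonneg[OF D] partition_Suc[OF D], of n, folded dB_def]
    have "(\<integral>\<omega>. (\<Sum>k<?N. \<bar>dB n k \<omega>\<bar> ^ 3) \<partial>M) = (\<Sum>k<?N. \<integral>\<omega>. \<bar>dB n k \<omega>\<bar> ^ 3 \<partial>M)" using mom by simp
    also have "\<dots> \<le> (\<Sum>k<?N. 2 * sqrt \<delta> * (dt n k))"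
    proof (rule sum_mono)
      fix k
      have d: "0 < dt n k" "sqrt (dt n k) \<le> sqrt \<delta>"
        using elim[rule_format, of k] partition_Suc[OF D, of n k] by auto
      have "2 * (dt n k) * sqrt (dt n k) \<le> 2 * (dt n k) * sqrt \<delta>"
        using d by (intro mult_left_mono) auto
      then show "(\<integral>\<omega>. \<bar>dB n k \<omega>\<bar> ^ 3 \<partial>M) \<le> 2 * sqrt \<delta> * (dt n k)"
        using mom(2)[of k] by (simp add: ac_simps)
    qed
    also have "\<dots> = 2 * sqrt \<delta> * D n ?N"
      using partition_0[OF D, of n] by (simp add: sum_distrib_left[symmetric] sum_increments)
    also have "\<dots> \<le> 2 * sqrt \<delta> * (T + 1)"
      using part_index_range(2)[of T n ?N] elim assms \<delta> by (intro mult_left_mono) auto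
    also have "\<dots> = \<eta> * \<epsilon>" by (rule \<delta>)
    finally have "(\<integral>\<omega>. (\<Sum>k<?N. \<bar>dB n k \<omega>\<bar> ^ 3) \<partial>M) / \<epsilon> \<le> \<eta>"
      using assms by (simp add: field_simps)
    moreover have "off_event M ((\<integral>\<omega>. (\<Sum>k<?N. \<bar>dB n k \<omega>\<bar> ^ 3) \<partial>M) / \<epsilon>) (\<lambda>\<omega>. (\<Sum>k<?N. \<bar>dB n k \<omega>\<bar> ^ 3) < \<epsilon>)"
      using mom assms by (intro off_event_Markov) (auto intro: sum_nonneg)
    ultimately show ?case by (rule off_event_weaken[rotated])
  qed
qed

text \<open>A squared increment minus the step length is centred, independent of the past, and has a
  variance quadratic in the step. With a bounded coefficient the second moments therefore add up to
  at most a constant times mesh times \<open>T + 1\<close>.\<close>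

lemma quadratic_variation_fluctuation_small:
  assumes "0 \<le> T" "0 < \<epsilon>" "0 < \<eta>" and c[measurable]: "c \<in> borel_measurable borel" and C: "\<And>x. \<bar>c x\<bar> \<le> C"
  shows "\<forall>\<^sub>F n in sequentially. off_event M \<eta> (\<lambda>\<omega>. \<forall>j\<le>part_index D n T.
    \<bar>\<Sum>k<j. c (Bn n k \<omega>) * ((dB n k \<omega>)\<^sup>2 - (dt n k))\<bar> < \<epsilon>)"
proof -
  \<comment> \<open>Chosen so that the final bound on the second moments is
    \<open>\<eta> * \<epsilon>\<^sup>2\<close>; the summand 1 keeps the denominator positive when
    \<open>C = 0\<close>.\<close>
  define \<delta> where "\<delta> = \<eta> * \<epsilon>\<^sup>2 / (2 * (C\<^sup>2 + 1) * (T + 1))"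
  have pos: "0 < 2 * (C\<^sup>2 + 1) * (T + 1)" using \<open>0 \<le> T\<close> by (intro mult_pos_pos add_nonneg_pos) auto
  have \<delta>: "0 < \<delta>" "2 * (C\<^sup>2 + 1) * \<delta> * (T + 1) = \<eta> * \<epsilon>\<^sup>2"
  proof -
    show "0 < \<delta>" using assms pos by (simp add: \<delta>_def)
    have "(2 * (C\<^sup>2 + 1) * (T + 1)) * \<delta> = \<eta> * \<epsilon>\<^sup>2"
      unfolding \<delta>_def using less_imp_neq[OF pos] by (simp only: times_divide_eq_right nonzero_mult_div_cancel_left not_sym)
    then show "2 * (C\<^sup>2 + 1) * \<delta> * (T + 1) = \<eta> * \<epsilon>\<^sup>2" by (simp add: ac_simps)
  qed
  have "\<forall>\<^sub>F n in sequentially. \<forall>k. dt n k < min 1 \<delta>"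
    using \<delta> by (intro partition_mesh[OF D]) auto
  then show ?thesis
  proof eventually_elim
    case (elim n)
    let ?N = "part_index D n T"
    have c_sq: "(c x)\<^sup>2 \<le> C\<^sup>2" for x using C[of x] power_mono[of "\<bar>c x\<bar>" C 2] by simp
    have [measurable]: "Bn n k \<in> borel_measurable (F (D n k))" "Bn n k \<in> borel_measurable M" for k
      using partition_nonneg[OF D] by (auto intro: B_measurable_F B_measurable)
    note mom = increment_moments(4-6)[OF partition_nonneg[OF D] partition_Suc[OF D], of n, folded dB_def]
    have ci: "integrable M (\<lambda>\<omega>. (c (Bn n k \<omega>))\<^sup>2)" for k
      using c_sq by (intro integrable_const_bound[where B="C\<^sup>2"]) auto
    have ce: "(\<integral>\<omega>. (c (Bn n k \<omega>))\<^sup>2 \<partial>M) \<le> C\<^sup>2" for k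
      using ci[of k] c_sq integral_mono[of M "\<lambda>\<omega>. (c (Bn n k \<omega>))\<^sup>2" "\<lambda>_. C\<^sup>2"] by (simp add: prob_space)
    have "off_event M ((\<Sum>k<?N. (\<integral>\<omega>. (c (Bn n k \<omega>))\<^sup>2 \<partial>M) * (\<integral>\<omega>. ((dB n k \<omega>)\<^sup>2 - (dt n k))\<^sup>2 \<partial>M)) / \<epsilon>\<^sup>2)
      (\<lambda>\<omega>. \<forall>j\<le>?N. \<bar>\<Sum>k<j. c (Bn n k \<omega>) * ((dB n k \<omega>)\<^sup>2 - (dt n k))\<bar> < \<epsilon>)"
      using increments_maximal[of "D n" ?N "\<lambda>k \<omega>. c (Bn n k \<omega>)" "\<lambda>k x. x\<^sup>2 - (dt n k)" \<epsilon>, folded dB_def]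
        partition_facts ci mom assms(2) by simp
    then show ?case
    proof (rule off_event_weaken)
      have "(\<Sum>k<?N. (\<integral>\<omega>. (c (Bn n k \<omega>))\<^sup>2 \<partial>M) * (\<integral>\<omega>. ((dB n k \<omega>)\<^sup>2 - (dt n k))\<^sup>2 \<partial>M)) \<le>
          (\<Sum>k<?N. 2 * (C\<^sup>2 + 1) * \<delta> * (dt n k))"
      proof (rule sum_mono)
        fix k
        have d: "0 < dt n k" "dt n k \<le> \<delta>"
          using elim[rule_format, of k] partition_Suc[OF D, of n k] by auto
        have "(\<integral>\<omega>. (c (Bn n k \<omega>))\<^sup>2 \<partial>M) * (2 * (dt n k)\<^sup>2) \<le> (C\<^sup>2 + 1) * (2 * (\<delta> * (dt n k)))"
          using ce[of k] d by (intro mult_mono) (auto simp: power2_eq_square)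
        then show "(\<integral>\<omega>. (c (Bn n k \<omega>))\<^sup>2 \<partial>M) * (\<integral>\<omega>. ((dB n k \<omega>)\<^sup>2 - (dt n k))\<^sup>2 \<partial>M) \<le>
            2 * (C\<^sup>2 + 1) * \<delta> * (dt n k)"
          unfolding mom(2) by (simp only: ac_simps)
      qed
      also have "\<dots> = 2 * (C\<^sup>2 + 1) * \<delta> * D n ?N"
        using partition_0[OF D, of n] by (simp add: sum_distrib_left[symmetric] sum_increments)
      also have "\<dots> \<le> 2 * (C\<^sup>2 + 1) * \<delta> * (T + 1)"
        using part_index_range(2)[of T n ?N] elim assms \<delta> by (intro mult_left_mono) auto
      also have "\<dots> = \<eta> * \<epsilon>\<^sup>2" by (rule \<delta>)
      finally show "(\<Sum>k<?N. (\<integral>\<omega>. (c (Bn n k \<omega>))\<^sup>2 \<partial>M) * (\<integral>\<omega>. ((dB n k \<omega>)\<^sup>2 - (dt n k))\<^sup>2 \<partial>M)) / \<epsilon>\<^sup>2 \<le> \<eta>"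
        using assms by (simp add: field_simps)
    qed
  qed
qed

end

section \<open>Taylor estimates for twice differentiable integrands\<close>

locale smooth_primitive =
  fixes \<Phi> f f1 f2 :: "real \<Rightarrow> real"
  assumes \<Phi>: "\<And>x. (\<Phi> has_real_derivative f x) (at x)"
    and f: "\<And>x. (f has_real_derivative f1 x) (at x)"
    and f1: "\<And>x. (f1 has_real_derivative f2 x) (at x)"
    and f2: "continuous_on UNIV f2"
begin

lemma continuous: "continuous_on A \<Phi>" "continuous_on A f" "continuous_on A f1"
  by (intro continuous_at_imp_continuous_on ballI DERIV_isCont[OF \<Phi>] DERIV_isCont[OF f] DERIV_isCont[OF f1])+

text \<open>The second bound is the error of the trapezoidal rule, in which the terms of second
  order cancel; so trapezoidal sums converge without reference to the quadratic variation. The first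
  bound keeps the second order term, the source of the time integral in Ito's formula.\<close>

lemma Taylor_bounds:
  obtains C where "0 \<le> C"
    "\<And>x y. \<bar>x\<bar> \<le> R \<Longrightarrow> \<bar>y\<bar> \<le> R \<Longrightarrow> \<bar>\<Phi> y - \<Phi> x - f x * (y - x) - f1 x * (y - x)\<^sup>2 / 2\<bar> \<le> C * \<bar>y - x\<bar> ^ 3"
    "\<And>x y. \<bar>x\<bar> \<le> R \<Longrightarrow> \<bar>y\<bar> \<le> R \<Longrightarrow> \<bar>(f x + f y) / 2 * (y - x) - (\<Phi> y - \<Phi> x)\<bar> \<le> C * \<bar>y - x\<bar> ^ 3"
proof -
  have "compact (f2 ` {-R..R})"
    by (intro compact_continuous_image continuous_on_subset[OF f2]) auto
  then obtain b where b: "\<forall>x\<in>{-R..R}. \<bar>f2 x\<bar> \<le> b"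
    using compact_imp_bounded[of "f2 ` {-R..R}"] unfolding bounded_iff by auto
  \<comment> \<open>For negative \<open>R\<close> the interval is empty and \<open>b\<close> may be
    negative.\<close>
  define C where "C = max 0 b"
  have "\<bar>f2 x\<bar> \<le> b" if "\<bar>x\<bar> \<le> R" for x using bspec[OF b, of x] that by (auto simp: abs_le_iff)
  then have C: "0 \<le> C" "\<And>x. \<bar>x\<bar> \<le> R \<Longrightarrow> \<bar>f2 x\<bar> \<le> C" unfolding C_def by (auto intro: max.coboundedI2)
  have 1: "\<bar>\<Phi> y - \<Phi> x - f x * (y - x) - f1 x * (y - x)\<^sup>2 / 2\<bar> \<le> C / 6 * \<bar>y - x\<bar> ^ 3"
    and 2: "\<bar>f y - f x - f1 x * (y - x)\<bar> \<le> C / 2 * \<bar>y - x\<bar>\<^sup>2" if xy: "\<bar>x\<bar> \<le> R" "\<bar>y\<bar> \<le> R" for x y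
  proof -
    have "\<exists>z. \<bar>z\<bar> \<le> R \<and> \<Phi> y = \<Phi> x + f x * (y - x) + f1 x * (y - x)\<^sup>2 / 2 + f2 z / 6 * (y - x)^3"
    proof (cases "y = x")
      case False
      have "\<exists>z. (if y < x then y < z \<and> z < x else x < z \<and> z < y) \<and>
          \<Phi> y = (\<Sum>m<3. ([\<Phi>, f, f1, f2] ! m) x / fact m * (y - x)^m) + ([\<Phi>, f, f1, f2] ! 3) z / fact 3 * (y - x)^3"
        by (rule Taylor[of 3 "\<lambda>m. [\<Phi>, f, f1, f2] ! m" \<Phi> "-R" R x y])
          (use False xy \<Phi> f f1 in \<open>auto simp: less_Suc_eq numeral_3_eq_3\<close>)
      then obtain z where z: "if y < x then y < z \<and> z < x else x < z \<and> z < y"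
        "\<Phi> y = (\<Sum>m<3. ([\<Phi>, f, f1, f2] ! m) x / fact m * (y - x)^m) + ([\<Phi>, f, f1, f2] ! 3) z / fact 3 * (y - x)^3"
        by blast
      have "\<bar>z\<bar> \<le> R" using z(1) xy by (auto split: if_splits)
      moreover have "\<Phi> y = \<Phi> x + f x * (y - x) + f1 x * (y - x)\<^sup>2 / 2 + f2 z / 6 * (y - x)^3"
        using z(2) by (simp add: numeral_3_eq_3 fact_numeral lessThan_Suc power2_eq_square)
      ultimately show ?thesis by blast
    qed (use xy in auto)
    then obtain z where z: "\<bar>z\<bar> \<le> R" "\<Phi> y = \<Phi> x + f x * (y - x) + f1 x * (y - x)\<^sup>2 / 2 + f2 z / 6 * (y - x)^3" by blast
    then have "\<bar>\<Phi> y - \<Phi> x - f x * (y - x) - f1 x * (y - x)\<^sup>2 / 2\<bar> = \<bar>f2 z\<bar> / 6 * \<bar>y - x\<bar>^3"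
      by (simp add: abs_mult power_abs)
    also have "\<dots> \<le> C / 6 * \<bar>y - x\<bar>^3" using C(2)[OF z(1)] by (intro mult_right_mono) auto
    finally show "\<bar>\<Phi> y - \<Phi> x - f x * (y - x) - f1 x * (y - x)\<^sup>2 / 2\<bar> \<le> C / 6 * \<bar>y - x\<bar> ^ 3" .
    have "\<exists>z. \<bar>z\<bar> \<le> R \<and> f y = f x + f1 x * (y - x) + f2 z / 2 * (y - x)^2"
    proof (cases "y = x")
      case False
      have "\<exists>z. (if y < x then y < z \<and> z < x else x < z \<and> z < y) \<and>
          f y = (\<Sum>m<2. ([f, f1, f2] ! m) x / fact m * (y - x)^m) + ([f, f1, f2] ! 2) z / fact 2 * (y - x)^2"
        by (rule Taylor[of 2 "\<lambda>m. [f, f1, f2] ! m" f "-R" R x y])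
          (use False xy f f1 in \<open>auto simp: less_Suc_eq numeral_2_eq_2\<close>)
      then obtain z where z: "if y < x then y < z \<and> z < x else x < z \<and> z < y"
        "f y = (\<Sum>m<2. ([f, f1, f2] ! m) x / fact m * (y - x)^m) + ([f, f1, f2] ! 2) z / fact 2 * (y - x)^2"
        by blast
      have "\<bar>z\<bar> \<le> R" using z(1) xy by (auto split: if_splits)
      moreover have "f y = f x + f1 x * (y - x) + f2 z / 2 * (y - x)^2"
        using z(2) by (simp add: numeral_2_eq_2 fact_numeral lessThan_Suc)
      ultimately show ?thesis by blast
    qed (use xy in auto)
    then obtain z where z: "\<bar>z\<bar> \<le> R" "f y = f x + f1 x * (y - x) + f2 z / 2 * (y - x)^2" by blast
    then have "\<bar>f y - f x - f1 x * (y - x)\<bar> = \<bar>f2 z\<bar> / 2 * \<bar>y - x\<bar>\<^sup>2"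
      by (simp add: abs_mult)
    also have "\<dots> \<le> C / 2 * \<bar>y - x\<bar>\<^sup>2" using C(2)[OF z(1)] by (intro mult_right_mono) auto
    finally show "\<bar>f y - f x - f1 x * (y - x)\<bar> \<le> C / 2 * \<bar>y - x\<bar>\<^sup>2" .
  qed
  show ?thesis
  proof (rule that[of C])
    show "0 \<le> C" by (rule C)
    fix x y assume xy: "\<bar>x\<bar> \<le> R" "\<bar>y\<bar> \<le> R"
    have "0 \<le> C * \<bar>y - x\<bar>^3" using C(1) by simp
    then show "\<bar>\<Phi> y - \<Phi> x - f x * (y - x) - f1 x * (y - x)\<^sup>2 / 2\<bar> \<le> C * \<bar>y - x\<bar> ^ 3"
      using 1[OF xy] by simp
    define p where "p = \<Phi> y - \<Phi> x - f x * (y - x) - f1 x * (y - x)\<^sup>2 / 2"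
    define q where "q = f y - f x - f1 x * (y - x)"
    have "\<bar>q * (y - x)\<bar> = \<bar>q\<bar> * \<bar>y - x\<bar>" by (rule abs_mult)
    also have "\<dots> \<le> C / 2 * \<bar>y - x\<bar>\<^sup>2 * \<bar>y - x\<bar>" using 2[OF xy] unfolding q_def by (rule mult_right_mono) simp
    also have "\<dots> = C * \<bar>y - x\<bar>^3 / 2" by (simp add: power2_eq_square power3_eq_cube)
    finally have q: "\<bar>q * (y - x)\<bar> \<le> C * \<bar>y - x\<bar>^3 / 2" .
    have "\<bar>p\<bar> \<le> C * \<bar>y - x\<bar>^3 / 6" using 1[OF xy] unfolding p_def by simp
    \<comment> \<open>\<open>p\<close> and \<open>q\<close> are the Taylor remainders of \<Phi> and
      \<open>f\<close>; in this combination the terms with \<open>f1\<close> cancel.\<close>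
    moreover have "(f x + f y) / 2 * (y - x) - (\<Phi> y - \<Phi> x) = q * (y - x) / 2 - p"
      unfolding p_def q_def by (simp add: power2_eq_square field_simps)
    ultimately show "\<bar>(f x + f y) / 2 * (y - x) - (\<Phi> y - \<Phi> x)\<bar> \<le> C * \<bar>y - x\<bar> ^ 3"
      using q \<open>0 \<le> C * \<bar>y - x\<bar>^3\<close> by linarith
  qed
qed

end

lemma continuous_bound_and_modulus:
  fixes h :: "real \<Rightarrow> real"
  assumes "continuous_on UNIV h" "0 < \<epsilon>"
  obtains C \<kappa> where "0 \<le> C" "0 < \<kappa>" "\<And>x. \<bar>x\<bar> \<le> R \<Longrightarrow> \<bar>h x\<bar> \<le> C"
    "\<And>x y. \<bar>x\<bar> \<le> R \<Longrightarrow> \<bar>y\<bar> \<le> R \<Longrightarrow> \<bar>x - y\<bar> \<le> \<kappa> \<Longrightarrow> \<bar>h x - h y\<bar> \<le> \<epsilon>"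
proof -
  have c: "continuous_on {-R..R} h" using assms(1) by (rule continuous_on_subset) simp
  then have "compact (h ` {-R..R})" by (intro compact_continuous_image) auto
  then obtain b where b: "\<forall>x\<in>{-R..R}. \<bar>h x\<bar> \<le> b"
    using compact_imp_bounded[of "h ` {-R..R}"] unfolding bounded_iff by auto
  have bb: "\<bar>h x\<bar> \<le> max 0 b" if "\<bar>x\<bar> \<le> R" for x
    using bspec[OF b, of x] that by (auto simp: abs_le_iff)
  have "uniformly_continuous_on {-R..R} h" using c by (intro compact_uniformly_continuous) auto
  then obtain d where d: "0 < d"
    "\<And>x y. x \<in> {-R..R} \<Longrightarrow> y \<in> {-R..R} \<Longrightarrow> dist y x < d \<Longrightarrow> dist (h y) (h x) < \<epsilon>"
    unfolding uniformly_continuous_on_def using \<open>0 < \<epsilon>\<close> by meson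
  have "\<bar>h x - h y\<bar> \<le> \<epsilon>" if "\<bar>x\<bar> \<le> R" "\<bar>y\<bar> \<le> R" "\<bar>x - y\<bar> \<le> d / 2" for x y
    using d(2)[of y x] that d(1) by (auto simp: dist_real_def abs_le_iff)
  with bb d(1) show ?thesis by (intro that[of "max 0 b" "d / 2"]) auto
qed

section \<open>Control of the paths along the partitions\<close>

context partitioned_brownian_motion
begin

text \<open>The order of the quantifiers matters: \<open>R\<close> is fixed first, because the
  tolerance \<kappa> will be taken from the modulus of continuity of some function on
  \<open>[-R, R]\<close>.\<close>

lemma partition_path_control:
  assumes "0 \<le> T" "0 < \<eta>"
  obtains R where "0 < R" "\<And>\<kappa>. 0 < \<kappa> \<Longrightarrow> \<forall>\<^sub>F n in sequentially. off_event M \<eta>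
    (\<lambda>\<omega>. controlled T R \<kappa> n \<omega>)"
proof -
  obtain R where R: "0 < R" "off_event M (\<eta>/2) (\<lambda>\<omega>. \<forall>s\<in>{0..T + 1}. \<bar>B s \<omega>\<bar> \<le> R)"
    using path_bounded[of "T + 1" "\<eta>/2"] assms by auto
  show ?thesis
  proof (rule that[OF R(1)])
    fix \<kappa> :: real assume "0 < \<kappa>"
    obtain \<delta> where \<delta>: "0 < \<delta>" "off_event M (\<eta>/2)
        (\<lambda>\<omega>. \<forall>s\<in>{0..T + 1}. \<forall>u\<in>{0..T + 1}. \<bar>s - u\<bar> < \<delta> \<longrightarrow> \<bar>B s \<omega> - B u \<omega>\<bar> \<le> \<kappa>)"
      using path_modulus[of "T + 1" "\<eta>/2" \<kappa>] assms \<open>0 < \<kappa>\<close> by auto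
    show "\<forall>\<^sub>F n in sequentially. off_event M \<eta>
      (\<lambda>\<omega>. controlled T R \<kappa> n \<omega>)"
      using partition_mesh[OF D \<delta>(1)]
    proof eventually_elim
      case (elim n)
      show ?case
      proof (rule off_event_mono[OF off_event_conj[OF R(2) \<delta>(2)]])
        fix \<omega> assume *: "(\<forall>s\<in>{0..T + 1}. \<bar>B s \<omega>\<bar> \<le> R) \<and>
          (\<forall>s\<in>{0..T + 1}. \<forall>u\<in>{0..T + 1}. \<bar>s - u\<bar> < \<delta> \<longrightarrow> \<bar>B s \<omega> - B u \<omega>\<bar> \<le> \<kappa>)"
        show "controlled T R \<kappa> n \<omega>"
        proof (intro conjI ballI impI)
          fix s u assume su: "s \<in> {0..T + 1}" "u \<in> {0..T + 1}" "\<exists>k. \<bar>s - u\<bar> \<le> dt n k"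
          then have "\<bar>s - u\<bar> < \<delta>" using elim by (meson le_less_trans)
          with * su show "\<bar>B s \<omega> - B u \<omega>\<bar> \<le> \<kappa>" by blast
        qed (use * in blast)
      qed simp
    qed
  qed
qed

lemma part_index_close:
  assumes "0 \<le> s" obtains k where "\<bar>D n (part_index D n s) - s\<bar> \<le> dt n k"
proof (cases "part_index D n s")
  case 0
  then have "D n (part_index D n s) = s" using part_index_le[OF D, of s n] assms partition_0[OF D, of n] by simp
  then show ?thesis using partition_Suc[OF D, of n 0] by (intro that[of 0]) simp
next
  case (Suc k)
  then have "D n k < s" by (intro less_part_index[OF D]) simp
  then show ?thesis using Suc part_index_le[OF D, of s n] by (intro that[of k]) simp
qed

text \<open>Telescoped sums end at the first partition point at or after \<open>s\<close>; this
  moves the end point to \<open>s\<close> itself, uniformly in \<open>s\<close>.\<close>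

lemma primitive_at_partition:
  fixes \<Phi> :: "real \<Rightarrow> real"
  assumes "continuous_on UNIV \<Phi>" "0 \<le> T" "0 < \<epsilon>" "0 < \<eta>"
  shows "\<forall>\<^sub>F n in sequentially. off_event M \<eta> (\<lambda>\<omega>. \<forall>s\<in>{0..T}. \<bar>\<Phi> (Bn n (part_index D n s) \<omega>) - \<Phi> (B s \<omega>)\<bar> \<le> \<epsilon>)"
proof -
  obtain R where R: "0 < R" "\<And>\<kappa>. 0 < \<kappa> \<Longrightarrow> \<forall>\<^sub>F n in sequentially. off_event M \<eta>
    (\<lambda>\<omega>. controlled T R \<kappa> n \<omega>)"
    using partition_path_control[OF assms(2,4)] by blast
  obtain C \<kappa> where "0 \<le> C" and \<kappa>: "0 < \<kappa>" and "\<And>x. \<bar>x\<bar> \<le> R \<Longrightarrow> \<bar>\<Phi> x\<bar> \<le> C"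
    and close: "\<And>x y. \<bar>x\<bar> \<le> R \<Longrightarrow> \<bar>y\<bar> \<le> R \<Longrightarrow> \<bar>x - y\<bar> \<le> \<kappa> \<Longrightarrow> \<bar>\<Phi> x - \<Phi> y\<bar> \<le> \<epsilon>"
    by (rule continuous_bound_and_modulus[OF assms(1,3), of R]) (rule that)
  from R(2)[OF \<kappa>] partition_mesh[OF D zero_less_one] show ?thesis
  proof eventually_elim
    case (elim n)
    show ?case
    proof (rule off_event_mono[OF elim(1) order_refl], rule ballI)
      fix \<omega> s assume *: "controlled T R \<kappa> n \<omega>"
        and s: "s \<in> {0..T}"
      have r: "D n (part_index D n s) \<in> {0..T + 1}" "s \<in> {0..T + 1}"
        using part_index_range[of T n "part_index D n s"] part_index_mono[OF D, of s T n] elim(2) s assms by auto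
      moreover obtain k where "\<bar>D n (part_index D n s) - s\<bar> \<le> dt n k"
        using part_index_close[of s n] s by auto
      ultimately have "\<bar>Bn n (part_index D n s) \<omega> - B s \<omega>\<bar> \<le> \<kappa>" using * by blast
      then show "\<bar>\<Phi> (Bn n (part_index D n s) \<omega>) - \<Phi> (B s \<omega>)\<bar> \<le> \<epsilon>" using * r by (intro close) auto
    qed
  qed
qed

end

section \<open>Trapezoidal and forward sums of smooth integrands\<close>

locale partitioned_with_primitive = partitioned_brownian_motion + smooth_primitive
begin

lemma trapezoidal_sums_converge:
  assumes "0 \<le> T" "0 < \<epsilon>" "0 < \<eta>"
  shows "\<forall>\<^sub>F n in sequentially. off_event M \<eta> (\<lambda>\<omega>. \<forall>j\<le>part_index D n T.
    \<bar>(fwd f n j \<omega> + bwd f n j \<omega>) / 2 - (\<Phi> (Bn n j \<omega>) - \<Phi> 0)\<bar> \<le> \<epsilon>)"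
proof -
  obtain R where R: "0 < R" "off_event M (\<eta>/2) (\<lambda>\<omega>. \<forall>s\<in>{0..T + 1}. \<bar>B s \<omega>\<bar> \<le> R)"
    using path_bounded[of "T + 1" "\<eta>/2"] assms by auto
  obtain C where C: "0 \<le> C"
    "\<And>x y. \<bar>x\<bar> \<le> R \<Longrightarrow> \<bar>y\<bar> \<le> R \<Longrightarrow> \<bar>\<Phi> y - \<Phi> x - f x * (y - x) - f1 x * (y - x)\<^sup>2 / 2\<bar> \<le> C * \<bar>y - x\<bar> ^ 3"
    "\<And>x y. \<bar>x\<bar> \<le> R \<Longrightarrow> \<bar>y\<bar> \<le> R \<Longrightarrow> \<bar>(f x + f y) / 2 * (y - x) - (\<Phi> y - \<Phi> x)\<bar> \<le> C * \<bar>y - x\<bar> ^ 3"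
    by (rule Taylor_bounds[of R]) (rule that)
  have "0 < \<epsilon> / (C + 1)" "0 < \<eta>/2" using assms C(1) by auto
  from increment_cubes_small[OF assms(1) this] partition_mesh[OF D zero_less_one]
  show ?thesis
  proof eventually_elim
    case (elim n)
    let ?N = "part_index D n T"
    show ?case
    proof (rule off_event_mono[OF off_event_conj[OF R(2) elim(1)]])
      fix \<omega> assume \<omega>: "\<omega> \<in> space M"
        and *: "(\<forall>s\<in>{0..T + 1}. \<bar>B s \<omega>\<bar> \<le> R) \<and> (\<Sum>k<?N. \<bar>dB n k \<omega>\<bar> ^ 3) < \<epsilon> / (C + 1)"
      show "\<forall>j\<le>?N. \<bar>(fwd f n j \<omega> + bwd f n j \<omega>) / 2 - (\<Phi> (Bn n j \<omega>) - \<Phi> 0)\<bar> \<le> \<epsilon>"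
      proof (intro allI impI)
        fix j assume j: "j \<le> ?N"
        have BR: "\<bar>Bn n k \<omega>\<bar> \<le> R" if "k \<le> ?N" for k
          using part_index_range[of T n k] elim(2) assms that * by auto
        let ?e = "\<lambda>k. (f (Bn n k \<omega>) + f (Bn n (Suc k) \<omega>)) / 2 * dB n k \<omega> - (\<Phi> (Bn n (Suc k) \<omega>) - \<Phi> (Bn n k \<omega>))"
        have "\<Phi> (Bn n j \<omega>) - \<Phi> 0 = (\<Sum>k<j. \<Phi> (Bn n (Suc k) \<omega>) - \<Phi> (Bn n k \<omega>))"
          using sum_lessThan_telescope[of "\<lambda>k. \<Phi> (Bn n k \<omega>)" j] B_0[OF \<omega>] partition_0[OF D, of n] by simp
        moreover have "(fwd f n j \<omega> + bwd f n j \<omega>) / 2 = (\<Sum>k<j. (f (Bn n k \<omega>) + f (Bn n (Suc k) \<omega>)) / 2 * dB n k \<omega>)"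
          unfolding fwd_def bwd_def by (simp add: sum.distrib[symmetric] sum_divide_distrib algebra_simps add_divide_distrib)
        ultimately have "\<bar>(fwd f n j \<omega> + bwd f n j \<omega>) / 2 - (\<Phi> (Bn n j \<omega>) - \<Phi> 0)\<bar> = \<bar>\<Sum>k<j. ?e k\<bar>"
          by (simp add: sum_subtractf)
        also have "\<dots> \<le> (\<Sum>k<j. \<bar>?e k\<bar>)" by (rule sum_abs)
        also have "\<dots> \<le> (\<Sum>k<j. C * \<bar>dB n k \<omega>\<bar> ^ 3)"
          unfolding dB_def using j by (intro sum_mono C(3) BR) auto
        also have "\<dots> \<le> C * (\<Sum>k<?N. \<bar>dB n k \<omega>\<bar> ^ 3)"
          unfolding sum_distrib_left[symmetric] using C(1) j by (intro mult_left_mono sum_mono2) auto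
        also have "\<dots> \<le> (C + 1) * (\<epsilon> / (C + 1))" using * C(1) by (intro mult_mono) (auto intro: sum_nonneg)
        also have "\<dots> = \<epsilon>" using C(1) by simp
        finally show "\<bar>(fwd f n j \<omega> + bwd f n j \<omega>) / 2 - (\<Phi> (Bn n j \<omega>) - \<Phi> 0)\<bar> \<le> \<epsilon>" .
      qed
    qed simp
  qed
qed

text \<open>Ito's formula, with the second order term as a pathwise integral.\<close>

definition ito_integral :: "real \<Rightarrow> 'a \<Rightarrow> real" where
  "ito_integral s \<omega> = \<Phi> (B s \<omega>) - \<Phi> 0 - integral {0..s} (\<lambda>u. f1 (B u \<omega>)) / 2"

text \<open>Four sources of error: the Taylor remainders, the fluctuation of the squared increments
  around the steps, the Riemann sum against the time integral, and the overshoot of the last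
  partition point, which affects both the integral and \<Phi>.\<close>

lemma ito_sums_converge:
  assumes "0 \<le> T" "0 < \<epsilon>" "0 < \<eta>"
  shows "\<forall>\<^sub>F n in sequentially. off_event M \<eta> (\<lambda>\<omega>. \<forall>s\<in>{0..T}.
    \<bar>fwd f n (part_index D n s) \<omega> - ito_integral s \<omega>\<bar> \<le> \<epsilon>)"
proof -
  obtain R where R: "0 < R" "\<And>\<kappa>. 0 < \<kappa> \<Longrightarrow> \<forall>\<^sub>F n in sequentially. off_event M (\<eta>/4)
    (\<lambda>\<omega>. controlled T R \<kappa> n \<omega>)"
    using partition_path_control[of T "\<eta>/4"] assms by auto
  obtain C where C: "0 \<le> C"
    "\<And>x y. \<bar>x\<bar> \<le> R \<Longrightarrow> \<bar>y\<bar> \<le> R \<Longrightarrow> \<bar>\<Phi> y - \<Phi> x - f x * (y - x) - f1 x * (y - x)\<^sup>2 / 2\<bar> \<le> C * \<bar>y - x\<bar> ^ 3"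
    "\<And>x y. \<bar>x\<bar> \<le> R \<Longrightarrow> \<bar>y\<bar> \<le> R \<Longrightarrow> \<bar>(f x + f y) / 2 * (y - x) - (\<Phi> y - \<Phi> x)\<bar> \<le> C * \<bar>y - x\<bar> ^ 3"
    by (rule Taylor_bounds[of R]) (rule that)
  define e where "e = \<epsilon> / (8 * (T + 1))"
  have e: "0 < e" "e * (T + 1) = \<epsilon> / 8" using assms by (auto simp: e_def field_simps)
  obtain C1 \<kappa> where C1: "0 \<le> C1" "0 < \<kappa>" "\<And>x. \<bar>x\<bar> \<le> R \<Longrightarrow> \<bar>f1 x\<bar> \<le> C1"
    "\<And>x y. \<bar>x\<bar> \<le> R \<Longrightarrow> \<bar>y\<bar> \<le> R \<Longrightarrow> \<bar>x - y\<bar> \<le> \<kappa> \<Longrightarrow> \<bar>f1 x - f1 y\<bar> \<le> e"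
    using continuous_bound_and_modulus[OF continuous(3) e(1), of R] by blast
  have f1_meas[measurable]: "f1 \<in> borel_measurable borel" using continuous(3) by (rule borel_measurable_continuous_onI)
  \<comment> \<open>The fluctuation estimate asks for a coefficient bounded on the whole line. On
    the retained event the paths stay in \<open>[-R, R]\<close>, where \<open>c\<close> and
    \<open>f1\<close> agree.\<close>
  define c where "c x = (if \<bar>x\<bar> \<le> R then f1 x else 0)" for x
  have c: "c \<in> borel_measurable borel" "\<And>x. \<bar>c x\<bar> \<le> C1"
    using C1 unfolding c_def by (measurable, auto)
  have "0 < \<epsilon> / 8 / (C + 1)" "0 < \<eta>/4" "0 < \<epsilon>/4" "0 < \<epsilon>/8" "0 < min 1 (\<epsilon> / 8 / (C1 + 1))" using assms C(1) C1(1) by auto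
  from increment_cubes_small[OF assms(1) this(1,2)] R(2)[OF C1(2)]
    quadratic_variation_fluctuation_small[OF assms(1) this(3,2) c]
    primitive_at_partition[OF continuous(1) assms(1) this(4,2)] partition_mesh[OF D this(5)]
  show ?thesis
  proof eventually_elim
    case (elim n)
    let ?N = "part_index D n T" and ?t = "D n"
    note big = off_event_conj[OF elim(1) off_event_conj[OF elim(2) off_event_conj[OF elim(3) elim(4)]]]
    show ?case
    proof (rule off_event_mono[OF big], goal_cases)
      case (2 \<omega>)
      then have cubes: "(\<Sum>k<?N. \<bar>dB n k \<omega>\<bar> ^ 3) < \<epsilon> / 8 / (C + 1)"
        and bd: "\<forall>s\<in>{0..T + 1}. \<bar>B s \<omega>\<bar> \<le> R"
        and osc: "\<forall>s\<in>{0..T + 1}. \<forall>u\<in>{0..T + 1}. (\<exists>k. \<bar>s - u\<bar> \<le> dt n k) \<longrightarrow> \<bar>B s \<omega> - B u \<omega>\<bar> \<le> \<kappa>"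
        and fluct: "\<forall>j\<le>?N. \<bar>\<Sum>k<j. c (Bn n k \<omega>) * ((dB n k \<omega>)\<^sup>2 - (dt n k))\<bar> < \<epsilon>/4"
        and prim: "\<forall>s\<in>{0..T}. \<bar>\<Phi> (Bn n (part_index D n s) \<omega>) - \<Phi> (B s \<omega>)\<bar> \<le> \<epsilon>/8"
        and \<omega>: "\<omega> \<in> space M" by auto
      have range: "D n k \<in> {0..T + 1}" if "k \<le> ?N" for k
        using part_index_range[of T n k] elim(5) assms that by auto
      have BR: "\<bar>Bn n k \<omega>\<bar> \<le> R" if "k \<le> ?N" for k using range[OF that] bd by blast
      have cont: "continuous_on {0..} (\<lambda>u. f1 (B u \<omega>))"
        by (rule continuous_on_compose2[OF continuous(3)[of UNIV] path_continuous[OF \<omega>]]) auto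
      show ?case
      proof
        fix s assume s: "s \<in> {0..T}"
        define j where "j = part_index D n s"
        have j: "j \<le> ?N" using s by (auto simp: j_def intro: part_index_mono[OF D])
        have sj: "s \<le> ?t j" unfolding j_def by (rule part_index_le[OF D])
        have tj: "?t j \<in> {0..T + 1}" using range[OF j] .
        let ?I = "\<lambda>a b. integral {a..b} (\<lambda>u. f1 (B u \<omega>))"
        let ?r = "\<lambda>k. \<Phi> (Bn n (Suc k) \<omega>) - \<Phi> (Bn n k \<omega>) - f (Bn n k \<omega>) * dB n k \<omega> - f1 (Bn n k \<omega>) * (dB n k \<omega>)\<^sup>2 / 2"
        have 1: "\<bar>\<Sum>k<j. ?r k\<bar> \<le> \<epsilon>/8"
        proof -
          have "\<bar>\<Sum>k<j. ?r k\<bar> \<le> (\<Sum>k<j. \<bar>?r k\<bar>)" by (rule sum_abs)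
          also have "\<dots> \<le> (\<Sum>k<j. C * \<bar>dB n k \<omega>\<bar> ^ 3)"
            unfolding dB_def using j by (intro sum_mono C(2) BR) auto
          also have "\<dots> \<le> C * (\<Sum>k<?N. \<bar>dB n k \<omega>\<bar> ^ 3)"
            unfolding sum_distrib_left[symmetric] using C(1) j by (intro mult_left_mono sum_mono2) auto
          also have "\<dots> \<le> (C + 1) * (\<epsilon> / 8 / (C + 1))" using cubes C(1) by (intro mult_mono) (auto intro: sum_nonneg)
          also have "\<dots> = \<epsilon>/8"
            by (subst times_divide_eq_right, rule nonzero_mult_div_cancel_left) (use C(1) in simp)
          finally show ?thesis .
        qed
        have 2: "\<bar>(\<Sum>k<j. f1 (Bn n k \<omega>) * (dB n k \<omega>)\<^sup>2) - (\<Sum>k<j. f1 (Bn n k \<omega>) * (?t (Suc k) - ?t k))\<bar> < \<epsilon>/4"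
        proof -
          have "(\<Sum>k<j. c (Bn n k \<omega>) * ((dB n k \<omega>)\<^sup>2 - (dt n k))) =
              (\<Sum>k<j. f1 (Bn n k \<omega>) * ((dB n k \<omega>)\<^sup>2 - (dt n k)))"
            using j by (intro sum.cong) (auto simp: c_def BR)
          also have "\<dots> = (\<Sum>k<j. f1 (Bn n k \<omega>) * (dB n k \<omega>)\<^sup>2) - (\<Sum>k<j. f1 (Bn n k \<omega>) * (?t (Suc k) - ?t k))"
            by (simp add: right_diff_distrib sum_subtractf)
          finally show ?thesis using fluct[rule_format, OF j] by simp
        qed
        have 3: "\<bar>(\<Sum>k<j. f1 (Bn n k \<omega>) * (?t (Suc k) - ?t k)) - ?I 0 (?t j)\<bar> \<le> \<epsilon>/8"
        proof -
          have "\<bar>(\<Sum>k<j. f1 (Bn n k \<omega>) * (?t (Suc k) - ?t k)) - ?I 0 (?t j)\<bar> \<le> e * ?t j"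
          proof (rule Riemann_sum_error[OF _ _ cont])
            fix k u assume u: "k < j" "?t k \<le> u" "u \<le> ?t (Suc k)"
            have r: "?t k \<in> {0..T + 1}" "u \<in> {0..T + 1}" using range[of k] range[of "Suc k"] u j by auto
            have "\<bar>u - ?t k\<bar> \<le> ?t (Suc k) - ?t k" using u by auto
            then have "\<bar>B u \<omega> - Bn n k \<omega>\<bar> \<le> \<kappa>" using r osc by blast
            then show "\<bar>f1 (B u \<omega>) - f1 (Bn n k \<omega>)\<bar> \<le> e" using r bd by (intro C1(4)) auto
          qed (use partition_facts in auto)
          also have "\<dots> \<le> e * (T + 1)" using tj e(1) by (intro mult_left_mono) auto
          finally show ?thesis using e(2) by simp
        qed
        have 4: "\<bar>?I 0 (?t j) - ?I 0 s\<bar> \<le> \<epsilon>/8"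
        proof -
          have ci: "continuous_on {a..b} (\<lambda>u. f1 (B u \<omega>))" if "0 \<le> a" for a b
            using cont by (rule continuous_on_subset) (use that in auto)
          have "?I 0 s + ?I s (?t j) = ?I 0 (?t j)"
            using s sj by (intro Henstock_Kurzweil_Integration.integral_combine integrable_continuous_real ci) auto
          moreover have "\<bar>?I s (?t j)\<bar> \<le> C1 * (?t j - s)"
            using s sj tj bd C1(3) by (intro integral_bound[where 'a=real, unfolded real_norm_def] ci) auto
          moreover have "C1 * (?t j - s) \<le> (C1 + 1) * (\<epsilon> / 8 / (C1 + 1))"
          proof (rule mult_mono)
            obtain k where "\<bar>?t j - s\<bar> \<le> ?t (Suc k) - ?t k" using part_index_close[of s n] s unfolding j_def by auto
            moreover have "?t (Suc k) - ?t k < \<epsilon> / 8 / (C1 + 1)" using elim(5) by simp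
            ultimately show "?t j - s \<le> \<epsilon> / 8 / (C1 + 1)" by linarith
          qed (use C1(1) sj in auto)
          moreover have "(C1 + 1) * (\<epsilon> / 8 / (C1 + 1)) = \<epsilon>/8"
            by (subst times_divide_eq_right, rule nonzero_mult_div_cancel_left) (use C1(1) in simp)
          ultimately show ?thesis by linarith
        qed
        have "(\<Sum>k<j. ?r k) = (\<Phi> (Bn n j \<omega>) - \<Phi> 0) - fwd f n j \<omega> - (\<Sum>k<j. f1 (Bn n k \<omega>) * (dB n k \<omega>)\<^sup>2) / 2"
          using sum_lessThan_telescope[of "\<lambda>k. \<Phi> (Bn n k \<omega>)" j] B_0[OF \<omega>] partition_0[OF D, of n]
          by (simp add: sum_subtractf fwd_def sum_divide_distrib)
        moreover have "\<bar>\<Phi> (Bn n j \<omega>) - \<Phi> (B s \<omega>)\<bar> \<le> \<epsilon>/8" using prim s by (simp add: j_def)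
        ultimately show "\<bar>fwd f n (part_index D n s) \<omega> - ito_integral s \<omega>\<bar> \<le> \<epsilon>"
          using 1 2 3 4 unfolding ito_integral_def j_def[symmetric] by linarith
      qed
    qed simp
  qed
qed

end

section \<open>Truncated powers\<close>

definition ppow :: "real \<Rightarrow> real \<Rightarrow> real" where
  "ppow \<beta> x = (if 0 < x then x powr \<beta> else 0)"

text \<open>Continuous on the whole line once \<open>\<beta> > - 1\<close>, even where
  \<open>ppow \<beta>\<close> is unbounded.\<close>

definition ppow_prim :: "real \<Rightarrow> real \<Rightarrow> real" where
  "ppow_prim \<beta> x = (max x 0) powr (\<beta> + 1) / (\<beta> + 1)"

text \<open>Dominates the difference between \<open>ppow \<beta>\<close> and its linear interpolation on \<open>[0, \<epsilon>]\<close>.\<close>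

definition spike :: "real \<Rightarrow> real \<Rightarrow> real \<Rightarrow> real" where
  "spike \<beta> \<epsilon> x = (if 0 < x \<and> x \<le> \<epsilon> then x powr (min \<beta> 0) else 0)"

lemma ppow_measurable[measurable]: "ppow \<beta> \<in> borel_measurable borel"
  unfolding ppow_def by measurable

lemma spike_measurable[measurable]: "spike \<beta> \<epsilon> \<in> borel_measurable borel"
  unfolding spike_def by measurable

lemma spike_nonneg: "0 \<le> spike \<beta> \<epsilon> x"
  by (simp add: spike_def)

lemma continuous_max_powr:
  fixes a :: real assumes "0 < a"
  shows "continuous_on UNIV (\<lambda>x::real. (max (x - p) 0) powr a)"
  using assms by (intro continuous_on_powr' continuous_intros) auto

lemma ppow_prim_continuous: "- 1 < \<beta> \<Longrightarrow> continuous_on UNIV (\<lambda>x. ppow_prim \<beta> (x - p))"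
  unfolding ppow_prim_def by (intro continuous_on_divide continuous_max_powr continuous_on_const) auto

text \<open>Near 0 the square is the power \<open>2 * \<beta>\<close> when \<beta> is negative,
  integrable because \<open>2 * \<beta> > - 1\<close>. This is where the lower bound on \<alpha>
  enters; the integral vanishes with the width \<epsilon>.\<close>

lemma spike_square_integral:
  assumes "- 1/2 < \<beta>" "0 < \<epsilon>"
  shows "integrable lborel (\<lambda>x. (spike \<beta> \<epsilon> (x - p))\<^sup>2)"
    "(\<integral>x. (spike \<beta> \<epsilon> (x - p))\<^sup>2 \<partial>lborel) = \<epsilon> powr (2 * min \<beta> 0 + 1) / (2 * min \<beta> 0 + 1)"
proof -
  define c where "c = 2 * min \<beta> 0"
  have c: "-1 < c" using assms by (auto simp: c_def min_def)
  have sq: "(spike \<beta> \<epsilon> x)\<^sup>2 = (if x \<in> {0..\<epsilon>} then x powr c else 0)" for x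
    by (auto simp: spike_def c_def power2_eq_square powr_add[symmetric])
  have "((\<lambda>x. x powr c) has_integral \<epsilon> powr (c + 1) / (c + 1)) {0..\<epsilon>}"
    using c assms by (intro has_integral_powr_from_0) auto
  then have "((\<lambda>x. (spike \<beta> \<epsilon> x)\<^sup>2) has_integral \<epsilon> powr (c + 1) / (c + 1)) UNIV"
    unfolding sq has_integral_restrict_UNIV .
  then have "(\<integral>\<^sup>+x. (spike \<beta> \<epsilon> x)\<^sup>2 \<partial>lborel) = ennreal (\<epsilon> powr (c + 1) / (c + 1))"
    by (intro nn_integral_has_integral_lborel) auto
  then have "has_bochner_integral lborel (\<lambda>x. (spike \<beta> \<epsilon> x)\<^sup>2) (\<epsilon> powr (c + 1) / (c + 1))"
    using c by (intro has_bochner_integral_nn_integral) auto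
  then have "has_bochner_integral lborel (\<lambda>x. (spike \<beta> \<epsilon> (- p + 1 * x))\<^sup>2) (\<epsilon> powr (c + 1) / (c + 1))"
    by (subst (asm) lborel_has_bochner_integral_real_affine_iff[where c=1 and t="- p"]) auto
  then show "integrable lborel (\<lambda>x. (spike \<beta> \<epsilon> (x - p))\<^sup>2)"
    "(\<integral>x. (spike \<beta> \<epsilon> (x - p))\<^sup>2 \<partial>lborel) = \<epsilon> powr (2 * min \<beta> 0 + 1) / (2 * min \<beta> 0 + 1)"
    by (auto simp: has_bochner_integral_iff c_def)
qed

section \<open>Polynomial approximation of truncated powers and of their primitives\<close>

lemma real_polynomial_smooth_primitive:
  assumes "real_polynomial_function f"
  obtains \<Phi> f1 f2 where "smooth_primitive \<Phi> f f1 f2"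
proof -
  obtain a n where f: "f = (\<lambda>x. \<Sum>i\<le>n. a i * x^i)"
    using assms by (auto simp: real_polynomial_function_iff_sum)
  define \<Phi> where "\<Phi> x = (\<Sum>i\<le>n. a i / real (Suc i) * x ^ Suc i)" for x
  have \<Phi>: "(\<Phi> has_real_derivative f x) (at x)" for x
    unfolding \<Phi>_def f
  proof (rule DERIV_sum)
    fix i
    have "((\<lambda>x. a i / real (Suc i) * x ^ Suc i) has_real_derivative a i / real (Suc i) * (real (Suc i) * x ^ i)) (at x)"
      by (intro DERIV_cmult) (use DERIV_pow[of "Suc i" x] in simp)
    then show "((\<lambda>x. a i / real (Suc i) * x ^ Suc i) has_real_derivative a i * x ^ i) (at x)"
      by (simp del: of_nat_Suc)
  qed
  obtain f1 where f1: "real_polynomial_function f1" "\<forall>x. (f has_real_derivative f1 x) (at x)"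
    using has_real_derivative_polynomial_function[OF assms] by blast
  obtain f2 where f2: "real_polynomial_function f2" "\<forall>x. (f1 has_real_derivative f2 x) (at x)"
    using has_real_derivative_polynomial_function[OF f1(1)] by blast
  have "continuous_on UNIV f2"
    using f2(1) by (intro continuous_on_polymonial_function) (simp add: real_polynomial_function_eq)
  then have "smooth_primitive \<Phi> f f1 f2" using \<Phi> f1 f2 by unfold_locales auto
  then show ?thesis by (rule that)
qed

text \<open>A continuous function agrees with the power outside the support of the spike, and
  Weierstrass' theorem on \<open>[-R, R]\<close> replaces it by a polynomial. Polynomials supply the
  primitive and the derivatives that Taylor's formula asks for.\<close>

lemma ppow_approximation:
  assumes "0 < \<epsilon>" "\<epsilon> \<le> 1" "0 < \<delta>"
  obtains \<Phi> f f1 f2 where "smooth_primitive \<Phi> f f1 f2"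
    "\<And>y. \<bar>y\<bar> \<le> R \<Longrightarrow> \<bar>ppow \<beta> (y - p) - f y\<bar> \<le> \<delta> + spike \<beta> \<epsilon> (y - p)"
proof -
  \<comment> \<open>On \<open>[p, p + \<epsilon>]\<close> the power is replaced by the line from 0
    to \<open>\<epsilon> powr \<beta>\<close>: the quotient is the ramp, and
    \<open>max (y - p) \<epsilon>\<close> freezes the power below \<epsilon>.\<close>
  define h where "h y = min (max (y - p) 0) \<epsilon> / \<epsilon> * (max (y - p) \<epsilon>) powr \<beta>" for y
  have "continuous_on {-R..R} h"
    unfolding h_def using assms by (intro continuous_intros) auto
  from Stone_Weierstrass_real_polynomial_function[OF compact_Icc this \<open>0 < \<delta>\<close>]
  obtain f where f: "real_polynomial_function f" "\<And>y. y \<in> {-R..R} \<Longrightarrow> \<bar>h y - f y\<bar> < \<delta>" by blast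
  obtain \<Phi> f1 f2 where s: "smooth_primitive \<Phi> f f1 f2"
    using real_polynomial_smooth_primitive[OF f(1)] by blast
  have close: "\<bar>ppow \<beta> (y - p) - h y\<bar> \<le> spike \<beta> \<epsilon> (y - p)" for y
  proof -
    define x where "x = y - p"
    consider "x \<le> 0" | "\<epsilon> < x" | "0 < x" "x \<le> \<epsilon>" by linarith
    then have "\<bar>ppow \<beta> x - min (max x 0) \<epsilon> / \<epsilon> * (max x \<epsilon>) powr \<beta>\<bar> \<le> spike \<beta> \<epsilon> x"
    proof cases
      case 3
      have le1: "0 \<le> x / \<epsilon>" "x / \<epsilon> \<le> 1" using 3 by auto
      have e: "\<epsilon> powr \<beta> \<le> \<epsilon> / x * x powr (min \<beta> 0)" "x powr \<beta> \<le> x powr (min \<beta> 0)"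
      proof -
        have px: "x powr \<beta> \<le> x powr (min \<beta> 0)" using 3 assms by (intro powr_mono') auto
        then show "x powr \<beta> \<le> x powr (min \<beta> 0)" .
        show "\<epsilon> powr \<beta> \<le> \<epsilon> / x * x powr (min \<beta> 0)"
        proof (cases "\<beta> \<le> 0")
          case True
          then have "\<epsilon> powr \<beta> \<le> x powr \<beta>" using 3 by (intro powr_mono2') auto
          also have "\<dots> = 1 * x powr (min \<beta> 0)" using True by (simp add: min_def)
          also have "\<dots> \<le> \<epsilon> / x * x powr (min \<beta> 0)" using 3 by (intro mult_right_mono) auto
          finally show ?thesis .
        next
          case False
          then have "\<epsilon> powr \<beta> \<le> 1" using assms by (intro powr_le1) auto
          also have "1 \<le> \<epsilon> / x" using 3 by simp
          finally show ?thesis using False 3 by (simp add: min_def)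
        qed
      qed
      define v where "v = x / \<epsilon> * \<epsilon> powr \<beta>"
      have "v \<le> x / \<epsilon> * (\<epsilon> / x * x powr (min \<beta> 0))" unfolding v_def by (rule mult_left_mono[OF e(1) le1(1)])
      also have "\<dots> = x powr (min \<beta> 0)" using 3 assms by simp
      finally have "v \<le> x powr (min \<beta> 0)" .
      moreover have "0 \<le> v" unfolding v_def by (intro mult_nonneg_nonneg le1) simp
      ultimately have "\<bar>x powr \<beta> - v\<bar> \<le> x powr (min \<beta> 0)" using e(2) powr_ge_zero[of x \<beta>] by linarith
      moreover have "ppow \<beta> x - min (max x 0) \<epsilon> / \<epsilon> * (max x \<epsilon>) powr \<beta> = x powr \<beta> - v"
        unfolding v_def using 3 by (simp add: ppow_def max_def min_def)
      moreover have "spike \<beta> \<epsilon> x = x powr (min \<beta> 0)" using 3 by (simp add: spike_def)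
      ultimately show ?thesis by simp
    qed (use assms in \<open>auto simp: ppow_def spike_def max_def min_def\<close>)
    then show ?thesis by (simp add: x_def h_def)
  qed
  show ?thesis
  proof (rule that[OF s])
    fix y assume "\<bar>y\<bar> \<le> R"
    then show "\<bar>ppow \<beta> (y - p) - f y\<bar> \<le> \<delta> + spike \<beta> \<epsilon> (y - p)"
      using close[of y] f(2)[of y] by (auto simp: abs_le_iff)
  qed
qed

lemma ppow_prim_has_derivative:
  assumes "- 1 < \<beta>" "x \<noteq> p"
  shows "((\<lambda>x. ppow_prim \<beta> (x - p)) has_real_derivative ppow \<beta> (x - p)) (at x)"
proof (cases "x < p")
  case True
  have "((\<lambda>_. 0) has_real_derivative ppow \<beta> (x - p)) (at x)" using True by (simp add: ppow_def)
  moreover have "\<forall>\<^sub>F y in nhds x. ppow_prim \<beta> (y - p) = 0"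
    using eventually_nhds_in_open[of "{..<p}" x] True
    by (auto elim!: eventually_mono simp: ppow_prim_def max_def)
  ultimately show ?thesis by (subst DERIV_cong_ev[OF refl _ refl])
next
  case False
  with assms have "p < x" by simp
  then have "((\<lambda>y. (y - p) powr (\<beta> + 1) / (\<beta> + 1)) has_real_derivative ppow \<beta> (x - p)) (at x)"
    using assms by (auto intro!: derivative_eq_intros simp: ppow_def)
  moreover have "\<forall>\<^sub>F y in nhds x. y \<in> {p<..}" using \<open>p < x\<close> by (intro eventually_nhds_in_open) auto
  then have "\<forall>\<^sub>F y in nhds x. ppow_prim \<beta> (y - p) = (y - p) powr (\<beta> + 1) / (\<beta> + 1)"
    by eventually_elim (auto simp: ppow_prim_def max_def)
  ultimately show ?thesis by (subst DERIV_cong_ev[OF refl _ refl])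
qed

text \<open>The primitive is continuous and its derivative can be missing only at \<open>p\<close>,
  so the fundamental theorem holds across the singularity even if the integrand is unbounded
  there.\<close>

lemma ppow_has_integral:
  assumes "- 1 < \<beta>" "x \<le> y"
  shows "((\<lambda>z. ppow \<beta> (z - p)) has_integral (ppow_prim \<beta> (y - p) - ppow_prim \<beta> (x - p))) {x..y}"
proof (rule fundamental_theorem_of_calculus_interior_strong[of "{p}"])
  show "continuous_on {x..y} (\<lambda>z. ppow_prim \<beta> (z - p))"
    using ppow_prim_continuous[OF assms(1), of p] by (rule continuous_on_subset) simp
  show "((\<lambda>z. ppow_prim \<beta> (z - p)) has_vector_derivative ppow \<beta> (z - p)) (at z)" if "z \<in> {x<..<y} - {p}" for z
    using ppow_prim_has_derivative[OF assms(1), of z p] that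
    by (auto simp: has_real_derivative_iff_has_vector_derivative)
qed (use assms in auto)

lemma spike_has_integral:
  assumes "- 1 < \<beta>" "x \<le> y" "0 < \<epsilon>"
  obtains I where "((\<lambda>z. spike \<beta> \<epsilon> (z - p)) has_integral I) {x..y}"
    "I \<le> \<epsilon> powr (min \<beta> 0 + 1) / (min \<beta> 0 + 1)"
proof -
  define c where "c = min \<beta> 0"
  have c: "- 1 < c" using assms by (auto simp: c_def min_def)
  have "((\<lambda>z. z powr c) has_integral \<epsilon> powr (c + 1) / (c + 1)) {0..\<epsilon>}"
    using c assms by (intro has_integral_powr_from_0) auto
  from has_integral_affinity'[OF this[unfolded box_real(2)[symmetric]], of 1 "- p"]
  have "((\<lambda>z. (z - p) powr c) has_integral \<epsilon> powr (c + 1) / (c + 1)) {p..p + \<epsilon>}" by (simp add: add.commute)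
  then have "((\<lambda>z. if z \<in> {p..p + \<epsilon>} then (z - p) powr c else 0) has_integral \<epsilon> powr (c + 1) / (c + 1)) UNIV"
    unfolding has_integral_restrict_UNIV .
  moreover have "(\<lambda>z. if z \<in> {p..p + \<epsilon>} then (z - p) powr c else 0) = (\<lambda>z. spike \<beta> \<epsilon> (z - p))"
    by (auto simp: fun_eq_iff spike_def c_def)
  ultimately have U: "((\<lambda>z. spike \<beta> \<epsilon> (z - p)) has_integral \<epsilon> powr (c + 1) / (c + 1)) UNIV" by simp
  then have i: "(\<lambda>z. spike \<beta> \<epsilon> (z - p)) integrable_on {x..y}"
    by (intro integrable_on_subinterval[OF has_integral_integrable[OF U]]) auto
  have "integral {x..y} (\<lambda>z. spike \<beta> \<epsilon> (z - p)) \<le> integral UNIV (\<lambda>z. spike \<beta> \<epsilon> (z - p))"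
    using i U by (intro integral_subset_le) (auto simp: spike_nonneg)
  then have "integral {x..y} (\<lambda>z. spike \<beta> \<epsilon> (z - p)) \<le> \<epsilon> powr (min \<beta> 0 + 1) / (min \<beta> 0 + 1)"
    using integral_unique[OF U] by (simp add: c_def)
  with integrable_integral[OF i] show ?thesis by (rule that)
qed

text \<open>Integrate \<open>close\<close> between 0 and \<open>y\<close>. The spike contributes at
  most its full integral, which is small with \<epsilon>; so the primitives are uniformly close
  although the integrands need not be.\<close>

lemma (in smooth_primitive) ppow_prim_approximation:
  assumes "- 1 < \<beta>" "0 < \<epsilon>" "0 \<le> \<delta>"
    and close: "\<And>y. \<bar>y\<bar> \<le> R \<Longrightarrow> \<bar>ppow \<beta> (y - p) - f y\<bar> \<le> \<delta> + spike \<beta> \<epsilon> (y - p)" and "\<bar>y\<bar> \<le> R"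
  shows "\<bar>(ppow_prim \<beta> (y - p) - ppow_prim \<beta> (0 - p)) - (\<Phi> y - \<Phi> 0)\<bar> \<le>
    R * \<delta> + \<epsilon> powr (min \<beta> 0 + 1) / (min \<beta> 0 + 1)"
proof -
  have *: "\<bar>(ppow_prim \<beta> (v - p) - ppow_prim \<beta> (u - p)) - (\<Phi> v - \<Phi> u)\<bar> \<le>
      (v - u) * \<delta> + \<epsilon> powr (min \<beta> 0 + 1) / (min \<beta> 0 + 1)"
    if uv: "u \<le> v" "- R \<le> u" "v \<le> R" for u v
  proof -
    obtain I where I: "((\<lambda>z. spike \<beta> \<epsilon> (z - p)) has_integral I) {u..v}"
      "I \<le> \<epsilon> powr (min \<beta> 0 + 1) / (min \<beta> 0 + 1)"
      by (rule spike_has_integral[OF assms(1) uv(1) assms(2)])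
    have "(f has_integral (\<Phi> v - \<Phi> u)) {u..v}"
      using uv(1) \<Phi> by (intro fundamental_theorem_of_calculus)
        (auto simp: has_real_derivative_iff_has_vector_derivative[symmetric] intro: has_field_derivative_at_within)
    from has_integral_diff[OF ppow_has_integral[OF assms(1) uv(1), of p] this]
    have d: "((\<lambda>z. ppow \<beta> (z - p) - f z) has_integral
        (ppow_prim \<beta> (v - p) - ppow_prim \<beta> (u - p)) - (\<Phi> v - \<Phi> u)) {u..v}" .
    have b: "((\<lambda>z. \<delta> + spike \<beta> \<epsilon> (z - p)) has_integral (v - u) * \<delta> + I) {u..v}"
      using has_integral_add[OF has_integral_const_real[of \<delta> u v] I(1)] uv(1) by simp
    have "norm (integral {u..v} (\<lambda>z. ppow \<beta> (z - p) - f z)) \<le> integral {u..v} (\<lambda>z. \<delta> + spike \<beta> \<epsilon> (z - p))"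
      using d b uv close by (intro integral_norm_bound_integral) (auto simp: abs_le_iff)
    then show ?thesis using I(2) integral_unique[OF d] integral_unique[OF b] by simp
  qed
  have R\<delta>: "\<bar>y\<bar> * \<delta> \<le> R * \<delta>" using assms by (intro mult_right_mono) auto
  show ?thesis
  proof (cases "0 \<le> y")
    case True
    then show ?thesis using *[of 0 y] R\<delta> \<open>\<bar>y\<bar> \<le> R\<close> by simp
  next
    case False
    then show ?thesis using *[of y 0] R\<delta> \<open>\<bar>y\<bar> \<le> R\<close> by (simp add: abs_if split: if_splits)
  qed
qed

lemma sum_from_0:
  "(\<Sum>k<N. a k) = (if N = 0 then 0 else a 0 + (\<Sum>k\<in>{1..<N}. a k))" for a :: "nat \<Rightarrow> real"
  by (cases N) (simp_all add: lessThan_Suc_atMost sum.atLeast_Suc_atMost[of 0] atLeast0AtMost[symmetric]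
      atLeastLessThanSuc_atLeastAtMost)

section \<open>Mean square of the spike at left end points\<close>

context partitioned_brownian_motion
begin

abbreviation spike_mean :: "real \<Rightarrow> real \<Rightarrow> real \<Rightarrow> nat \<Rightarrow> nat \<Rightarrow> real" where
  "spike_mean \<beta> \<epsilon> p n k \<equiv> \<integral>\<omega>. (spike \<beta> \<epsilon> (Bn n k \<omega> - p))\<^sup>2 \<partial>M"

text \<open>The three cases are those in which, at left end points, the density of \<open>B\<close> is bounded near \<open>p\<close>,
  the bounded ratio replaces left by right end points, or the spike is bounded.\<close>

lemma spike_sums_small_aux:
  assumes \<beta>: "- 1/2 < \<beta>" and sing: "\<beta> < 0 \<Longrightarrow> p = 0 \<Longrightarrow> bounded_ratio D" and "0 \<le> T" "0 < \<tau>"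
  shows "\<forall>\<^sub>F \<epsilon> in at_right 0. \<forall>\<^sub>F n in sequentially.
    (\<Sum>k\<in>{1..<part_index D n T}. (spike_mean \<beta> \<epsilon> p n k) * (dt n k)) \<le> \<tau>"
proof -
  define c where "c = 2 * min \<beta> 0 + 1"
  have c: "0 < c" using \<beta> by (auto simp: c_def min_def)
  have q0: "((\<lambda>\<epsilon>. C * (\<epsilon> powr c / c)) \<longlongrightarrow> 0) (at_right 0)" for C :: real
  proof -
    have "((\<lambda>\<epsilon>::real. \<epsilon> powr c) \<longlongrightarrow> 0) (at_right 0)" using c by real_asymp
    then have "((\<lambda>\<epsilon>. C * (\<epsilon> powr c / c)) \<longlongrightarrow> C * (0 / c)) (at_right 0)" by (intro tendsto_intros) (use c in auto)
    then show ?thesis by simp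
  qed
  have small: "\<forall>\<^sub>F \<epsilon> in at_right 0. C * (\<epsilon> powr c / c) < \<tau>" for C
    using order_tendstoD(2)[OF q0 \<open>0 < \<tau>\<close>] .
  have pos: "\<forall>\<^sub>F \<epsilon> in at_right (0::real). 0 < \<epsilon>" by (simp add: eventually_at_right_less)
  have tpos: "0 < D n k" if "1 \<le> k" for n k
    using strict_monoD[OF partition_strict_mono[OF D], of 0 k n] partition_0[OF D, of n] that by simp
  have step: "0 \<le> dt n k" for n k using partition_Suc[OF D, of n k] by simp
  have tot: "(\<Sum>k\<in>{1..<N}. dt n k) \<le> D n N" for n N
  proof -
    have "(\<Sum>k\<in>{1..<N}. dt n k) \<le> (\<Sum>k<N. dt n k)"
      using step by (intro sum_mono2) auto
    also have "\<dots> = D n N" using partition_0[OF D, of n] by (simp add: sum_increments)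
    finally show ?thesis .
  qed
  have E: "integrable lborel (\<lambda>x. (spike \<beta> \<epsilon> (x - p))\<^sup>2)"
    "(\<integral>x. (spike \<beta> \<epsilon> (x - p))\<^sup>2 \<partial>lborel) = \<epsilon> powr c / c"
    "1 \<le> k \<Longrightarrow> (spike_mean \<beta> \<epsilon> p n k) \<le> (\<epsilon> powr c / c) / sqrt (D n k)"
    if "0 < \<epsilon>" for \<epsilon> n k
  proof -
    show i: "integrable lborel (\<lambda>x. (spike \<beta> \<epsilon> (x - p))\<^sup>2)"
      and e: "(\<integral>x. (spike \<beta> \<epsilon> (x - p))\<^sup>2 \<partial>lborel) = \<epsilon> powr c / c"
      using spike_square_integral[OF \<beta> that, of p] by (simp_all add: c_def)
    show "(spike_mean \<beta> \<epsilon> p n k) \<le> (\<epsilon> powr c / c) / sqrt (D n k)" if "1 \<le> k"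
      using expectation_B_le_sqrt(2)[OF tpos[OF that], of "\<lambda>x. (spike \<beta> \<epsilon> (x - p))\<^sup>2" n] i e by simp
  qed
  consider "p \<noteq> 0" | "p = 0" "\<beta> < 0" | "p = 0" "0 \<le> \<beta>" by linarith
  then show ?thesis
  proof cases
    \<comment> \<open>The spike lives on \<open>(p, p + \<epsilon>]\<close>. For \<epsilon> below
      \<open>\<bar>p\<bar> / 2\<close> this keeps the distance \<open>\<bar>p\<bar> / 2\<close> from
      0, so the density bound there is uniform in time.\<close>
    case 1
    have "\<forall>\<^sub>F \<epsilon> in at_right 0. \<epsilon> < \<bar>p\<bar> / 2" using order_tendstoD(2)[OF tendsto_ident_at[of 0 "{0<..}"], of "\<bar>p\<bar> / 2"] 1 by simp
    from this small[of "2 * (T + 1) / \<bar>p\<bar>"] pos show ?thesis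
    proof eventually_elim
      case (elim \<epsilon>)
      show ?case using partition_mesh[OF D zero_less_one]
      proof eventually_elim
        case (elim n)
        let ?N = "part_index D n T"
        have le: "(spike_mean \<beta> \<epsilon> p n k) \<le> (\<epsilon> powr c / c) / (\<bar>p\<bar> / 2)" if "1 \<le> k" for k
        proof -
          have "spike \<beta> \<epsilon> (x - p) = 0" if "\<bar>x\<bar> < \<bar>p\<bar> / 2" for x
            using that \<open>\<epsilon> < \<bar>p\<bar> / 2\<close> unfolding spike_def by (simp add: abs_if split: if_splits)
          then show ?thesis
            using expectation_B_le_away_from_0[OF tpos[OF that], of "\<lambda>x. (spike \<beta> \<epsilon> (x - p))\<^sup>2" "\<bar>p\<bar> / 2" n]
              1 E(1,2)[OF \<open>0 < \<epsilon>\<close>] by simp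
        qed
        have "(\<Sum>k\<in>{1..<?N}. (spike_mean \<beta> \<epsilon> p n k) * (dt n k)) \<le>
            (\<Sum>k\<in>{1..<?N}. (\<epsilon> powr c / c) / (\<bar>p\<bar> / 2) * (dt n k))"
          using le step by (intro sum_mono mult_right_mono) auto
        also have "\<dots> = (\<epsilon> powr c / c) / (\<bar>p\<bar> / 2) * (\<Sum>k\<in>{1..<?N}. dt n k)"
          by (simp only: sum_distrib_left)
        also have "\<dots> \<le> (\<epsilon> powr c / c) / (\<bar>p\<bar> / 2) * (T + 1)"
          using tot[of n ?N] part_index_range(2)[of T n ?N] elim \<open>0 \<le> T\<close> c
          by (intro mult_left_mono) (auto intro!: divide_nonneg_nonneg)
        also have "\<dots> = 2 * (T + 1) / \<bar>p\<bar> * (\<epsilon> powr c / c)" using 1 c by (simp add: field_simps)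
        finally show ?case using \<open>2 * (T + 1) / \<bar>p\<bar> * (\<epsilon> powr c / c) < \<tau>\<close> by linarith
      qed
    qed
  next
    case 2
    then obtain K0 where "\<And>n k. 1 \<le> k \<Longrightarrow> D n (Suc k) \<le> K0 * D n k" using sing by (auto simp: bounded_ratio_def)
    then have K: "\<And>n k. 1 \<le> k \<Longrightarrow> D n (Suc k) \<le> max 0 K0 * D n k"
      using tpos by (smt (verit) mult_right_mono)
    define K where "K = max 0 K0"
    from small[of "2 * sqrt K * sqrt (T + 1)"] pos show ?thesis
    proof eventually_elim
      case (elim \<epsilon>)
      show ?case using partition_mesh[OF D zero_less_one]
      proof eventually_elim
        case (elim n)
        let ?N = "part_index D n T"
        have "(\<Sum>k\<in>{1..<?N}. (spike_mean \<beta> \<epsilon> p n k) * (dt n k)) \<le>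
            (\<Sum>k\<in>{1..<?N}. (\<epsilon> powr c / c) / sqrt (D n k) * (dt n k))"
          using E(3)[OF \<open>0 < \<epsilon>\<close>] step by (intro sum_mono mult_right_mono) auto
        also have "\<dots> = (\<epsilon> powr c / c) * (\<Sum>k\<in>{1..<?N}. (dt n k) / sqrt (D n k))"
          by (simp add: sum_distrib_left)
        also have "\<dots> \<le> (\<epsilon> powr c / c) * (2 * sqrt K * sqrt (D n ?N))"
          using partition_facts K c by (intro mult_left_mono sum_increments_over_sqrt_left) (auto simp: K_def)
        also have "\<dots> \<le> (\<epsilon> powr c / c) * (2 * sqrt K * sqrt (T + 1))"
          using part_index_range(2)[of T n ?N] elim \<open>0 \<le> T\<close> c by (intro mult_left_mono) (auto simp: K_def)
        also have "\<dots> = 2 * sqrt K * sqrt (T + 1) * (\<epsilon> powr c / c)" by (rule mult.commute)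
        finally show ?case using \<open>2 * sqrt K * sqrt (T + 1) * (\<epsilon> powr c / c) < \<tau>\<close> by linarith
      qed
    qed
  next
    case 3
    \<comment> \<open>Steps that begin before \<open>d\<close> have total length at most
      \<open>2 * d\<close>, which is half of \<tau>, and the spike is at most 1 there; from time
      \<open>d\<close> on the density is at most \<open>1 / sqrt d\<close>.\<close>
    define d where "d = \<tau> / 4"
    have d: "0 < d" using \<open>0 < \<tau>\<close> by (simp add: d_def)
    have "\<forall>\<^sub>F \<epsilon> in at_right 0. (T + 1) / sqrt d * (\<epsilon> powr c / c) < \<tau> / 2"
      using order_tendstoD(2)[OF q0, of "\<tau>/2" "(T + 1) / sqrt d"] \<open>0 < \<tau>\<close> by simp
    from this pos show ?thesis
    proof eventually_elim
      case (elim \<epsilon>)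
      show ?case using partition_mesh[OF D zero_less_one] partition_mesh[OF D d]
      proof eventually_elim
        case (elim n)
        let ?N = "part_index D n T" and ?e = "\<lambda>k. spike_mean \<beta> \<epsilon> p n k"
        define q where "q = \<epsilon> powr c / c"
        have q: "0 \<le> q" using c by (simp add: q_def)
        have Bm[measurable]: "Bn n k \<in> borel_measurable M" for k using partition_nonneg[OF D] by (rule B_measurable)
        have e1: "?e k \<le> 1" for k
        proof -
          have le1: "(spike \<beta> \<epsilon> x)\<^sup>2 \<le> 1" for x using 3 by (auto simp: spike_def min_def)
          then have "integrable M (\<lambda>\<omega>. (spike \<beta> \<epsilon> (Bn n k \<omega> - p))\<^sup>2)"
            by (intro integrable_const_bound[where B=1]) auto
          then have "?e k \<le> (\<integral>\<omega>. 1 \<partial>M)" using le1 by (intro integral_mono) auto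
          then show ?thesis by (simp add: prob_space)
        qed
        have e2: "?e k \<le> q / sqrt d" if "1 \<le> k" "d \<le> D n k" for k
        proof -
          have "q / sqrt (D n k) \<le> q / sqrt d" using that d q tpos[OF that(1), of n] by (intro divide_left_mono) auto
          then show ?thesis using E(3)[OF \<open>0 < \<epsilon>\<close> that(1), of n] by (simp add: q_def)
        qed
        have "(\<Sum>k\<in>{1..<?N}. ?e k * (dt n k)) \<le>
            (\<Sum>k\<in>{1..<?N}. (if D n k < d then dt n k else 0) + q / sqrt d * (dt n k))"
        proof (rule sum_mono)
          fix k assume "k \<in> {1..<?N}"
          then have k: "1 \<le> k" by simp
          show "?e k * (dt n k) \<le>
              (if D n k < d then dt n k else 0) + q / sqrt d * (dt n k)"
          proof (cases "D n k < d")
            case True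
            have "?e k * (dt n k) \<le> 1 * (dt n k)" using e1 step by (rule mult_right_mono)
            moreover have "0 \<le> q / sqrt d * (dt n k)" using q d step[of n k] by simp
            ultimately show ?thesis using True by simp
          next
            case False
            then show ?thesis using mult_right_mono[OF e2[OF k] step[of n k]] by simp
          qed
        qed
        also have "\<dots> = (\<Sum>k\<in>{1..<?N}. if D n k < d then dt n k else 0) +
            q / sqrt d * (\<Sum>k\<in>{1..<?N}. dt n k)"
          by (simp only: sum.distrib sum_distrib_left)
        also have "\<dots> \<le> 2 * d + q / sqrt d * (T + 1)"
        proof (rule add_mono)
          have "(\<Sum>k\<in>{1..<?N}. if D n k < d then dt n k else 0) =
              (\<Sum>k\<in>{1..<?N} \<inter> {k. D n k < d}. dt n k)" by (simp add: sum.inter_restrict)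
          also have "\<dots> \<le> (\<Sum>k<part_index D n d. dt n k)"
            using step before_eq_lessThan[OF D, of n d] by (intro sum_mono2) auto
          also have "\<dots> = D n (part_index D n d)" using partition_0[OF D, of n] by (simp add: sum_increments)
          also have "\<dots> \<le> 2 * d" using part_index_less[OF D, of d n d] d elim by auto
          finally show "(\<Sum>k\<in>{1..<?N}. if D n k < d then dt n k else 0) \<le> 2 * d" .
          show "q / sqrt d * (\<Sum>k\<in>{1..<?N}. dt n k) \<le> q / sqrt d * (T + 1)"
            using tot[of n ?N] part_index_range(2)[of T n ?N] elim \<open>0 \<le> T\<close> q d by (intro mult_left_mono) auto
        qed
        also have "\<dots> = \<tau> / 2 + (T + 1) / sqrt d * (\<epsilon> powr c / c)" by (simp add: d_def q_def algebra_simps)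
        finally show ?case using \<open>(T + 1) / sqrt d * (\<epsilon> powr c / c) < \<tau> / 2\<close> by linarith
      qed
    qed
  qed
qed

text \<open>The term \<open>k = 0\<close> is added. There \<open>B\<close> is 0 and has no density,
  so the term is the constant \<open>s\<close> times the first step. As \<open>s\<close> depends on
  \<epsilon>, the partition is refined only after \<epsilon> is fixed.\<close>

lemma spike_sums_small:
  assumes \<beta>: "- 1/2 < \<beta>" and sing: "\<beta> < 0 \<Longrightarrow> p = 0 \<Longrightarrow> bounded_ratio D" and "0 \<le> T" "0 < \<tau>"
  shows "\<forall>\<^sub>F \<epsilon> in at_right 0. \<forall>\<^sub>F n in sequentially.
    (\<Sum>k<part_index D n T. (spike_mean \<beta> \<epsilon> p n k) * (dt n k)) \<le> \<tau>"
proof -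
  have \<tau>2: "0 < \<tau> / 2" using \<open>0 < \<tau>\<close> by simp
  have "\<forall>\<^sub>F \<epsilon> in at_right 0. \<forall>\<^sub>F n in sequentially.
    (\<Sum>k\<in>{1..<part_index D n T}. (spike_mean \<beta> \<epsilon> p n k) * (dt n k)) \<le> \<tau> / 2"
    by (rule spike_sums_small_aux[OF \<beta> _ \<open>0 \<le> T\<close> \<tau>2]) (rule sing)
  then show ?thesis
  proof eventually_elim
    case (elim \<epsilon>)
    define s where "s = (spike \<beta> \<epsilon> (- p))\<^sup>2"
    have "0 < \<tau> / 2 / (s + 1)" using \<tau>2 by (auto simp: s_def intro!: divide_pos_pos add_nonneg_pos)
    from partition_mesh[OF D this] elim show ?case
    proof eventually_elim
      case (elim n)
      let ?e = "\<lambda>k. (spike_mean \<beta> \<epsilon> p n k) * (dt n k)"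
      have "(\<integral>\<omega>. (spike \<beta> \<epsilon> (Bn n 0 \<omega> - p))\<^sup>2 \<partial>M) = (\<integral>\<omega>. s \<partial>M)"
        using partition_0[OF D, of n] by (intro Bochner_Integration.integral_cong) (auto simp: B_0 s_def)
      then have "?e 0 = s * (D n (Suc 0) - D n 0)" by (simp add: prob_space)
      also have "\<dots> \<le> (s + 1) * (\<tau> / 2 / (s + 1))"
        using elim(1)[rule_format, of 0] partition_Suc[OF D, of n 0] by (intro mult_mono) (auto simp: s_def)
      also have "\<dots> = \<tau> / 2"
        by (subst times_divide_eq_right, rule nonzero_mult_div_cancel_left)
          (use zero_le_power2[of "spike \<beta> \<epsilon> (- p)"] in \<open>simp add: s_def add_nonneg_eq_0_iff\<close>)
      finally show ?case using elim(2) \<tau>2 by (subst sum_from_0) auto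
    qed
  qed
qed

end

section \<open>Riemann sums of truncated powers\<close>

context partitioned_brownian_motion
begin

lemma spike_square_integrable:
  assumes "- 1/2 < \<beta>" "0 < \<epsilon>"
  shows "integrable M (\<lambda>\<omega>. (spike \<beta> \<epsilon> (Bn n k \<omega> - p))\<^sup>2)"
proof (cases "k = 0")
  case True
  then have "integrable M (\<lambda>\<omega>. (spike \<beta> \<epsilon> (Bn n k \<omega> - p))\<^sup>2) \<longleftrightarrow> integrable M (\<lambda>\<omega>. (spike \<beta> \<epsilon> (0 - p))\<^sup>2)"
    using partition_0[OF D, of n] by (intro Bochner_Integration.integrable_cong) (auto simp: B_0)
  then show ?thesis by simp
next
  case False
  then have "0 < D n k"
    using strict_monoD[OF partition_strict_mono[OF D], of 0 k n] partition_0[OF D, of n] by simp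
  then show ?thesis
    using expectation_B_le_sqrt(1)[of "D n k" "\<lambda>x. (spike \<beta> \<epsilon> (x - p))\<^sup>2"] spike_square_integral(1)[OF assms, of p]
    by simp
qed

text \<open>The square of \<open>g\<close> is at most twice the sum of the squares of its two
  bounds. Forward sums are estimated through the means along the partition, in \<open>fw\<close>;
  backward sums only through \<open>e\<close>, a bound on the Lebesgue norm of \<open>g\<close>. The
  term \<open>4 * R * \<delta>\<^sup>2\<close> is the share of the constant bound on
  \<open>[-R, R]\<close>.\<close>

lemma dominated_sums_small:
  assumes \<beta>: "- 1/2 < \<beta>" and \<epsilon>: "0 < \<epsilon>" and \<delta>: "0 < \<delta>" and R: "0 < R" and "0 \<le> T" "0 < l" "0 < e"
    and g[measurable]: "g \<in> borel_measurable borel"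
    and dom: "\<And>y. \<bar>y\<bar> \<le> R \<Longrightarrow> \<bar>g y\<bar> \<le> \<delta> + spike \<beta> \<epsilon> (y - p)" "\<And>y. R < \<bar>y\<bar> \<Longrightarrow> g y = 0"
    and e: "4 * R * \<delta>\<^sup>2 + 2 * (\<epsilon> powr (2 * min \<beta> 0 + 1) / (2 * min \<beta> 0 + 1)) \<le> e\<^sup>2"
    and mesh: "\<And>k. dt n k < 1"
    and fw: "2 * \<delta>\<^sup>2 * (T + 1) + 2 * (\<Sum>k<part_index D n T.
      (spike_mean \<beta> \<epsilon> p n k) * (dt n k)) \<le> \<eta> * l\<^sup>2"
    and bw: "e\<^sup>2 * (2 * sqrt (T + 1)) / l\<^sup>2 + e * (4 * sqrt (sqrt (T + 1))) / l \<le> \<eta>'"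
  shows "off_event M \<eta> (\<lambda>\<omega>. \<forall>j\<le>part_index D n T. \<bar>fwd g n j \<omega>\<bar> < l)"
    "off_event M \<eta>' (\<lambda>\<omega>. \<forall>j\<le>part_index D n T. \<bar>bwd g n j \<omega>\<bar> < 3 * l)"
proof -
  let ?N = "part_index D n T"
  have N: "D n ?N \<le> T + 1" using part_index_range(2)[of T n ?N] assms by auto
  have Bm[measurable]: "Bn n k \<in> borel_measurable M" for k using partition_nonneg[OF D] by (rule B_measurable)
  have sq: "(g y)\<^sup>2 \<le> 2 * \<delta>\<^sup>2 * indicator {-R..R} y + 2 * (spike \<beta> \<epsilon> (y - p))\<^sup>2" for y
  proof (cases "\<bar>y\<bar> \<le> R")
    case True
    have "(g y)\<^sup>2 \<le> (\<delta> + spike \<beta> \<epsilon> (y - p))\<^sup>2" using dom(1)[OF True] by (intro power2_le_iff_abs_le[THEN iffD2]) (auto simp: spike_nonneg \<delta> less_imp_le)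
    also have "\<dots> \<le> 2 * \<delta>\<^sup>2 + 2 * (spike \<beta> \<epsilon> (y - p))\<^sup>2"
      using sum_squares_bound[of \<delta> "spike \<beta> \<epsilon> (y - p)"] by (simp add: power2_sum)
    finally show ?thesis using True by (simp add: indicator_def abs_le_iff)
  next
    case False
    then show ?thesis using dom(2)[of y] by (simp add: indicator_def)
  qed
  note spike = spike_square_integral[OF \<beta> \<epsilon>, of p]
  have dom_int: "integrable lborel (\<lambda>y. 2 * \<delta>\<^sup>2 * indicator {-R..R} y + 2 * (spike \<beta> \<epsilon> (y - p))\<^sup>2)"
    using spike(1)
    by (intro Bochner_Integration.integrable_add integrable_mult_right integrable_real_indicator)
      (auto simp: emeasure_lborel_Icc_eq)
  then have g_int: "integrable lborel (\<lambda>y. (g y)\<^sup>2)"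
    using sq by (rule_tac Bochner_Integration.integrable_bound) (auto intro!: AE_I2 order_trans[OF sq abs_ge_self])
  have "(\<integral>y. (g y)\<^sup>2 \<partial>lborel) \<le> (\<integral>y. 2 * \<delta>\<^sup>2 * indicator {-R..R} y + 2 * (spike \<beta> \<epsilon> (y - p))\<^sup>2 \<partial>lborel)"
    using g_int dom_int sq by (rule integral_mono)
  also have "\<dots> = 2 * \<delta>\<^sup>2 * (2 * R) + 2 * (\<epsilon> powr (2 * min \<beta> 0 + 1) / (2 * min \<beta> 0 + 1))"
    using spike R by simp
  also have "\<dots> \<le> e\<^sup>2" using e by (simp add: algebra_simps)
  finally have g_le: "(\<integral>y. (g y)\<^sup>2 \<partial>lborel) \<le> e\<^sup>2" .
  have gB_le: "(g (Bn n k \<omega>))\<^sup>2 \<le> 2 * \<delta>\<^sup>2 + 2 * (spike \<beta> \<epsilon> (Bn n k \<omega> - p))\<^sup>2" for k \<omega>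
  proof -
    have "2 * \<delta>\<^sup>2 * indicator {-R..R} (Bn n k \<omega>) \<le> 2 * \<delta>\<^sup>2" by (simp add: indicator_def)
    then show ?thesis using sq[of "Bn n k \<omega>"] by linarith
  qed
  have dom_B: "integrable M (\<lambda>\<omega>. 2 * \<delta>\<^sup>2 + 2 * (spike \<beta> \<epsilon> (Bn n k \<omega> - p))\<^sup>2)" for k
    using spike_square_integrable[OF \<beta> \<epsilon>] by simp
  have gB: "integrable M (\<lambda>\<omega>. (g (Bn n k \<omega>))\<^sup>2)" for k
    by (rule Bochner_Integration.integrable_bound[OF dom_B[of k]]) (auto intro!: AE_I2 gB_le)
  have gB_E: "(\<integral>\<omega>. (g (Bn n k \<omega>))\<^sup>2 \<partial>M) \<le> 2 * \<delta>\<^sup>2 + 2 * (spike_mean \<beta> \<epsilon> p n k)" for k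
  proof -
    have "(\<integral>\<omega>. (g (Bn n k \<omega>))\<^sup>2 \<partial>M) \<le> (\<integral>\<omega>. 2 * \<delta>\<^sup>2 + 2 * (spike \<beta> \<epsilon> (Bn n k \<omega> - p))\<^sup>2 \<partial>M)"
      using gB dom_B gB_le by (rule integral_mono)
    then show ?thesis using spike_square_integrable[OF \<beta> \<epsilon>] by (simp add: prob_space)
  qed
  have step: "0 \<le> dt n k" for k using partition_Suc[OF D, of n k] by simp
  have "(\<Sum>k<?N. (\<integral>\<omega>. (g (Bn n k \<omega>))\<^sup>2 \<partial>M) * (dt n k)) \<le>
      (\<Sum>k<?N. (2 * \<delta>\<^sup>2 + 2 * (spike_mean \<beta> \<epsilon> p n k)) * (dt n k))"
    using gB_E step by (intro sum_mono mult_right_mono) auto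
  also have "\<dots> = 2 * \<delta>\<^sup>2 * (\<Sum>k<?N. dt n k) +
      2 * (\<Sum>k<?N. (spike_mean \<beta> \<epsilon> p n k) * (dt n k))"
    by (simp only: sum_distrib_left sum.distrib distrib_right mult.assoc)
  also have "\<dots> \<le> 2 * \<delta>\<^sup>2 * (T + 1) + 2 * (\<Sum>k<?N. (spike_mean \<beta> \<epsilon> p n k) * (dt n k))"
    using N partition_0[OF D, of n] by (intro add_right_mono mult_left_mono) (auto simp: sum_increments)
  also note fw
  finally have "(\<Sum>k<?N. (\<integral>\<omega>. (g (Bn n k \<omega>))\<^sup>2 \<partial>M) * (dt n k)) / l\<^sup>2 \<le> \<eta>"
    using \<open>0 < l\<close> by (simp add: field_simps)
  with forward_maximal[where t="D n" and N="?N", OF partition_strict_mono[OF D] partition_0[OF D] g gB \<open>0 < l\<close>]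
  show "off_event M \<eta> (\<lambda>\<omega>. \<forall>j\<le>?N. \<bar>fwd g n j \<omega>\<bar> < l)"
    unfolding fwd_def dB_def by (rule off_event_weaken)
  have "e\<^sup>2 * (2 * sqrt (D n ?N)) / l\<^sup>2 + e * (4 * sqrt (sqrt (D n ?N))) / l \<le>
      e\<^sup>2 * (2 * sqrt (T + 1)) / l\<^sup>2 + e * (4 * sqrt (sqrt (T + 1))) / l"
    using N assms by (intro add_mono divide_right_mono mult_left_mono) auto
  also note bw
  finally have "e\<^sup>2 * (2 * sqrt (D n ?N)) / l\<^sup>2 + e * (4 * sqrt (sqrt (D n ?N))) / l \<le> \<eta>'" .
  with backward_maximal[where t="D n" and N="?N", OF partition_strict_mono[OF D] partition_0[OF D] g g_int g_le \<open>0 < e\<close> \<open>0 < l\<close>]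
  show "off_event M \<eta>' (\<lambda>\<omega>. \<forall>j\<le>?N. \<bar>bwd g n j \<omega>\<bar> < 3 * l)"
    unfolding bwd_def dB_def by (rule off_event_weaken)
qed

text \<open>The choices are made in the order path bound \<open>R\<close>, Lebesgue norm
  \<open>e\<close>, spike width \<epsilon>, uniform error \<delta>, polynomial, and finally
  \<open>n\<close>. In particular one polynomial serves all large \<open>n\<close>.\<close>

lemma ppow_sums_approximation:
  assumes \<beta>: "- 1/2 < \<beta>" and sing: "\<beta> < 0 \<Longrightarrow> p = 0 \<Longrightarrow> bounded_ratio D"
    and "0 \<le> T" "0 < \<tau>" "0 < \<eta>"
  obtains \<Phi> f f1 f2 where "smooth_primitive \<Phi> f f1 f2"
    "\<forall>\<^sub>F n in sequentially. off_event M \<eta> (\<lambda>\<omega>. sums_close (\<lambda>y. ppow \<beta> (y - p)) (\<lambda>y. ppow_prim \<beta> (y - p)) f \<Phi> \<tau> T n \<omega>)"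
proof -
  define c where "c = 2 * min \<beta> 0 + 1"
  define c' where "c' = min \<beta> 0 + 1"
  have c: "0 < c" "0 < c'" using \<beta> by (auto simp: c_def c'_def min_def)
  \<comment> \<open>The backward sums come with the bound \<open>3 * l\<close>.\<close>
  define l where "l = \<tau> / 3"
  have l: "0 < l" using \<open>0 < \<tau>\<close> by (simp add: l_def)
  obtain R where R: "0 < R" "off_event M (\<eta>/4) (\<lambda>\<omega>. \<forall>s\<in>{0..T + 1}. \<bar>B s \<omega>\<bar> \<le> R)"
    using path_bounded[of "T + 1" "\<eta>/4"] assms by auto
  have id0: "((\<lambda>x::real. x) \<longlongrightarrow> 0) (at_right 0)" by (rule tendsto_ident_at)
  have "((\<lambda>e. e\<^sup>2 * (2 * sqrt (T + 1)) / l\<^sup>2 + e * (4 * sqrt (sqrt (T + 1))) / l) \<longlongrightarrow>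
      0\<^sup>2 * (2 * sqrt (T + 1)) / l\<^sup>2 + 0 * (4 * sqrt (sqrt (T + 1))) / l) (at_right 0)"
    by (intro tendsto_intros id0) (use l in auto)
  then have "\<forall>\<^sub>F e in at_right 0. e\<^sup>2 * (2 * sqrt (T + 1)) / l\<^sup>2 + e * (4 * sqrt (sqrt (T + 1))) / l < \<eta>/4"
    using \<open>0 < \<eta>\<close> by (intro order_tendstoD) auto
  moreover have pos: "\<forall>\<^sub>F e in at_right (0::real). 0 < e" by (simp add: eventually_at_right_less)
  ultimately have "\<forall>\<^sub>F e in at_right 0. e\<^sup>2 * (2 * sqrt (T + 1)) / l\<^sup>2 + e * (4 * sqrt (sqrt (T + 1))) / l < \<eta>/4 \<and> 0 < e"
    by (rule eventually_conj)
  then obtain e where e: "0 < e" "e\<^sup>2 * (2 * sqrt (T + 1)) / l\<^sup>2 + e * (4 * sqrt (sqrt (T + 1))) / l < \<eta>/4"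
    using eventually_happens[of _ "at_right (0::real)"] by (auto simp: trivial_limit_at_right_real)
  have p0: "((\<lambda>\<epsilon>::real. \<epsilon> powr a / a) \<longlongrightarrow> 0) (at_right 0)" if "0 < a" for a
  proof -
    have "((\<lambda>\<epsilon>::real. \<epsilon> powr a) \<longlongrightarrow> 0) (at_right 0)" using that by real_asymp
    then have "((\<lambda>\<epsilon>. \<epsilon> powr a / a) \<longlongrightarrow> 0 / a) (at_right 0)" by (intro tendsto_intros) (use that in auto)
    then show ?thesis by simp
  qed
  define S where "S \<epsilon> n = (\<Sum>k<part_index D n T. (spike_mean \<beta> \<epsilon> p n k) * (dt n k))" for \<epsilon> n
  have "\<forall>\<^sub>F \<epsilon> in at_right 0. \<epsilon> powr c / c < e\<^sup>2 / 4" by (rule order_tendstoD(2)[OF p0[OF c(1)]]) (use e(1) in simp)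
  moreover have "\<forall>\<^sub>F \<epsilon> in at_right 0. \<epsilon> powr c' / c' < \<tau> / 2" by (rule order_tendstoD(2)[OF p0[OF c(2)]]) (use \<open>0 < \<tau>\<close> in simp)
  moreover have "\<forall>\<^sub>F \<epsilon> in at_right (0::real). \<epsilon> < 1" using order_tendstoD(2)[OF id0] by simp
  moreover have "\<forall>\<^sub>F \<epsilon> in at_right 0. \<forall>\<^sub>F n in sequentially. S \<epsilon> n \<le> \<eta> * l\<^sup>2 / 16"
    unfolding S_def by (rule spike_sums_small[OF \<beta> _ \<open>0 \<le> T\<close>]) (use sing \<open>0 < \<eta>\<close> l in auto)
  ultimately have "\<forall>\<^sub>F \<epsilon> in at_right 0. \<epsilon> powr c / c < e\<^sup>2 / 4 \<and> \<epsilon> powr c' / c' < \<tau> / 2 \<and> \<epsilon> < 1 \<and>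
      (\<forall>\<^sub>F n in sequentially. S \<epsilon> n \<le> \<eta> * l\<^sup>2 / 16) \<and> 0 < \<epsilon>"
    using pos by (intro eventually_conj)
  then obtain \<epsilon> where \<epsilon>: "\<epsilon> powr c / c < e\<^sup>2 / 4" "\<epsilon> powr c' / c' < \<tau> / 2" "\<epsilon> < 1" "0 < \<epsilon>"
    and S: "\<forall>\<^sub>F n in sequentially. S \<epsilon> n \<le> \<eta> * l\<^sup>2 / 16"
    using eventually_happens[of _ "at_right (0::real)"] by (auto simp: trivial_limit_at_right_real)
  have lim: "((\<lambda>\<delta>. 4 * R * \<delta>\<^sup>2) \<longlongrightarrow> 4 * R * 0\<^sup>2) (at_right 0)" "((\<lambda>\<delta>. R * \<delta>) \<longlongrightarrow> R * 0) (at_right 0)"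
    "((\<lambda>\<delta>. 2 * \<delta>\<^sup>2 * (T + 1)) \<longlongrightarrow> 2 * 0\<^sup>2 * (T + 1)) (at_right 0)"
    by (intro tendsto_intros id0)+
  have "\<forall>\<^sub>F \<delta> in at_right 0. 4 * R * \<delta>\<^sup>2 < e\<^sup>2 / 2" by (rule order_tendstoD(2)[OF lim(1)]) (use e(1) in simp)
  moreover have "\<forall>\<^sub>F \<delta> in at_right 0. R * \<delta> < \<tau> / 2" by (rule order_tendstoD(2)[OF lim(2)]) (use \<open>0 < \<tau>\<close> in simp)
  moreover have "\<forall>\<^sub>F \<delta> in at_right 0. 2 * \<delta>\<^sup>2 * (T + 1) < \<eta> * l\<^sup>2 / 8"
    by (rule order_tendstoD(2)[OF lim(3)]) (use \<open>0 < \<eta>\<close> l in simp)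
  ultimately have "\<forall>\<^sub>F \<delta> in at_right 0. 4 * R * \<delta>\<^sup>2 < e\<^sup>2 / 2 \<and> R * \<delta> < \<tau> / 2 \<and> 2 * \<delta>\<^sup>2 * (T + 1) < \<eta> * l\<^sup>2 / 8 \<and> 0 < \<delta>"
    using pos by (intro eventually_conj)
  then obtain \<delta> where \<delta>: "4 * R * \<delta>\<^sup>2 < e\<^sup>2 / 2" "R * \<delta> < \<tau> / 2" "2 * \<delta>\<^sup>2 * (T + 1) < \<eta> * l\<^sup>2 / 8" "0 < \<delta>"
    using eventually_happens[of _ "at_right (0::real)"] by (auto simp: trivial_limit_at_right_real)
  obtain \<Phi> f f1 f2 where sp: "smooth_primitive \<Phi> f f1 f2"
    and close: "\<And>y. \<bar>y\<bar> \<le> R \<Longrightarrow> \<bar>ppow \<beta> (y - p) - f y\<bar> \<le> \<delta> + spike \<beta> \<epsilon> (y - p)"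
    by (rule ppow_approximation[OF \<epsilon>(4) less_imp_le[OF \<epsilon>(3)] \<delta>(4), of R \<beta> p]) (rule that)
  interpret smooth_primitive \<Phi> f f1 f2 by (rule sp)
  have [measurable]: "f \<in> borel_measurable borel" using continuous(2) by (rule borel_measurable_continuous_onI)
  let ?h = "\<lambda>y. ppow \<beta> (y - p)"
  \<comment> \<open>Cut off outside \<open>[-R, R]\<close>, where the polynomial is not controlled.
    On paths that stay inside, the sums of \<open>g\<close> are the differences of the sums of
    \<open>?h\<close> and \<open>f\<close>.\<close>
  define g where "g y = (if \<bar>y\<bar> \<le> R then ?h y - f y else 0)" for y
  have [measurable]: "g \<in> borel_measurable borel" unfolding g_def by measurable
  from S partition_mesh[OF D zero_less_one]
  have "\<forall>\<^sub>F n in sequentially. off_event M \<eta> (\<lambda>\<omega>. sums_close ?h (\<lambda>y. ppow_prim \<beta> (y - p)) f \<Phi> \<tau> T n \<omega>)"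
  proof eventually_elim
    case (elim n)
    let ?N = "part_index D n T"
    have fw: "2 * \<delta>\<^sup>2 * (T + 1) + 2 * S \<epsilon> n \<le> \<eta>/4 * l\<^sup>2" using elim(1) \<delta>(3) by simp
    have e2: "4 * R * \<delta>\<^sup>2 + 2 * (\<epsilon> powr c / c) \<le> e\<^sup>2" using \<delta>(1) \<epsilon>(1) by linarith
    have sums: "off_event M (\<eta>/4) (\<lambda>\<omega>. \<forall>j\<le>?N. \<bar>fwd g n j \<omega>\<bar> < l)"
      "off_event M (\<eta>/4) (\<lambda>\<omega>. \<forall>j\<le>?N. \<bar>bwd g n j \<omega>\<bar> < 3 * l)"
      using dominated_sums_small[OF \<beta> \<epsilon>(4) \<delta>(4) R(1) \<open>0 \<le> T\<close> l e(1), of g p n "\<eta>/4" "\<eta>/4"]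
        close e2 elim(2) fw e(2) unfolding S_def c_def by (auto simp: g_def)
    show ?case
    proof (rule off_event_mono[OF off_event_conj[OF R(2) off_event_conj[OF sums]]])
      fix \<omega> assume *: "(\<forall>s\<in>{0..T + 1}. \<bar>B s \<omega>\<bar> \<le> R) \<and> (\<forall>j\<le>?N. \<bar>fwd g n j \<omega>\<bar> < l) \<and> (\<forall>j\<le>?N. \<bar>bwd g n j \<omega>\<bar> < 3 * l)"
      have BR: "\<bar>Bn n k \<omega>\<bar> \<le> R" if "k \<le> ?N" for k
        using part_index_range[of T n k] elim(2) assms that * by auto
      show "sums_close ?h (\<lambda>y. ppow_prim \<beta> (y - p)) f \<Phi> \<tau> T n \<omega>"
      proof (intro allI impI)
        fix j assume j: "j \<le> ?N"
        have "fwd ?h n j \<omega> - fwd f n j \<omega> = fwd g n j \<omega>"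
          unfolding fwd_def sum_subtractf[symmetric] using j BR by (intro sum.cong) (auto simp: g_def left_diff_distrib)
        moreover have "bwd ?h n j \<omega> - bwd f n j \<omega> = bwd g n j \<omega>"
          unfolding bwd_def sum_subtractf[symmetric] using j BR by (intro sum.cong) (auto simp: g_def left_diff_distrib)
        moreover have "\<bar>fwd g n j \<omega>\<bar> \<le> \<tau>" "\<bar>bwd g n j \<omega>\<bar> \<le> \<tau>" using * j l by (force simp: l_def)+
        moreover have "\<bar>(ppow_prim \<beta> (Bn n j \<omega> - p) - ppow_prim \<beta> (0 - p)) - (\<Phi> (Bn n j \<omega>) - \<Phi> 0)\<bar> \<le> R * \<delta> + \<epsilon> powr c' / c'"
          unfolding c'_def using \<beta> \<epsilon>(4) \<delta>(4) close BR[OF j] by (intro ppow_prim_approximation) auto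
        moreover have "R * \<delta> + \<epsilon> powr c' / c' \<le> \<tau>" using \<delta>(2) \<epsilon>(2) by linarith
        ultimately show "\<bar>fwd ?h n j \<omega> - fwd f n j \<omega>\<bar> \<le> \<tau> \<and> \<bar>bwd ?h n j \<omega> - bwd f n j \<omega>\<bar> \<le> \<tau> \<and>
          \<bar>(ppow_prim \<beta> (Bn n j \<omega> - p) - ppow_prim \<beta> (0 - p)) - (\<Phi> (Bn n j \<omega>) - \<Phi> 0)\<bar> \<le> \<tau>" by simp
      qed
    qed (use \<open>0 < \<eta>\<close> in simp)
  qed
  from sp this show ?thesis by (rule that)
qed

text \<open>For every accuracy some smooth integrand has forward sums close to these, and its sums
  converge; hence these sums are Cauchy. The smooth integrand changes with the accuracy, so the
  limit is obtained by completeness.\<close>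

lemma ppow_ito_integral:
  assumes \<beta>: "- 1/2 < \<beta>" and sing: "\<beta> < 0 \<Longrightarrow> p = 0 \<Longrightarrow> bounded_ratio D"
  obtains I where "ucp_limit M (\<lambda>n s. fwd (\<lambda>y. ppow \<beta> (y - p)) n (part_index D n s)) I"
proof (rule ucp_complete)
  let ?h = "\<lambda>y. ppow \<beta> (y - p)"
  show "fwd ?h n (part_index D n t) \<in> borel_measurable M" for n t
  proof -
    have [measurable]: "Bn n k \<in> borel_measurable M" for k using partition_nonneg[OF D] by (rule B_measurable)
    show ?thesis unfolding fwd_def dB_def by measurable
  qed
  fix T \<epsilon> \<eta> :: real assume *: "0 \<le> T" "0 < \<epsilon>" "0 < \<eta>"
  have e4: "0 < \<epsilon>/4" "0 < \<eta>/4" using * by auto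
  obtain \<Phi> f f1 f2 where sp: "smooth_primitive \<Phi> f f1 f2"
    and close: "\<forall>\<^sub>F n in sequentially. off_event M (\<eta>/4) (\<lambda>\<omega>. sums_close ?h (\<lambda>y. ppow_prim \<beta> (y - p)) f \<Phi> (\<epsilon>/4) T n \<omega>)"
    using ppow_sums_approximation[OF \<beta> sing *(1) e4] by blast
  interpret smooth_primitive \<Phi> f f1 f2 by (rule sp)
  interpret partitioned_with_primitive M F B D \<Phi> f f1 f2 ..
  from close ito_sums_converge[OF *(1) e4]
  have "\<forall>\<^sub>F n in sequentially. off_event M (\<eta>/2) (\<lambda>\<omega>. \<forall>s\<in>{0..T}.
      \<bar>fwd ?h n (part_index D n s) \<omega> - ito_integral s \<omega>\<bar> \<le> \<epsilon>/2)"
  proof eventually_elim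
    case (elim n)
    show ?case
    proof (rule off_event_mono[OF off_event_conj[OF elim]], simp, rule ballI)
      fix \<omega> s assume **: "(sums_close ?h (\<lambda>y. ppow_prim \<beta> (y - p)) f \<Phi> (\<epsilon>/4) T n \<omega>) \<and>
        (\<forall>s\<in>{0..T}. \<bar>fwd f n (part_index D n s) \<omega> - ito_integral s \<omega>\<bar> \<le> \<epsilon>/4)" and s: "s \<in> {0..T}"
      have "part_index D n s \<le> part_index D n T" using s by (intro part_index_mono[OF D]) auto
      with ** s have "\<bar>fwd ?h n (part_index D n s) \<omega> - fwd f n (part_index D n s) \<omega>\<bar> \<le> \<epsilon>/4"
        "\<bar>fwd f n (part_index D n s) \<omega> - ito_integral s \<omega>\<bar> \<le> \<epsilon>/4" by blast+
      then show "\<bar>fwd ?h n (part_index D n s) \<omega> - ito_integral s \<omega>\<bar> \<le> \<epsilon>/2" by linarith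
    qed
  qed
  then obtain N where N: "\<And>n. N \<le> n \<Longrightarrow> off_event M (\<eta>/2) (\<lambda>\<omega>. \<forall>s\<in>{0..T}.
      \<bar>fwd ?h n (part_index D n s) \<omega> - ito_integral s \<omega>\<bar> \<le> \<epsilon>/2)"
    unfolding eventually_sequentially by blast
  have "off_event M \<eta> (\<lambda>\<omega>. \<forall>s\<in>{0..T}. \<bar>fwd ?h m (part_index D m s) \<omega> - fwd ?h n (part_index D n s) \<omega>\<bar> \<le> \<epsilon>)"
    if "N \<le> m" "N \<le> n" for m n
  proof (rule off_event_mono[OF off_event_conj[OF N[OF that(1)] N[OF that(2)]]], simp, rule ballI)
    fix \<omega> s assume **: "(\<forall>s\<in>{0..T}. \<bar>fwd ?h m (part_index D m s) \<omega> - ito_integral s \<omega>\<bar> \<le> \<epsilon>/2) \<and>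
      (\<forall>s\<in>{0..T}. \<bar>fwd ?h n (part_index D n s) \<omega> - ito_integral s \<omega>\<bar> \<le> \<epsilon>/2)" and s: "s \<in> {0..T}"
    then have "\<bar>fwd ?h m (part_index D m s) \<omega> - ito_integral s \<omega>\<bar> \<le> \<epsilon>/2"
      "\<bar>fwd ?h n (part_index D n s) \<omega> - ito_integral s \<omega>\<bar> \<le> \<epsilon>/2" by blast+
    then show "\<bar>fwd ?h m (part_index D m s) \<omega> - fwd ?h n (part_index D n s) \<omega>\<bar> \<le> \<epsilon>" by linarith
  qed
  then show "\<exists>N. \<forall>m\<ge>N. \<forall>n\<ge>N. off_event M \<eta> (\<lambda>\<omega>. \<forall>s\<in>{0..T}.
      \<bar>fwd ?h m (part_index D m s) \<omega> - fwd ?h n (part_index D n s) \<omega>\<bar> \<le> \<epsilon>)" by blast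
qed (rule that)

text \<open>Four comparisons of \<epsilon>/4 each: singular with smooth sums, smooth sums with
  \<Phi>, \<Phi> with the primitive of the power, and the partition point with \<open>s\<close>. The
  limit is explicit, since trapezoidal sums approximate increments of primitives.\<close>

lemma ppow_trapezoidal_sums:
  assumes \<beta>: "- 1/2 < \<beta>" and sing: "\<beta> < 0 \<Longrightarrow> p = 0 \<Longrightarrow> bounded_ratio D"
  defines "h \<equiv> \<lambda>y. ppow \<beta> (y - p)" and "G \<equiv> \<lambda>y. ppow_prim \<beta> (y - p)"
  shows "ucp_limit M (\<lambda>n s \<omega>. (fwd h n (part_index D n s) \<omega> + bwd h n (part_index D n s) \<omega>) / 2)
    (\<lambda>s \<omega>. G (B s \<omega>) - G 0)"
proof (rule ucp_limitI)
  have G: "continuous_on UNIV G" unfolding G_def using \<beta> by (intro ppow_prim_continuous) simp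
  then have [measurable]: "G \<in> borel_measurable borel" by (rule borel_measurable_continuous_onI)
  show "(\<lambda>\<omega>. G (B t \<omega>) - G 0) \<in> borel_measurable M" if "0 \<le> t" for t
    using B_measurable[OF that] by measurable
  fix T \<epsilon> \<eta> :: real assume *: "0 \<le> T" "0 < \<epsilon>" "0 < \<eta>"
  have e4: "0 < \<epsilon>/4" "0 < \<eta>/4" using * by auto
  obtain \<Phi> f f1 f2 where sp: "smooth_primitive \<Phi> f f1 f2"
    and close: "\<forall>\<^sub>F n in sequentially. off_event M (\<eta>/4) (\<lambda>\<omega>. sums_close h G f \<Phi> (\<epsilon>/4) T n \<omega>)"
    using ppow_sums_approximation[OF \<beta> sing *(1) e4] unfolding h_def G_def by blast
  interpret smooth_primitive \<Phi> f f1 f2 by (rule sp)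
  interpret partitioned_with_primitive M F B D \<Phi> f f1 f2 ..
  from close trapezoidal_sums_converge[OF *(1) e4] primitive_at_partition[OF G *(1) e4]
  show "\<forall>\<^sub>F n in sequentially. off_event M \<eta> (\<lambda>\<omega>. \<forall>s\<in>{0..T}.
      \<bar>(fwd h n (part_index D n s) \<omega> + bwd h n (part_index D n s) \<omega>) / 2 - (G (B s \<omega>) - G 0)\<bar> \<le> \<epsilon>)"
  proof eventually_elim
    case (elim n)
    show ?case
    proof (rule off_event_mono[OF off_event_conj[OF elim(1) off_event_conj[OF elim(2,3)]]], use * in simp, rule ballI)
      fix \<omega> s assume **: "(sums_close h G f \<Phi> (\<epsilon>/4) T n \<omega>) \<and>
        (\<forall>j\<le>part_index D n T. \<bar>(fwd f n j \<omega> + bwd f n j \<omega>) / 2 - (\<Phi> (Bn n j \<omega>) - \<Phi> 0)\<bar> \<le> \<epsilon>/4) \<and>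
        (\<forall>s\<in>{0..T}. \<bar>G (Bn n (part_index D n s) \<omega>) - G (B s \<omega>)\<bar> \<le> \<epsilon>/4)" and s: "s \<in> {0..T}"
      define j where "j = part_index D n s"
      have j: "j \<le> part_index D n T" unfolding j_def using s by (intro part_index_mono[OF D]) auto
      have "\<bar>fwd h n j \<omega> - fwd f n j \<omega>\<bar> \<le> \<epsilon>/4" "\<bar>bwd h n j \<omega> - bwd f n j \<omega>\<bar> \<le> \<epsilon>/4"
        "\<bar>(G (Bn n j \<omega>) - G 0) - (\<Phi> (Bn n j \<omega>) - \<Phi> 0)\<bar> \<le> \<epsilon>/4"
        "\<bar>(fwd f n j \<omega> + bwd f n j \<omega>) / 2 - (\<Phi> (Bn n j \<omega>) - \<Phi> 0)\<bar> \<le> \<epsilon>/4"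
        "\<bar>G (Bn n j \<omega>) - G (B s \<omega>)\<bar> \<le> \<epsilon>/4"
        using ** j s unfolding j_def by blast+
      note b = this
      have "\<bar>(fwd h n j \<omega> + bwd h n j \<omega>) / 2 - (fwd f n j \<omega> + bwd f n j \<omega>) / 2\<bar> \<le> \<epsilon>/4"
        using b(1,2) unfolding abs_le_iff by (auto simp: field_simps)
      moreover have "\<bar>(fwd f n j \<omega> + bwd f n j \<omega>) / 2 - (G (Bn n j \<omega>) - G 0)\<bar> \<le> \<epsilon>/2"
        using b(3,4) by linarith
      ultimately show "\<bar>(fwd h n (part_index D n s) \<omega> + bwd h n (part_index D n s) \<omega>) / 2 - (G (B s \<omega>) - G 0)\<bar> \<le> \<epsilon>"
        using b(5) unfolding j_def[symmetric] by linarith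
    qed
  qed
qed

end

section \<open>The solution\<close>

text \<open>The sign -1 gives the reflected motion, of which the lower branch of the solution is a
  truncated power, up to sign. Subtracting \<open>B 0\<close>, which is
  \<open>F 0\<close>-measurable, leaves the increments unchanged.\<close>

lemma (in brownian_motion) centered_brownian_motion_signed:
  fixes \<sigma> :: real assumes \<sigma>: "\<bar>\<sigma>\<bar> = 1"
  shows "centered_brownian_motion M F (\<lambda>t \<omega>. \<sigma> * (B t \<omega> - B 0 \<omega>))"
proof (intro centered_brownian_motion.intro brownian_motion.intro usual_filtered_prob_space_axioms
    brownian_motion_axioms.intro centered_brownian_motion_axioms.intro)
  let ?X = "\<lambda>t \<omega>. \<sigma> * (B t \<omega> - B 0 \<omega>)"
  show "adapted F ?X"
    unfolding adapted_def
  proof (intro allI impI)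
    fix t :: real assume "0 \<le> t"
    then have [measurable]: "B t \<in> borel_measurable (F t)" "B 0 \<in> borel_measurable (F t)"
      by (auto intro: B_measurable_F)
    show "?X t \<in> borel_measurable (F t)" by measurable
  qed
  show "continuous_process M ?X"
    unfolding continuous_process_def by (intro ballI continuous_intros path_continuous)
  show "AE \<omega> in M. ?X 0 \<omega> = 0" by simp
  show "?X 0 \<omega> = 0" for \<omega> by simp
  fix s t :: real assume st: "0 \<le> s" "s < t"
  have incr: "(\<lambda>\<omega>. ?X t \<omega> - ?X s \<omega>) = (\<lambda>\<omega>. \<sigma> * (B t \<omega> - B s \<omega>))" by (simp add: fun_eq_iff algebra_simps)
  let ?Z = "\<lambda>\<omega>. B t \<omega> - B s \<omega>"
  \<comment> \<open>Multiplication by \<sigma> is Borel, so the new increment generates no larger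
    \<sigma>-algebra than the old one and inherits its independence.\<close>
  have sub: "sets (vimage_algebra (space M) (\<lambda>\<omega>. ?X t \<omega> - ?X s \<omega>) borel) \<subseteq> sets (vimage_algebra (space M) ?Z borel)"
  proof
    fix A assume "A \<in> sets (vimage_algebra (space M) (\<lambda>\<omega>. ?X t \<omega> - ?X s \<omega>) borel)"
    then obtain C where C: "C \<in> sets borel" "A = (\<lambda>\<omega>. \<sigma> * ?Z \<omega>) -` C \<inter> space M"
      unfolding incr by (auto simp: sets_vimage_algebra2)
    have "(\<lambda>x. \<sigma> * x) \<in> borel_measurable borel" by measurable
    from measurable_sets[OF this C(1)] have "(\<lambda>x. \<sigma> * x) -` C \<in> sets borel" by simp
    from in_vimage_algebra[OF this, of ?Z "space M"] show "A \<in> sets (vimage_algebra (space M) ?Z borel)"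
      unfolding C(2) by (simp add: vimage_def)
  qed
  note ind = B_indep_increments[OF st]
  show "indep_set (sets (F s)) (sets (vimage_algebra (space M) (\<lambda>\<omega>. ?X t \<omega> - ?X s \<omega>) borel))"
  proof (rule indep_setI)
    show "sets (F s) \<subseteq> events" using st sets_F_subset by simp
    have "?Z \<in> borel_measurable M" using st by (intro borel_measurable_diff B_measurable) auto
    then have "sets (vimage_algebra (space M) ?Z borel) \<subseteq> events" by (auto simp: sets_vimage_algebra2)
    then show "sets (vimage_algebra (space M) (\<lambda>\<omega>. ?X t \<omega> - ?X s \<omega>) borel) \<subseteq> events" using sub by blast
    show "prob (A \<inter> C) = prob A * prob C"
      if "A \<in> sets (F s)" "C \<in> sets (vimage_algebra (space M) (\<lambda>\<omega>. ?X t \<omega> - ?X s \<omega>) borel)" for A C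
      using indep_setD[OF ind] that sub by blast
  qed
  have "distributed M lborel (\<lambda>\<omega>. 0 + \<sigma> * ?Z \<omega>) (normal_density (0 + \<sigma> * 0) (\<bar>\<sigma>\<bar> * sqrt (t - s)))"
    using st \<sigma> by (intro normal_density_affine B_normal_increments) auto
  then show "distributed M lborel (\<lambda>\<omega>. ?X t \<omega> - ?X s \<omega>) (normal_density 0 (sqrt (t - s)))"
    unfolding incr using \<sigma> by simp
qed

text \<open>The chain rule behind the equation. With \<open>m = 1 - \<alpha>\<close> one has
  \<open>\<beta> + 1 = 1 / m\<close>; the branch \<open>(m * z) powr (1 / m)\<close> is \<kappa>
  times the primitive of \<open>z powr \<beta>\<close>, and its power \<alpha> is \<kappa> times
  \<open>z powr \<beta>\<close>. The affine argument reaches \<open>b\<close> at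
  \<open>y = p\<close> and \<open>- a\<close> at \<open>y = - q\<close>. On the flat part both sides
  of the second identity vanish, because the power of 0 is 0 for every exponent.\<close>

lemma F_ab_affine_eq:
  fixes \<alpha> a b c y :: real
  assumes "\<alpha> < 1" "0 < a" "0 < b"
  defines "\<beta> \<equiv> \<alpha> / (1 - \<alpha>)" and "\<kappa> \<equiv> (1 - \<alpha>) powr (\<alpha> / (1 - \<alpha>))"
    and "p \<equiv> (b - c) / (1 - \<alpha>)" and "q \<equiv> (a + c) / (1 - \<alpha>)"
  shows "F_ab \<alpha> a b ((1 - \<alpha>) * y + c) = \<kappa> * ppow_prim \<beta> (y - p) - \<kappa> * ppow_prim \<beta> (- y - q)" (is ?F)
    and "\<bar>F_ab \<alpha> a b ((1 - \<alpha>) * y + c)\<bar> powr \<alpha> = \<kappa> * ppow \<beta> (y - p) + \<kappa> * ppow \<beta> (- y - q)" (is ?h)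
proof -
  define m where "m = 1 - \<alpha>"
  have m: "0 < m" using assms by (simp add: m_def)
  have \<beta>1: "\<beta> + 1 = 1 / m" using m by (simp add: \<beta>_def m_def field_simps)
  have prim: "\<kappa> * (z powr (\<beta> + 1) / (\<beta> + 1)) = (m * z) powr (1 / m)" if "0 \<le> z" for z
  proof -
    have "\<kappa> * m = m powr (\<beta> + 1)" using m by (simp add: \<kappa>_def \<beta>_def m_def powr_add)
    then have "\<kappa> * (z powr (1 / m) / (1 / m)) = m powr (1 / m) * z powr (1 / m)"
      unfolding \<beta>1 by (simp add: ac_simps)
    then show ?thesis unfolding \<beta>1 using m that by (simp add: powr_mult)
  qed
  have dens: "((m * z) powr (1 / m)) powr \<alpha> = \<kappa> * z powr \<beta>" if "0 < z" for z
    using m that by (simp add: powr_powr powr_mult \<kappa>_def \<beta>_def m_def)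
  have yp: "m * (y - p) = m * y + c - b" "m * (- y - q) = - (m * y + c + a)"
    using m by (simp_all add: p_def q_def m_def[symmetric] field_simps)
  have sgn: "0 < y - p \<longleftrightarrow> b < m * y + c" "0 < - y - q \<longleftrightarrow> m * y + c < - a"
    using yp m zero_less_mult_iff[of m "y - p"] zero_less_mult_iff[of m "- y - q"] by auto
  consider (low) "m * y + c < - a" | (mid) "- a \<le> m * y + c" "m * y + c \<le> b" | (high) "b < m * y + c" by linarith
  then have "?F \<and> ?h"
  proof cases
    case low
    then have s: "0 < - y - q" "\<not> 0 < y - p" using sgn assms by auto
    have F: "F_ab \<alpha> a b (m * y + c) = - ((m * (- y - q)) powr (1 / m))"
      using low unfolding yp by (simp add: F_ab_def m_def)
    show ?thesis
      unfolding m_def[symmetric] F using s m prim[of "- y - q"] dens[of "- y - q"]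
      by (simp add: ppow_def ppow_prim_def max_def)
  next
    case mid
    then have "\<not> 0 < - y - q" "\<not> 0 < y - p" using sgn by auto
    then show ?thesis using mid
      by (simp add: m_def[symmetric] F_ab_def ppow_def ppow_prim_def max_def)
  next
    case high
    then have s: "\<not> 0 < - y - q" "0 < y - p" using sgn assms by auto
    have F: "F_ab \<alpha> a b (m * y + c) = (m * (y - p)) powr (1 / m)"
      using high assms unfolding yp by (simp add: F_ab_def m_def)
    show ?thesis
      unfolding m_def[symmetric] F using s m prim[of "y - p"] dens[of "y - p"]
      by (simp add: ppow_def ppow_prim_def max_def)
  qed
  then show ?F ?h by auto
qed

lemma (in brownian_motion) B_measurable_augmented_natural:
  assumes "0 \<le> t" shows "B t \<in> borel_measurable (augmented_natural M B t)"
proof (rule measurableI)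
  let ?G = "{B s -` A \<inter> space M | s A. 0 \<le> s \<and> s \<le> t \<and> A \<in> sets borel} \<union> null_sets M"
  have G: "?G \<subseteq> Pow (space M)" using sets.sets_into_space by (auto simp: null_sets_def)
  have sp: "space (augmented_natural M B t) = space M"
    unfolding augmented_natural_def using G by (rule space_measure_of)
  have st: "sets (augmented_natural M B t) = sigma_sets (space M) ?G"
    unfolding augmented_natural_def using G by (rule sets_measure_of)
  fix A :: "real set" assume "A \<in> sets borel"
  then have "B t -` A \<inter> space M \<in> ?G" using assms by blast
  then show "B t -` A \<inter> space (augmented_natural M B t) \<in> sets (augmented_natural M B t)"
    unfolding sp st by (rule sigma_sets.Basic)
qed simp

theorem theorem3p5:
  fixes M :: "'w measure" and F :: "real \<Rightarrow> 'w measure" and B :: "real \<Rightarrow> 'w \<Rightarrow> real"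
    and D :: "nat \<Rightarrow> nat \<Rightarrow> real" and \<alpha> x0 a b :: real
  assumes "brownian_motion M F B"
    and "partition_sequence D"
    and "- 1 < \<alpha>" and "\<alpha> < 1"
    and "0 < a" and "0 < b"
    and "\<alpha> < 0 \<Longrightarrow> signed_power x0 (1 - \<alpha>) \<in> {- a, b} \<Longrightarrow> bounded_ratio D"
  shows "strong_solution M D B \<alpha> (F_ab \<alpha> a b (signed_power x0 (1 - \<alpha>))) (X_ab \<alpha> a b x0 B)"
proof -
  interpret brownian_motion M F B by fact
  define c where "c = signed_power x0 (1 - \<alpha>)"
  define \<beta> where "\<beta> = \<alpha> / (1 - \<alpha>)"
  define \<kappa> where "\<kappa> = (1 - \<alpha>) powr (\<alpha> / (1 - \<alpha>))"
  define p where "p = (b - c) / (1 - \<alpha>)"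
  define q where "q = (a + c) / (1 - \<alpha>)"
  have \<beta>: "- 1/2 < \<beta>" using assms(3,4) by (simp add: \<beta>_def field_simps)
  have neg: "\<alpha> < 0" if "\<beta> < 0" using that assms(4) by (simp add: \<beta>_def field_simps)
  \<comment> \<open>\<open>p = 0\<close> means \<open>c = b\<close>, and \<open>q = 0\<close> means
    \<open>c = - a\<close>: the two starting points of which the assumption on the partitions
    speaks.\<close>
  have sing_p: "bounded_ratio D" if "\<beta> < 0" "p = 0"
    using assms(7) neg[OF that(1)] that(2) assms(4) by (simp add: p_def c_def)
  have sing_q: "bounded_ratio D" if "\<beta> < 0" "q = 0"
    using assms(7) neg[OF that(1)] that(2) assms(4) by (simp add: q_def c_def add_eq_0_iff)
  define Fy where "Fy y = F_ab \<alpha> a b ((1 - \<alpha>) * y + c)" for y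
  have Fy: "Fy y = \<kappa> * ppow_prim \<beta> (y - p) - \<kappa> * ppow_prim \<beta> (- y - q)"
    "\<bar>Fy y\<bar> powr \<alpha> = \<kappa> * ppow \<beta> (y - p) + \<kappa> * ppow \<beta> (- y - q)" for y
    using F_ab_affine_eq[of \<alpha> a b y c] assms(4-6) by (simp_all add: Fy_def \<beta>_def \<kappa>_def p_def q_def)
  have X: "X_ab \<alpha> a b x0 B t \<omega> = Fy (B t \<omega>)" for t \<omega> by (simp add: X_ab_def Fy_def c_def)
  have prim_cont: "continuous_on UNIV (\<lambda>x. ppow_prim \<beta> (x - r))" for r
    using \<beta> by (intro ppow_prim_continuous) simp
  have Fy_cont: "continuous_on UNIV Fy"
    unfolding Fy(1)[abs_def]
    by (intro continuous_intros prim_cont continuous_on_compose2[OF prim_cont[of q], of UNIV uminus]) auto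
  then have [measurable]: "Fy \<in> borel_measurable borel" by (rule borel_measurable_continuous_onI)
  let ?B1 = "\<lambda>t \<omega>. B t \<omega> - B 0 \<omega>" and ?B2 = "\<lambda>t \<omega>. - (B t \<omega> - B 0 \<omega>)"
  interpret P1: partitioned_brownian_motion M F ?B1 D
    using centered_brownian_motion_signed[of 1] assms(2)
    by (simp add: partitioned_brownian_motion_def partitioned_brownian_motion_axioms_def)
  interpret P2: partitioned_brownian_motion M F ?B2 D
    using centered_brownian_motion_signed[of "-1"] assms(2)
    by (simp add: partitioned_brownian_motion_def partitioned_brownian_motion_axioms_def)
  let ?h1 = "\<lambda>y. ppow \<beta> (y - p)" and ?h2 = "\<lambda>y. ppow \<beta> (y - q)" and ?j = "part_index D"
  obtain I1 where I1: "ucp_limit M (\<lambda>n s. P1.fwd ?h1 n (?j n s)) I1"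
    using P1.ppow_ito_integral[OF \<beta> sing_p] by blast
  obtain I2 where I2: "ucp_limit M (\<lambda>n s. P2.fwd ?h2 n (?j n s)) I2"
    using P2.ppow_ito_integral[OF \<beta> sing_q] by blast
  note T1 = P1.ppow_trapezoidal_sums[OF \<beta> sing_p]
  note T2 = P2.ppow_trapezoidal_sums[OF \<beta> sing_q]
  \<comment> \<open>The minus sign arises because the increments of \<open>?B2\<close> are those of
    \<open>B\<close> with opposite sign.\<close>
  define I where "I t \<omega> = \<kappa> * I1 t \<omega> + (- \<kappa>) * I2 t \<omega>" for t \<omega>
  have I: "ucp_limit M (\<lambda>n t \<omega>. \<kappa> * P1.fwd ?h1 n (?j n t) \<omega> + (- \<kappa>) * P2.fwd ?h2 n (?j n t) \<omega>) I"
    unfolding I_def[abs_def] by (intro ucp_limit_add ucp_limit_cmult I1 I2)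
  define G where "G t \<omega> = \<kappa> * (ppow_prim \<beta> (?B1 t \<omega> - p) - ppow_prim \<beta> (0 - p)) +
      (- \<kappa>) * (ppow_prim \<beta> (?B2 t \<omega> - q) - ppow_prim \<beta> (0 - q))" for t \<omega>
  have G: "ucp_limit M (\<lambda>n t \<omega>. \<kappa> * ((P1.fwd ?h1 n (?j n t) \<omega> + P1.bwd ?h1 n (?j n t) \<omega>) / 2) +
      (- \<kappa>) * ((P2.fwd ?h2 n (?j n t) \<omega> + P2.bwd ?h2 n (?j n t) \<omega>) / 2)) G"
    unfolding G_def[abs_def] by (intro ucp_limit_add ucp_limit_cmult T1 T2)
  \<comment> \<open>Backward minus forward sums are the covariation sums, and they equal twice the
    trapezoidal sums minus twice the forward sums.\<close>
  define C where "C t \<omega> = 2 * G t \<omega> + (- 2) * I t \<omega>" for t \<omega>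
  have C: "ucp_limit M (\<lambda>n t \<omega>. 2 * (\<kappa> * ((P1.fwd ?h1 n (?j n t) \<omega> + P1.bwd ?h1 n (?j n t) \<omega>) / 2) +
      (- \<kappa>) * ((P2.fwd ?h2 n (?j n t) \<omega> + P2.bwd ?h2 n (?j n t) \<omega>) / 2)) +
      (- 2) * (\<kappa> * P1.fwd ?h1 n (?j n t) \<omega> + (- \<kappa>) * P2.fwd ?h2 n (?j n t) \<omega>)) C"
    unfolding C_def[abs_def] by (intro ucp_limit_add ucp_limit_cmult G I)
  let ?Y = "\<lambda>t \<omega>. \<bar>X_ab \<alpha> a b x0 B t \<omega>\<bar> powr \<alpha>"
  have Y: "?Y t \<omega> = \<kappa> * ?h1 (?B1 t \<omega>) + \<kappa> * ?h2 (?B2 t \<omega>)" if "B 0 \<omega> = 0" for t \<omega>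
    using Fy(2)[of "B t \<omega>"] that by (simp add: X)
  have ito: "has_ito_integral M D ?Y B I"
    unfolding has_ito_integral_def
  proof (rule ucp_limit_cong_AE[OF I], use B_start in eventually_elim, intro allI impI)
    fix \<omega> n and t :: real assume \<omega>: "B 0 \<omega> = 0"
    show "\<kappa> * P1.fwd ?h1 n (?j n t) \<omega> + (- \<kappa>) * P2.fwd ?h2 n (?j n t) \<omega> =
        (\<Sum>k | D n k < t. ?Y (D n k) \<omega> * (B (D n (Suc k)) \<omega> - B (D n k) \<omega>))"
      unfolding before_eq_lessThan[OF assms(2)] P1.fwd_def P2.fwd_def P1.dB_def P2.dB_def
        sum_distrib_left sum.distrib[symmetric]
      by (intro sum.cong refl) (simp only: Y[OF \<omega>] \<omega>, simp add: algebra_simps)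
  qed
  have cov: "has_covariation M D ?Y B C"
    unfolding has_covariation_def
  proof (rule ucp_limit_cong_AE[OF C], use B_start in eventually_elim, intro allI impI)
    fix \<omega> n and t :: real assume \<omega>: "B 0 \<omega> = 0"
    let ?J = "?j n t"
    have "2 * (\<kappa> * ((P1.fwd ?h1 n ?J \<omega> + P1.bwd ?h1 n ?J \<omega>) / 2) + (- \<kappa>) * ((P2.fwd ?h2 n ?J \<omega> + P2.bwd ?h2 n ?J \<omega>) / 2)) +
        (- 2) * (\<kappa> * P1.fwd ?h1 n ?J \<omega> + (- \<kappa>) * P2.fwd ?h2 n ?J \<omega>) =
        \<kappa> * P1.bwd ?h1 n ?J \<omega> - \<kappa> * P2.bwd ?h2 n ?J \<omega> - (\<kappa> * P1.fwd ?h1 n ?J \<omega> - \<kappa> * P2.fwd ?h2 n ?J \<omega>)"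
      by (simp add: field_simps)
    also have "\<dots> = (\<Sum>k | D n k < t. (?Y (D n (Suc k)) \<omega> - ?Y (D n k) \<omega>) * (B (D n (Suc k)) \<omega> - B (D n k) \<omega>))"
      unfolding before_eq_lessThan[OF assms(2)] P1.fwd_def P2.fwd_def P1.bwd_def P2.bwd_def P1.dB_def P2.dB_def
        sum_distrib_left sum_subtractf[symmetric]
      by (intro sum.cong refl) (simp only: Y[OF \<omega>] \<omega>, simp add: algebra_simps)
    finally show "2 * (\<kappa> * ((P1.fwd ?h1 n ?J \<omega> + P1.bwd ?h1 n ?J \<omega>) / 2) + (- \<kappa>) * ((P2.fwd ?h2 n ?J \<omega> + P2.bwd ?h2 n ?J \<omega>) / 2)) +
        (- 2) * (\<kappa> * P1.fwd ?h1 n ?J \<omega> + (- \<kappa>) * P2.fwd ?h2 n ?J \<omega>) =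
        (\<Sum>k | D n k < t. (?Y (D n (Suc k)) \<omega> - ?Y (D n k) \<omega>) * (B (D n (Suc k)) \<omega> - B (D n k) \<omega>))" .
  qed
  have "has_stratonovich_integral M D ?Y B (\<lambda>t \<omega>. I t \<omega> + C t \<omega> / 2)"
    unfolding has_stratonovich_integral_def using ito cov by blast
  moreover have "AE \<omega> in M. X_ab \<alpha> a b x0 B t \<omega> = F_ab \<alpha> a b c + (I t \<omega> + C t \<omega> / 2)" for t
    using B_start
  proof eventually_elim
    case (elim \<omega>)
    \<comment> \<open>The Ito integral cancels, which is why its limit could remain
      implicit.\<close>
    have "I t \<omega> + C t \<omega> / 2 = G t \<omega>" by (simp add: C_def diff_divide_distrib)
    also have "\<dots> = Fy (B t \<omega>) - Fy 0" by (simp add: G_def Fy(1) elim algebra_simps)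
    finally show ?case by (simp add: X Fy_def)
  qed
  moreover have "continuous_process M (X_ab \<alpha> a b x0 B)"
    unfolding continuous_process_def X
    by (intro ballI continuous_on_compose2[OF Fy_cont path_continuous]) auto
  moreover have "adapted (augmented_natural M B) (X_ab \<alpha> a b x0 B)"
    unfolding adapted_def X[abs_def]
  proof (intro allI impI)
    fix t :: real assume "0 \<le> t"
    note [measurable] = B_measurable_augmented_natural[OF this]
    show "(\<lambda>\<omega>. Fy (B t \<omega>)) \<in> borel_measurable (augmented_natural M B t)" by measurable
  qed
  ultimately show ?thesis unfolding strong_solution_def c_def[symmetric] by blast
qed

end
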